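(* Fix an integer $p\geq 2$, a unit vector $\theta_1^0\in\mathbb{R}^p$, $v>0$ and a bounded positive real sequence $(r_n)$. For a positive real sequence $(\nu_n)$ and a bounded sequence $(\tau_n)$ in $\mathbb{R}^p$ such that $\theta_1^0+\nu_n\tau_n$ is a unit vector for every $n$, let $$\Lambda_n:=\log\frac{d\mathrm{P}_{\theta_1^0+\nu_n\tau_n,r_n,v}}{d\mathrm{P}_{\theta_1^0,r_n,v}}.$$ Then, under $\mathrm{P}_{\theta_1^0,r_n,v}$ (with $\Sigma_n=I_p+r_nv\,\theta_1^0\theta_1^{0\prime}$), the following hold as $n\to\infty$, for any such $(\tau_n)$: (i) if $r_n\equiv1$, then, with $\nu_n=1/\sqrt n$, $$\Delta_n=\frac{v}{1+v}\sqrt n\,(I_p-\theta_1^0\theta_1^{0\prime})(S_n-\Sigma_n)\theta_1^0\quad\text{and}\quad\Gamma=\frac{v^2}{1+v}(I_p-\theta_1^0\theta_1^{0\prime}),$$ we have $\Lambda_n=\tau_n'\Delta_n-\frac12\tau_n'\Gamma\tau_n+o_{\rm P}(1)$, and $\Delta_n$ is asymptotically normal with mean zero and covariance matrix $\Gamma$; (ii) if $r_n=o(1)$ with $\sqrt n\,r_n\to\infty$, then, with $\nu_n=1/(\sqrt n\,r_n)$, $$\Delta_n=v\sqrt n\,(I_p-\theta_1^0\theta_1^{0\prime})(S_n-\Sigma_n)\theta_1^0\quad\text{and}\quad\Gamma=v^2(I_p-\theta_1^0\theta_1^{0\prime}),$$ we have $\Lambda_n=\tau_n'\Delta_n-\frac12\tau_n'\Gamma\tau_n+o_{\rm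 P}(1)$, and $\Delta_n$ is asymptotically normal with mean zero and covariance matrix $\Gamma$; (iii) if $r_n=1/\sqrt n$, then, with $\nu_n\equiv1$, $$\Lambda_n=\tau_n'\Big[v\sqrt n\,(S_n-\Sigma_n)\Big(\theta_1^0+\frac12\tau_n\Big)\Big]-\frac{v^2}{2}\|\tau_n\|^2+\frac{v^2}{8}\|\tau_n\|^4+o_{\rm P}(1),$$ where, if $\tau_n\to\tau$, then $\tau_n'\sqrt n(S_n-\Sigma_n)(\theta_1^0+\frac12\tau_n)$ is asymptotically normal with mean zero and variance $\|\tau\|^2-\frac14\|\tau\|^4$; (iv) if $r_n=o(1/\sqrt n)$, then, even with $\nu_n\equiv1$, $\Lambda_n=o_{\rm P}(1)$.
   Context: Model: for a unit vector $\theta_1\in\mathbb{R}^p$, $v>0$ and a positive sequence $(r_n)$, $\mathrm{P}_{\theta_1,r_n,v}=\mathrm{P}^{(n)}_{\theta_1,r_n,v}$ denotes the joint distribution of $X_{n1},\ldots,X_{nn}$ when these are i.i.d. $p$-variate normal with mean $0$ and covariance matrix $I_p+r_nv\,\theta_1\theta_1'$ (a triangular array; the dimension $p$ is fixed). Prime denotes transpose. The sample covariance matrix is $S_n=\frac1n\sum_{i=1}^n(X_{ni}-\bar X_n)(X_{ni}-\bar X_n)'$ with $\bar X_n=\frac1n\sum_{i=1}^nX_{ni}$. The log-likelihood ratio $\Lambda_n$ is evaluated at the sample $(X_{n1},\ldots,X_{nn})$. The constraint that $\theta_1^0+\nu_n\tau_n$ is a unit vector is equivalent to $\theta_1^{0\prime}\tau_n=-\frac{\nu_n}{2}\|\tau_n\|^2$.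 *)

theory Defs
  imports "HOL-Probability.Probability"
begin

definition outer :: "real ^ 'p \<Rightarrow> real ^ 'p \<Rightarrow> real ^ 'p ^ 'p" where
  "outer x y = (\<chi> i j. x $ i * y $ j)"

definition pos_semidef :: "real ^ 'p ^ 'p \<Rightarrow> bool" where
  "pos_semidef A \<longleftrightarrow> transpose A = A \<and> (\<forall>x. 0 \<le> x \<bullet> (A *v x))"

text \<open>The positive semidefinite square root; it is unique when it exists. Existence and uniqueness
  for all the covariance matrices occurring in the model are shown in \<open>psd_sqrt_spiked\<close> below.\<close>

definition psd_sqrt :: "real ^ 'p ^ 'p \<Rightarrow> real ^ 'p ^ 'p" where
  "psd_sqrt \<Sigma> = (SOME A. pos_semidef A \<and> A ** A = \<Sigma>)"

definition std_normal_vec :: "(real ^ 'p) measure" where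
  "std_normal_vec = distr (\<Pi>\<^sub>M i\<in>UNIV. std_normal_distribution) borel (\<lambda>z. \<chi> i. z i)"

text \<open>The normal law with mean \<open>\<mu>\<close> and (possibly singular) covariance matrix \<open>\<Sigma>\<close> is the law of
  \<open>\<mu> + \<Sigma>\<^sup>1\<^sup>/\<^sup>2 Z\<close> with \<open>Z\<close> having independent standard normal coordinates.\<close>

definition mv_normal :: "real ^ 'p \<Rightarrow> real ^ 'p ^ 'p \<Rightarrow> (real ^ 'p) measure" where
  "mv_normal \<mu> \<Sigma> = distr std_normal_vec borel (\<lambda>z. \<mu> + psd_sqrt \<Sigma> *v z)"

text \<open>In dimension one the second parameter is the variance; variance \<open>0\<close> gives a point mass.\<close>

definition normal_law :: "real \<Rightarrow> real \<Rightarrow> real measure" where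
  "normal_law m s = distr std_normal_distribution borel (\<lambda>z. m + sqrt s * z)"

definition is_oP1 :: "(nat \<Rightarrow> 'a measure) \<Rightarrow> (nat \<Rightarrow> 'a \<Rightarrow> real) \<Rightarrow> bool" where
  "is_oP1 M X \<longleftrightarrow> (\<forall>n. X n \<in> borel_measurable (M n)) \<and>
     (\<forall>\<epsilon>>0. (\<lambda>n. measure (M n) {\<omega> \<in> space (M n). \<bar>X n \<omega>\<bar> > \<epsilon>}) \<longlonglongrightarrow> 0)"

definition conv_in_distr ::
    "(nat \<Rightarrow> 'a measure) \<Rightarrow> (nat \<Rightarrow> 'a \<Rightarrow> 'b::topological_space) \<Rightarrow> 'b measure \<Rightarrow> bool" where
  "conv_in_distr M X L \<longleftrightarrow> (\<forall>n. X n \<in> borel_measurable (M n)) \<and>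
     (\<forall>f::'b \<Rightarrow> real. continuous_on UNIV f \<longrightarrow> bounded (range f) \<longrightarrow>
        (\<lambda>n. \<integral>\<omega>. f (X n \<omega>) \<partial>M n) \<longlonglongrightarrow> (\<integral>x. f x \<partial>L))"

text \<open>For real random variables this is the library's convergence of distribution functions.\<close>

lemma conv_in_distr_iff_weak_conv_m:
  fixes X :: "nat \<Rightarrow> 'a \<Rightarrow> real"
  assumes M: "\<And>n. prob_space (M n)" and X: "\<And>n. X n \<in> borel_measurable (M n)"
    and L: "real_distribution L"
  shows "conv_in_distr M X L \<longleftrightarrow> weak_conv_m (\<lambda>n. distr (M n) borel (X n)) L"
proof -
  have D: "real_distribution (distr (M n) borel (X n))" for n
    using prob_space.real_distribution_distr[OF M X] .
  have I: "(\<integral>x. f x \<partial>distr (M n) borel (X n)) = (\<integral>\<omega>. f (X n \<omega>) \<partial>M n)"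
    if "continuous_on UNIV f" for f :: "real \<Rightarrow> real" and n
    using X that by (intro integral_distr) (auto intro: borel_measurable_continuous_onI)
  show ?thesis
  proof
    assume C: "conv_in_distr M X L"
    show "weak_conv_m (\<lambda>n. distr (M n) borel (X n)) L"
    proof (rule integral_bdd_continuous_conv_imp_weak_conv[OF D L])
      fix f :: "real \<Rightarrow> real"
      assume f: "\<And>x. isCont f x" "\<And>x. \<bar>f x\<bar> \<le> 1"
      have c: "continuous_on UNIV f" using f by (simp add: continuous_on_eq_continuous_at)
      have "bounded (range f)" using f(2) by (auto simp: bounded_iff)
      then show "(\<lambda>n. integral\<^sup>L (distr (M n) borel (X n)) f) \<longlonglongrightarrow> integral\<^sup>L L f"
        using C c unfolding conv_in_distr_def by (simp add: I[OF c])
    qed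
  next
    assume W: "weak_conv_m (\<lambda>n. distr (M n) borel (X n)) L"
    show "conv_in_distr M X L"
      unfolding conv_in_distr_def
    proof (intro conjI allI impI X)
      fix f :: "real \<Rightarrow> real"
      assume c: "continuous_on UNIV f" and b: "bounded (range f)"
      obtain B where B: "\<And>x. norm (f x) \<le> B" using b by (auto simp: bounded_iff)
      have "(\<lambda>n. integral\<^sup>L (distr (M n) borel (X n)) f) \<longlonglongrightarrow> integral\<^sup>L L f"
        using c by (intro weak_conv_imp_integral_bdd_continuous_conv[OF D L W _ B])
          (auto simp: continuous_on_eq_continuous_at)
      then show "(\<lambda>n. \<integral>\<omega>. f (X n \<omega>) \<partial>M n) \<longlonglongrightarrow> (\<integral>x. f x \<partial>L)"
        by (simp add: I[OF c])
    qed
  qed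
qed

definition spiked_cov :: "real ^ 'p \<Rightarrow> real \<Rightarrow> real \<Rightarrow> real ^ 'p ^ 'p" where
  "spiked_cov \<theta> \<rho> v = mat 1 + (\<rho> * v) *\<^sub>R outer \<theta> \<theta>"

text \<open>Observations are indexed by \<open>{1..n}\<close>; \<open>PiM\<close> makes them independent.\<close>

definition sample_law :: "nat \<Rightarrow> real ^ 'p \<Rightarrow> real \<Rightarrow> real \<Rightarrow> (nat \<Rightarrow> real ^ 'p) measure" where
  "sample_law n \<theta> \<rho> v = (\<Pi>\<^sub>M i\<in>{1..n}. mv_normal 0 (spiked_cov \<theta> \<rho> v))"

definition sample_mean :: "nat \<Rightarrow> (nat \<Rightarrow> real ^ 'p) \<Rightarrow> real ^ 'p" where
  "sample_mean n x = (1 / real n) *\<^sub>R (\<Sum>i\<in>{1..n}. x i)"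

definition sample_cov :: "nat \<Rightarrow> (nat \<Rightarrow> real ^ 'p) \<Rightarrow> real ^ 'p ^ 'p" where
  "sample_cov n x =
     (1 / real n) *\<^sub>R (\<Sum>i\<in>{1..n}. outer (x i - sample_mean n x) (x i - sample_mean n x))"

text \<open>\<open>log dP\<^sub>1/dP\<^sub>0\<close> with \<open>P\<^sub>1\<close>, \<open>P\<^sub>0\<close> the sample laws at \<open>\<theta> + \<nu> \<tau>\<close> and \<open>\<theta>\<close>. Note that \<open>RN_deriv\<close> takes
  the dominating measure first.\<close>

definition log_lik_ratio ::
    "real ^ 'p \<Rightarrow> (nat \<Rightarrow> real) \<Rightarrow> real \<Rightarrow> (nat \<Rightarrow> real) \<Rightarrow> (nat \<Rightarrow> real ^ 'p) \<Rightarrow>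
     nat \<Rightarrow> (nat \<Rightarrow> real ^ 'p) \<Rightarrow> real" where
  "log_lik_ratio \<theta> r v \<nu> \<tau> n x =
     ln (enn2real (RN_deriv (sample_law n \<theta> (r n) v)
                            (sample_law n (\<theta> + \<nu> n *\<^sub>R \<tau> n) (r n) v) x))"

text \<open>Sequences are indexed from \<open>n = 1\<close>; their values at \<open>0\<close> are irrelevant.\<close>

definition admissible ::
    "real ^ 'p \<Rightarrow> (nat \<Rightarrow> real) \<Rightarrow> (nat \<Rightarrow> real ^ 'p) \<Rightarrow> bool" where
  "admissible \<theta> \<nu> \<tau> \<longleftrightarrow> bounded (\<tau> ` {1..}) \<and> (\<forall>n\<ge>1. norm (\<theta> + \<nu> n *\<^sub>R \<tau> n) = 1)"

lemma outer_mult_vec: "outer x y *v z = (y \<bullet> z) *\<^sub>R x"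
  by (simp add: outer_def matrix_vector_mult_def vec_eq_iff inner_vec_def sum_distrib_left
      sum_distrib_right ac_simps)

lemma scaleR_matrix_mult_vec: "(c *\<^sub>R A) *v (x::real^'p) = c *\<^sub>R (A *v x)"
  by (rule scaleR_matrix_vector_assoc[symmetric])

lemma psd_sqrt_eigen:
  assumes B: "pos_semidef B" and BB: "B ** B = \<Sigma>"
    and x: "\<Sigma> *v x = a *\<^sub>R x" and a: "a \<ge> 0"
  shows "B *v x = sqrt a *\<^sub>R (x :: real ^ 'p)"
proof -
  have sym: "(B *v u) \<bullet> w = u \<bullet> (B *v w)" for u w
    using B by (metis dot_lmul_matrix pos_semidef_def transpose_matrix_vector)
  have BBx: "B *v (B *v x) = a *\<^sub>R x" using BB x by (simp add: matrix_vector_mul_assoc)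
  define y where "y = B *v x - sqrt a *\<^sub>R x"
  have By: "B *v y = - sqrt a *\<^sub>R y"
    using a by (simp add: y_def matrix_vector_mult_diff_distrib BBx matrix_vector_mult_scaleR
        scaleR_diff_right)
  have "y = 0"
  proof (cases "a = 0")
    case True
    have "(B *v x) \<bullet> (B *v x) = x \<bullet> (B *v (B *v x))" by (rule sym)
    also have "\<dots> = 0" using BBx True by simp
    finally show ?thesis using True by (simp add: y_def)
  next
    case False
    have "0 \<le> y \<bullet> (B *v y)" using B by (simp add: pos_semidef_def)
    also have "\<dots> = - (sqrt a * (y \<bullet> y))" by (simp add: By)
    finally have "sqrt a * (y \<bullet> y) \<le> 0" by simp
    moreover have "sqrt a > 0" using False a by simp
    ultimately have "y \<bullet> y \<le> 0" by (simp add: mult_le_0_iff)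
    then show ?thesis by (metis inner_ge_zero inner_eq_zero_iff order_antisym)
  qed
  then show ?thesis by (simp add: y_def)
qed

lemma psd_sqrt_spiked:
  fixes \<theta> :: "real ^ 'p"
  assumes \<theta>: "norm \<theta> = 1" and ab: "a \<ge> 0" "b \<ge> 0"
  defines "P \<equiv> mat 1 - outer \<theta> \<theta>" and "Q \<equiv> outer \<theta> \<theta>"
  shows "psd_sqrt (a *\<^sub>R P + b *\<^sub>R Q) = sqrt a *\<^sub>R P + sqrt b *\<^sub>R Q"
    and "pos_semidef (sqrt a *\<^sub>R P + sqrt b *\<^sub>R Q)"
    and "(sqrt a *\<^sub>R P + sqrt b *\<^sub>R Q) ** (sqrt a *\<^sub>R P + sqrt b *\<^sub>R Q) = a *\<^sub>R P + b *\<^sub>R Q"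
proof -
  have tt: "\<theta> \<bullet> \<theta> = 1" using \<theta> by (simp add: dot_square_norm)
  have act: "(c *\<^sub>R P + d *\<^sub>R Q) *v x = c *\<^sub>R (x - (\<theta> \<bullet> x) *\<^sub>R \<theta>) + d *\<^sub>R ((\<theta> \<bullet> x) *\<^sub>R \<theta>)" for c d x
    by (simp add: P_def Q_def matrix_vector_mult_add_rdistrib scaleR_matrix_mult_vec
        matrix_vector_mult_diff_rdistrib outer_mult_vec)
  let ?R = "sqrt a *\<^sub>R P + sqrt b *\<^sub>R Q"
  have "transpose ?R = ?R"
    by (simp add: P_def Q_def transpose_def vec_eq_iff outer_def mat_def mult.commute)
  moreover have "0 \<le> x \<bullet> (?R *v x)" for x
  proof -
    have "(\<theta> \<bullet> x)\<^sup>2 \<le> x \<bullet> x"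
      using Cauchy_Schwarz_ineq[of \<theta> x] tt by simp
    moreover have "x \<bullet> (?R *v x) = sqrt a * (x \<bullet> x - (\<theta> \<bullet> x)\<^sup>2) + sqrt b * (\<theta> \<bullet> x)\<^sup>2"
      by (simp add: act inner_add_right inner_diff_right power2_eq_square inner_commute)
    ultimately show ?thesis using ab by simp
  qed
  ultimately show psd: "pos_semidef ?R" by (simp add: pos_semidef_def)
  have "?R *v (?R *v x) = (a *\<^sub>R P + b *\<^sub>R Q) *v x" for x
    using ab by (simp add: act inner_add_right inner_diff_right tt)
  then show sq: "?R ** ?R = a *\<^sub>R P + b *\<^sub>R Q"
    by (simp add: matrix_eq matrix_vector_mul_assoc)
  have uniq: "B = ?R" if B: "pos_semidef B \<and> B ** B = a *\<^sub>R P + b *\<^sub>R Q" for B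
  proof -
    have "B *v x = ?R *v x" for x
    proof -
      let ?p = "x - (\<theta> \<bullet> x) *\<^sub>R \<theta>"
      have "(a *\<^sub>R P + b *\<^sub>R Q) *v ?p = a *\<^sub>R ?p" "(a *\<^sub>R P + b *\<^sub>R Q) *v \<theta> = b *\<^sub>R \<theta>"
        by (simp_all add: act inner_diff_right tt)
      then have "B *v ?p = sqrt a *\<^sub>R ?p" "B *v \<theta> = sqrt b *\<^sub>R \<theta>"
        using psd_sqrt_eigen B ab by blast+
      moreover have "B *v x = B *v ?p + (\<theta> \<bullet> x) *\<^sub>R (B *v \<theta>)"
        by (simp add: matrix_vector_mult_diff_distrib matrix_vector_mult_scaleR)
      ultimately show ?thesis by (simp add: act)
    qed
    then show ?thesis by (simp add: matrix_eq)
  qed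
  show "psd_sqrt (a *\<^sub>R P + b *\<^sub>R Q) = ?R"
    unfolding psd_sqrt_def using psd sq uniq by (intro some_equality conjI)
qed

end

theory Submission imports Defs begin

text \<open>
  The proof rests on two facts about Gaussian data: the log-likelihood ratio is an explicit quadratic
  form in the sample covariance matrix, and the statistics that have to be asymptotically normal are
  exactly scale mixtures of normal vectors.

  Write \<open>\<theta>' = \<theta> + \<nu>\<tau>\<close>. The matrices \<open>I + r v \<theta>\<theta>\<^sup>T\<close> and \<open>I + r v \<theta>'\<theta>'\<^sup>T\<close> have the same determinant, and
  their inverses differ only in the direction of the spike, so that
  \<open>\<Lambda> = r v / (2 (1 + r v)) \<Sum>\<^sub>i ((\<theta>' \<bullet> x\<^sub>i)\<^sup>2 - (\<theta> \<bullet> x\<^sub>i)\<^sup>2)\<close> (\<open>AE_log_lik_ratio\<close>). Expanding the squares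
  around \<open>\<Sigma>\<close> with \<open>H = \<surd>n (S - \<Sigma>)\<close> and \<open>\<theta> \<bullet> \<tau> = - \<nu> |\<tau>|\<^sup>2 / 2\<close> gives, with \<open>\<kappa> = \<surd>n r \<nu>\<close> and
  \<open>c = v / (1 + r v)\<close>,
  \<open>\<Lambda> = \<kappa>\<^sup>2 v c / 2 (- |\<tau>|\<^sup>2 + \<nu>\<^sup>2 |\<tau>|\<^sup>4 / 4) + \<kappa> c / 2 (2 \<tau> \<bullet> H \<theta> + \<nu> \<tau> \<bullet> H \<tau>)\<close>
  up to a term of order \<open>\<kappa> n |mean|\<^sup>2 / \<surd>n\<close> (\<open>log_lik_ratio_expansion\<close>). The four regimes are the
  four ways in which this expression can behave: \<open>\<kappa> = 1\<close> in the first three of them, with \<open>\<nu> \<rightarrow> 0\<close> in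
  the first two and \<open>\<nu> = 1\<close> in the third, whereas \<open>\<kappa> \<rightarrow> 0\<close> in the last one. All remainders are bounded
  by a null sequence times the single random variable \<open>fluct\<close>, whose expectation is bounded
  (\<open>fluct_bounded_expectation\<close>), so Markov's inequality makes them \<open>o\<^sub>P(1)\<close>.

  For the limit laws, the data are split as \<open>x\<^sub>i = s \<zeta>\<^sub>i \<theta> + P y\<^sub>i\<close> with \<open>s\<^sup>2 = 1 + r v\<close>, \<open>P\<close> the projection
  orthogonal to \<open>\<theta>\<close> and independent standard normal \<open>\<zeta>\<^sub>i\<close>, \<open>y\<^sub>i\<close>. Then \<open>\<surd>n P (S - \<Sigma>) \<theta>\<close> equals
  \<open>s P (\<Sum>\<^sub>i w\<^sub>i y\<^sub>i)\<close> with weights \<open>w\<^sub>i = (\<zeta>\<^sub>i - mean \<zeta>) / \<surd>n\<close> that depend on \<open>\<zeta>\<close> only. Given \<open>\<zeta>\<close>, this is a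
  centred normal vector scaled by the square root of the sample variance of \<open>\<zeta>\<close>
  (\<open>weighted_gauss_mixture\<close>), and that sample variance tends to 1 in mean. Dominated convergence then
  yields the limit law for arbitrary bounded continuous test functions
  (\<open>scale_mixture_limit\<close>), which avoids any multivariate central limit theorem. In the third regime
  the same exact law holds for unspiked data because \<open>\<tau>\<close> is orthogonal to \<open>\<theta> + \<tau>/2\<close>; passing to the
  spiked data costs a null sequence times \<open>fluct\<close>, which characteristic functions absorb.

  Both facts come from the invariance of the standard normal law under linear isometries
  (\<open>gauss_isometry_invariant\<close>), which is derived from the uniqueness of translation-invariant measures.
\<close>

section \<open>Isometry invariance of Lebesgue measure\<close>

text \<open>Uniqueness of Haar measure in the form needed below. Integrating \<open>1\<^sub>A(x + y) 1\<^sub>B(y)\<close> against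
  \<open>\<mu> \<otimes> \<lambda>\<close> in the two possible orders gives \<open>\<mu>(A) \<lambda>(B) = \<lambda>(A) \<mu>(-B)\<close>; for the unit ball \<open>B = -B\<close> the two
  normalising factors agree.\<close>

lemma translation_invariant_unique:
  fixes \<mu> :: "'a::euclidean_space measure"
  assumes sets [measurable_cong, simp]: "sets \<mu> = sets borel" and sf: "sigma_finite_measure \<mu>"
    and inv: "\<And>c. distr \<mu> borel ((+) c) = \<mu>"
    and ball: "emeasure \<mu> (cball 0 1) = emeasure lborel (cball (0::'a) 1)"
  shows "\<mu> = lborel"
proof (rule measure_eqI)
  show "sets \<mu> = sets lborel" by simp
  fix A assume "A \<in> sets \<mu>"
  then have A [measurable]: "A \<in> sets borel" by simp
  interpret \<mu>: sigma_finite_measure \<mu> by fact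
  interpret pair_sigma_finite \<mu> "lborel :: 'a measure" ..
  let ?B = "cball (0::'a) 1"
  have [measurable]: "?B \<in> sets borel" by simp
  have space [simp]: "space \<mu> = UNIV" using sets_eq_imp_space_eq[OF sets] by simp
  have inv': "emeasure M ((\<lambda>x. c + x) -` X) = emeasure M X"
    if "distr M borel ((+) c) = M" "X \<in> sets borel" "space M = UNIV" "sets M = sets borel"
    for M :: "'a measure" and c X
  proof -
    have [measurable_cong]: "sets M = sets borel" by fact
    have "emeasure M X = emeasure (distr M borel ((+) c)) X" using that by simp
    also have "\<dots> = emeasure M ((\<lambda>x. c + x) -` X)"
      using that by (subst emeasure_distr) (auto simp: measurable_cong_sets[OF that(4) refl])
    finally show ?thesis by simp
  qed
  \<comment> \<open>Integrating over \<open>x\<close> first removes the shift from \<open>A\<close>; integrating over \<open>y\<close> first moves it to the ball.\<close>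
  have 1: "(\<integral>\<^sup>+x. \<integral>\<^sup>+y. indicator A (x + y) * indicator ?B y \<partial>lborel \<partial>\<mu>) =
      emeasure \<mu> A * emeasure lborel ?B"
  proof -
    have "(\<integral>\<^sup>+x. \<integral>\<^sup>+y. indicator A (x + y) * indicator ?B y \<partial>lborel \<partial>\<mu>) =
        (\<integral>\<^sup>+y. \<integral>\<^sup>+x. indicator A (x + y) * indicator ?B y \<partial>\<mu> \<partial>lborel)"
      by (rule Fubini'[symmetric]) measurable
    also have "\<dots> = (\<integral>\<^sup>+y. emeasure \<mu> A * indicator ?B y \<partial>lborel)"
    proof (rule nn_integral_cong)
      fix y :: 'a
      have "(\<integral>\<^sup>+x. indicator A (x + y) \<partial>\<mu>) = (\<integral>\<^sup>+x. indicator ((\<lambda>x. y + x) -` A) x \<partial>\<mu>)"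
        by (rule nn_integral_cong) (simp add: indicator_def add.commute)
      also have "\<dots> = emeasure \<mu> ((\<lambda>x. y + x) -` A)"
        by (rule nn_integral_indicator) (auto simp: measurable_sets_borel[OF _ A])
      also have "\<dots> = emeasure \<mu> A" by (rule inv') (auto simp: inv)
      finally show "(\<integral>\<^sup>+x. indicator A (x + y) * indicator ?B y \<partial>\<mu>) = emeasure \<mu> A * indicator ?B y"
        by (subst nn_integral_multc) auto
    qed
    also have "\<dots> = emeasure \<mu> A * emeasure lborel ?B" by (subst nn_integral_cmult) auto
    finally show ?thesis .
  qed
  have 2: "(\<integral>\<^sup>+x. \<integral>\<^sup>+y. indicator A (x + y) * indicator ?B y \<partial>lborel \<partial>\<mu>) =
      emeasure lborel A * emeasure \<mu> ?B"
  proof -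
    have "(\<integral>\<^sup>+x. \<integral>\<^sup>+y. indicator A (x + y) * indicator ?B y \<partial>lborel \<partial>\<mu>) =
        (\<integral>\<^sup>+x. \<integral>\<^sup>+y. indicator A y * indicator ?B (y - x) \<partial>lborel \<partial>\<mu>)"
    proof (rule nn_integral_cong)
      fix x :: 'a
      have "(\<integral>\<^sup>+y. indicator A y * indicator ?B (y - x) \<partial>lborel) =
          (\<integral>\<^sup>+y. indicator A y * indicator ?B (y - x) \<partial>distr lborel borel ((+) x))"
        by (subst lborel_distr_plus) simp
      also have "\<dots> = (\<integral>\<^sup>+y. indicator A (x + y) * indicator ?B y \<partial>lborel)"
        by (subst nn_integral_distr) auto
      finally show "(\<integral>\<^sup>+y. indicator A (x + y) * indicator ?B y \<partial>lborel) =
          (\<integral>\<^sup>+y. indicator A y * indicator ?B (y - x) \<partial>lborel)" by simp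
    qed
    also have "\<dots> = (\<integral>\<^sup>+y. \<integral>\<^sup>+x. indicator A y * indicator ?B (y - x) \<partial>\<mu> \<partial>lborel)"
      by (rule Fubini'[symmetric]) measurable
    also have "\<dots> = (\<integral>\<^sup>+y. indicator A y * emeasure \<mu> ?B \<partial>lborel)"
    proof (rule nn_integral_cong)
      fix y :: 'a
      have "(\<integral>\<^sup>+x. indicator ?B (y - x) \<partial>\<mu>) = (\<integral>\<^sup>+x. indicator ((\<lambda>x. - y + x) -` ?B) x \<partial>\<mu>)"
        by (rule nn_integral_cong) (simp add: indicator_def dist_norm norm_minus_commute)
      also have "\<dots> = emeasure \<mu> ((\<lambda>x. - y + x) -` ?B)"
        by (rule nn_integral_indicator) (auto simp: measurable_sets_borel[of _ borel])
      also have "\<dots> = emeasure \<mu> ?B" by (rule inv') (auto simp: inv)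
      finally show "(\<integral>\<^sup>+x. indicator A y * indicator ?B (y - x) \<partial>\<mu>) = indicator A y * emeasure \<mu> ?B"
        by (subst nn_integral_cmult) auto
    qed
    also have "\<dots> = emeasure lborel A * emeasure \<mu> ?B" by (subst nn_integral_multc) auto
    finally show ?thesis .
  qed
  have fin: "emeasure lborel ?B \<noteq> \<infinity>"
    using emeasure_lborel_cball_finite[of "0::'a" 1] by simp
  have "0 < measure lborel ?B" by (rule content_cball_pos) simp
  then have pos: "emeasure lborel ?B \<noteq> 0" by (auto simp: measure_def)
  have "emeasure \<mu> A * emeasure lborel ?B = emeasure lborel A * emeasure lborel ?B"
    using 1 2 ball by simp
  then have "emeasure \<mu> A * emeasure lborel ?B / emeasure lborel ?B =
      emeasure lborel A * emeasure lborel ?B / emeasure lborel ?B" by (rule arg_cong)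
  then show "emeasure \<mu> A = emeasure lborel A"
    using fin pos by (simp add: ennreal_mult_divide_eq)
qed

text \<open>An isometry maps the unit ball onto itself, so the image of Lebesgue measure is a
  translation-invariant measure with the correct normalisation.\<close>

lemma lborel_isometry_invariant:
  fixes f :: "'a::euclidean_space \<Rightarrow> 'a"
  assumes f: "linear f" and iso: "\<And>x. norm (f x) = norm x"
  shows "distr lborel borel f = lborel"
proof (rule translation_invariant_unique)
  interpret f: linear f by fact
  have [measurable]: "f \<in> borel_measurable borel"
    using f by (intro borel_measurable_continuous_onI linear_continuous_on linear_linear[THEN iffD2]) 
      (simp add: linear_conv_bounded_linear)
  have inj: "inj f"
    using iso by (auto simp: f.inj_iff_eq_0 dest!: arg_cong[of _ 0 norm])
  then have surj: "surj f" by (rule linear_inj_imp_surj[OF f])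
  show "sets (distr lborel borel f) = sets borel" by simp
  show "distr (distr lborel borel f) borel ((+) c) = distr lborel borel f" for c
  proof -
    obtain d where d: "f d = c" using surj by (metis surjD)
    have "distr (distr lborel borel f) borel ((+) c) = distr lborel borel (\<lambda>x. f (d + x))"
      by (subst distr_distr) (auto simp: comp_def f.add d)
    also have "\<dots> = distr (distr lborel borel ((+) d)) borel f"
      by (subst distr_distr) (auto simp: comp_def)
    finally show ?thesis by (simp add: lborel_distr_plus)
  qed
  show "emeasure (distr lborel borel f) (cball 0 1) = emeasure lborel (cball (0::'a) 1)"
  proof -
    have "f -` cball 0 1 = cball 0 1" by (auto simp: iso)
    then show ?thesis by (subst emeasure_distr) auto
  qed
  show "sigma_finite_measure (distr lborel borel f)"
  proof
    show "\<exists>A. countable A \<and> A \<subseteq> sets (distr lborel borel f) \<and> \<Union> A = space (distr lborel borel f) \<and>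
        (\<forall>a\<in>A. emeasure (distr lborel borel f) a \<noteq> \<infinity>)"
    proof (intro exI[of _ "range (\<lambda>n::nat. cball 0 (real n))"] conjI ballI)
      show "(\<Union>n::nat. cball 0 (real n)) = space (distr lborel borel f)"
        by (auto intro: real_arch_simple)
      fix a assume "a \<in> range (\<lambda>n::nat. cball (0::'a) (real n))"
      then obtain n :: nat where a: "a = cball 0 (real n)" by auto
      have "f -` a = a" by (auto simp: a iso)
      then show "emeasure (distr lborel borel f) a \<noteq> \<infinity>"
        using emeasure_lborel_cball_finite[of "0::'a" "real n"]
        by (subst emeasure_distr) (auto simp: a)
    qed auto
  qed
qed

section \<open>The standard normal law on a Euclidean space\<close>

definition gauss :: "'a::euclidean_space measure" where
  "gauss = density lborel (\<lambda>x. \<Prod>b\<in>Basis. std_normal_density (x \<bullet> b))"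

text \<open>The density depends on the norm only; this is what makes the law isotropic.\<close>

lemma gauss_radial:
  "gauss = density lborel
     (\<lambda>x::'a::euclidean_space. ennreal ((1 / sqrt (2 * pi)) ^ DIM('a) * exp (- (norm x)\<^sup>2 / 2)))"
proof -
  have "(\<Prod>b\<in>Basis. std_normal_density (x \<bullet> b)) =
      (1 / sqrt (2 * pi)) ^ DIM('a) * exp (- (norm x)\<^sup>2 / 2)" for x :: 'a
  proof -
    have "(\<Prod>b\<in>Basis. std_normal_density (x \<bullet> b)) =
        (\<Prod>b::'a\<in>Basis. 1 / sqrt (2 * pi)) * (\<Prod>b\<in>Basis. exp (- (x \<bullet> b)\<^sup>2 / 2))"
      unfolding prod.distrib[symmetric] by (simp add: std_normal_density_def)
    also have "\<dots> = (1 / sqrt (2 * pi)) ^ DIM('a) * exp (\<Sum>b\<in>Basis. - (x \<bullet> b)\<^sup>2 / 2)"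
      by (subst exp_sum) auto
    also have "(\<Sum>b\<in>Basis. - (x \<bullet> b)\<^sup>2 / 2) = - (norm x)\<^sup>2 / 2"
      unfolding power2_norm_eq_inner euclidean_inner[of x x]
      by (simp add: sum_negf sum_divide_distrib power2_eq_square)
    finally show ?thesis .
  qed
  then show ?thesis by (simp add: gauss_def)
qed

lemma sets_gauss [simp, measurable_cong]: "sets gauss = sets borel"
  by (simp add: gauss_def)

lemma space_gauss [simp]: "space gauss = UNIV"
  by (simp add: gauss_def)

lemma prob_space_gauss: "prob_space (gauss :: 'a::euclidean_space measure)"
proof
  interpret N: prob_space std_normal_distribution
    using prob_space_normal_density[of 1 0] by simp
  have "(\<integral>\<^sup>+x. ennreal (std_normal_density x) \<partial>lborel) = 1"
    using N.emeasure_space_1 by (simp add: emeasure_density)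
  then show "emeasure gauss (space gauss) = (1::ennreal)"
    by (simp add: gauss_def emeasure_density prod_ennreal[symmetric]
        nn_integral_lborel_prod[where f = "\<lambda>_ y. ennreal (std_normal_density y)"])
qed

interpretation gauss: prob_space "gauss :: 'a::euclidean_space measure"
  by (rule prob_space_gauss)

lemma gauss_real: "gauss = std_normal_distribution"
  by (simp add: gauss_def)

lemma gauss_isometry_invariant:
  fixes f :: "'a::euclidean_space \<Rightarrow> 'a"
  assumes f: "linear f" and iso: "\<And>x. norm (f x) = norm x"
  shows "distr gauss borel f = gauss"
proof -
  have m [measurable]: "f \<in> borel_measurable borel"
    using f by (intro borel_measurable_continuous_onI linear_continuous_on)
      (simp add: linear_conv_bounded_linear)
  let ?g = "\<lambda>x::'a. ennreal ((1 / sqrt (2 * pi)) ^ DIM('a) * exp (- (norm x)\<^sup>2 / 2))"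
  have "gauss = density (distr lborel borel f) ?g"
    by (simp add: gauss_radial lborel_isometry_invariant[OF f iso])
  also have "\<dots> = distr (density lborel (\<lambda>x. ?g (f x))) borel f"
    by (subst density_distr) auto
  also have "\<dots> = distr gauss borel f" by (simp add: gauss_radial iso)
  finally show ?thesis by simp
qed

lemma gauss_pair:
  "gauss \<Otimes>\<^sub>M gauss = (gauss :: ('a::euclidean_space \<times> 'b::euclidean_space) measure)"
proof -
  let ?g = "\<lambda>x. ennreal ((1 / sqrt (2 * pi)) ^ DIM('a) * exp (- (norm (x::'a))\<^sup>2 / 2))"
  let ?h = "\<lambda>y. ennreal ((1 / sqrt (2 * pi)) ^ DIM('b) * exp (- (norm (y::'b))\<^sup>2 / 2))"
  have "gauss \<Otimes>\<^sub>M gauss = density (lborel \<Otimes>\<^sub>M lborel) (\<lambda>(x, y). ?g x * ?h y)"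
    unfolding gauss_radial
  proof (rule pair_measure_density)
    show "sigma_finite_measure (density lborel ?h)"
      using gauss.sigma_finite_measure_axioms[where 'a = 'b] unfolding gauss_radial .
  qed (auto intro: sigma_finite_lborel)
  also have "\<dots> = (gauss :: ('a \<times> 'b) measure)"
    unfolding gauss_radial lborel_prod
  proof (rule arg_cong[where f = "density lborel"], rule ext, clarify)
    fix x :: 'a and y :: 'b
    have "exp (- (norm (x, y))\<^sup>2 / 2) = exp (- (norm x)\<^sup>2 / 2) * exp (- (norm y)\<^sup>2 / 2)"
      by (simp add: norm_Pair exp_add[symmetric] field_simps)
    then show "?g x * ?h y = ennreal ((1 / sqrt (2 * pi)) ^ DIM('a \<times> 'b) * exp (- (norm (x, y))\<^sup>2 / 2))"
      by (simp add: ennreal_mult[symmetric] power_add ac_simps)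
  qed
  finally show ?thesis .
qed

lemma linear_borel_measurable:
  "linear f \<Longrightarrow> (f :: 'a::euclidean_space \<Rightarrow> 'b::euclidean_space) \<in> borel_measurable borel"
  by (intro borel_measurable_continuous_onI linear_continuous_on) (simp add: linear_conv_bounded_linear)

lemma distr_pair_snd:
  assumes "prob_space M" "sigma_finite_measure N"
  shows "distr (M \<Otimes>\<^sub>M N) N snd = N"
proof (rule measure_eqI)
  interpret M: prob_space M by fact
  interpret N: sigma_finite_measure N by fact
  fix A assume A: "A \<in> sets (distr (M \<Otimes>\<^sub>M N) N snd)"
  then have "emeasure (distr (M \<Otimes>\<^sub>M N) N snd) A = emeasure (M \<Otimes>\<^sub>M N) (space M \<times> A)"
    by (subst emeasure_distr) (auto intro!: arg_cong2[where f = emeasure] simp: space_pair_measure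
        dest: sets.sets_into_space)
  with A show "emeasure (distr (M \<Otimes>\<^sub>M N) N snd) A = emeasure N A"
    by (simp add: N.emeasure_pair_measure_Times M.emeasure_space_1)
qed simp

text \<open>The coordinate of a standard normal vector in the direction \<open>b\<close> can be replaced by an independent
  standard normal variable: exchanging \<open>s\<close> and \<open>b \<bullet> y\<close> is an isometry of \<open>\<real> \<times> \<real>\<^sup>d\<close>.\<close>

lemma gauss_split:
  fixes b :: "'a::euclidean_space"
  assumes b: "norm b = 1"
  shows "distr (gauss \<Otimes>\<^sub>M gauss) borel (\<lambda>(s::real, y). s *\<^sub>R b + (y - (b \<bullet> y) *\<^sub>R b)) = gauss"
proof -
  have bb: "b \<bullet> b = 1" using b by (simp add: dot_square_norm)
  let ?T = "\<lambda>p::real \<times> 'a. (b \<bullet> snd p, snd p + (fst p - b \<bullet> snd p) *\<^sub>R b)"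
  have lin: "linear ?T"
    by (rule linearI) (auto simp: algebra_simps inner_add_right)
  have T: "?T \<in> measurable gauss borel"
    using linear_borel_measurable[OF lin] by (simp add: measurable_cong_sets[OF sets_gauss refl])
  have [measurable]: "snd \<in> borel_measurable (borel :: (real \<times> 'a) measure)"
    by (simp_all add: borel_prod[symmetric])
  have iso: "norm (?T p) = norm p" for p
  proof -
    obtain s y where p: "p = (s, y)" by (cases p)
    have "(norm (y + (s - b \<bullet> y) *\<^sub>R b))\<^sup>2 = (norm y)\<^sup>2 - (b \<bullet> y)\<^sup>2 + s\<^sup>2"
      unfolding power2_norm_eq_inner
      by (simp add: inner_add_left inner_add_right bb inner_commute power2_eq_square algebra_simps)
    then show ?thesis by (simp add: p norm_Pair)
  qed
  have "distr (gauss \<Otimes>\<^sub>M gauss) borel (\<lambda>(s::real, y). s *\<^sub>R b + (y - (b \<bullet> y) *\<^sub>R b)) =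
      distr (distr gauss borel ?T) borel snd"
    by (subst distr_distr[OF _ T]) (auto simp: gauss_pair comp_def algebra_simps split_beta')
  also have "\<dots> = distr ((gauss :: real measure) \<Otimes>\<^sub>M gauss) borel snd"
    by (simp add: gauss_isometry_invariant[OF lin iso] gauss_pair)
  also have "\<dots> = distr ((gauss :: real measure) \<Otimes>\<^sub>M gauss) (gauss :: 'a measure) snd"
    by (rule distr_cong) auto
  also have "\<dots> = gauss"
    by (rule distr_pair_snd) (auto intro: prob_space_gauss gauss.sigma_finite_measure_axioms)
  finally show ?thesis .
qed

lemma gauss_inner:
  fixes b :: "'a::euclidean_space"
  assumes b: "norm b = 1"
  shows "distr gauss borel ((\<bullet>) b) = std_normal_distribution"
proof -
  have bb: "b \<bullet> b = 1" using b by (simp add: dot_square_norm)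
  have "distr gauss borel ((\<bullet>) b) =
      distr (distr (gauss \<Otimes>\<^sub>M gauss) borel (\<lambda>(s::real, y). s *\<^sub>R b + (y - (b \<bullet> y) *\<^sub>R b))) borel ((\<bullet>) b)"
    by (simp add: gauss_split[OF b])
  also have "\<dots> = distr (gauss \<Otimes>\<^sub>M (gauss :: 'a measure)) (gauss :: real measure) fst"
    by (subst distr_distr)
      (auto simp: comp_def split_beta' inner_add_right inner_diff_right bb intro!: distr_cong)
  also have "\<dots> = gauss" by (rule gauss.distr_pair_fst)
  finally show ?thesis by (simp add: gauss_real)
qed

lemma unit_direction:
  fixes a :: "'a::euclidean_space"
  obtains b where "norm b = 1" "a = norm a *\<^sub>R b"
proof (cases "a = 0")
  case True
  obtain b :: 'a where "b \<in> Basis" using nonempty_Basis by blast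
  with True show ?thesis by (intro that[of b]) auto
next
  case False
  then show ?thesis by (intro that[of "a /\<^sub>R norm a"]) auto
qed

lemma gauss_inner_scaled:
  fixes a :: "'a::euclidean_space"
  shows "distr gauss borel ((\<bullet>) a) = distr gauss borel (\<lambda>t::real. norm a * t)"
proof -
  obtain b where b: "norm b = 1" "a = norm a *\<^sub>R b" by (rule unit_direction)
  have "(\<bullet>) a = (\<lambda>t. norm a * t) \<circ> (\<bullet>) b"
    by (rule ext, subst b(2)) simp
  then have "distr gauss borel ((\<bullet>) a) = distr (distr gauss borel ((\<bullet>) b)) borel (\<lambda>t. norm a * t)"
    by (simp add: distr_distr)
  then show ?thesis by (simp add: gauss_inner[OF b(1)] gauss_real)
qed

text \<open>The pair \<open>(x, y) \<mapsto> (a x + b y, a y - b x)\<close> is an isometry of the product space.\<close>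

lemma gauss_rotation:
  assumes ab: "a\<^sup>2 + b\<^sup>2 = 1"
  shows "distr (gauss \<Otimes>\<^sub>M gauss) borel (\<lambda>(x::'a::euclidean_space, y). a *\<^sub>R x + b *\<^sub>R y) = gauss"
proof -
  let ?T = "\<lambda>p::'a \<times> 'a. (a *\<^sub>R fst p + b *\<^sub>R snd p, a *\<^sub>R snd p - b *\<^sub>R fst p)"
  have lin: "linear ?T"
    by (rule linearI) (auto simp: algebra_simps)
  have T: "?T \<in> measurable gauss borel"
    using linear_borel_measurable[OF lin] by (simp add: measurable_cong_sets[OF sets_gauss refl])
  have [measurable]: "fst \<in> borel_measurable (borel :: ('a \<times> 'a) measure)"
    by (simp_all add: borel_prod[symmetric])
  have iso: "norm (?T p) = norm p" for p
  proof -
    obtain x y where p: "p = (x, y)" by (cases p)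
    have "(norm (a *\<^sub>R x + b *\<^sub>R y))\<^sup>2 + (norm (a *\<^sub>R y - b *\<^sub>R x))\<^sup>2 = (a\<^sup>2 + b\<^sup>2) * ((norm x)\<^sup>2 + (norm y)\<^sup>2)"
      unfolding power2_norm_eq_inner
      by (simp add: inner_add_left inner_add_right inner_diff_left inner_diff_right inner_commute
          power2_eq_square algebra_simps)
    then show ?thesis by (simp add: p norm_Pair ab)
  qed
  have "distr (gauss \<Otimes>\<^sub>M gauss) borel (\<lambda>(x::'a, y). a *\<^sub>R x + b *\<^sub>R y) =
      distr (distr gauss borel ?T) borel fst"
    by (subst distr_distr[OF _ T]) (auto simp: gauss_pair comp_def split_beta')
  also have "\<dots> = distr (gauss \<Otimes>\<^sub>M (gauss :: 'a measure)) (gauss :: 'a measure) fst"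
    unfolding gauss_isometry_invariant[OF lin iso] gauss_pair by (rule distr_cong) auto
  also have "\<dots> = gauss" by (rule gauss.distr_pair_fst)
  finally show ?thesis .
qed

text \<open>Induction over the index set with the rotation lemma as the induction step: two independent normal
  vectors with scales \<open>c\<close> and \<open>r\<close> combine to one with scale \<open>\<surd>(c\<^sup>2 + r\<^sup>2)\<close>.\<close>

lemma gauss_weighted_sum:
  assumes "finite I"
  shows "distr (\<Pi>\<^sub>M i\<in>I. gauss) borel (\<lambda>y. \<Sum>i\<in>I. c i *\<^sub>R (y i :: 'a::euclidean_space)) =
    distr gauss borel (\<lambda>x. sqrt (\<Sum>i\<in>I. (c i)\<^sup>2) *\<^sub>R x)"
  using assms
proof induction
  case empty
  have "distr (\<Pi>\<^sub>M i\<in>{}. gauss) borel (\<lambda>y. 0 :: 'a) = return borel 0"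
    by (rule prob_space.distr_const) (auto intro: prob_space_PiM prob_space_gauss)
  moreover have "distr gauss borel (\<lambda>x. 0 :: 'a) = return borel (0 :: 'a)"
    by (rule gauss.distr_const) simp
  ultimately show ?case by simp
next
  case (insert j I)
  let ?S = "\<lambda>y. \<Sum>i\<in>I. c i *\<^sub>R (y i :: 'a)"
  let ?P = "\<Pi>\<^sub>M i\<in>I. (gauss :: 'a measure)"
  let ?r = "sqrt (\<Sum>i\<in>I. (c i)\<^sup>2)"
  let ?R = "sqrt (\<Sum>i\<in>insert j I. (c i)\<^sup>2)"
  have R: "?R\<^sup>2 = (c j)\<^sup>2 + ?r\<^sup>2"
    using insert by (simp add: sum_nonneg)
  interpret P: prob_space ?P by (auto intro: prob_space_PiM prob_space_gauss)
  have "distr (\<Pi>\<^sub>M i\<in>insert j I. gauss) borel (\<lambda>y. \<Sum>i\<in>insert j I. c i *\<^sub>R (y i :: 'a)) =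
      distr (distr (gauss \<Otimes>\<^sub>M ?P) (\<Pi>\<^sub>M i\<in>insert j I. gauss) (\<lambda>(x, X). X(j := x)))
        borel (\<lambda>y. \<Sum>i\<in>insert j I. c i *\<^sub>R (y i :: 'a))"
    by (subst distr_pair_PiM_eq_PiM) (auto intro: prob_space_gauss)
  also have "\<dots> = distr (gauss \<Otimes>\<^sub>M ?P) borel (\<lambda>(x, X). c j *\<^sub>R x + ?S X)"
  proof (subst distr_distr)
    have "(\<Sum>i\<in>I. c i *\<^sub>R (if i = j then x else X i)) = ?S X" for x X
      using insert by (intro sum.cong) auto
    then show "distr (gauss \<Otimes>\<^sub>M ?P) borel ((\<lambda>y. \<Sum>i\<in>insert j I. c i *\<^sub>R y i) \<circ> (\<lambda>(x, X). X(j := x))) =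
        distr (gauss \<Otimes>\<^sub>M ?P) borel (\<lambda>(x, X). c j *\<^sub>R x + ?S X)"
      using insert by (intro distr_cong) (auto simp: comp_def split_beta')
  qed (use insert in \<open>auto intro!: measurable_fun_upd\<close>)
  also have "\<dots> = distr (distr gauss borel (\<lambda>x. x) \<Otimes>\<^sub>M distr ?P borel ?S) borel (\<lambda>(x, s). c j *\<^sub>R x + s)"
    by (subst pair_measure_distr)
      (auto simp: distr_distr comp_def split_beta' intro!: prob_space_imp_sigma_finite P.prob_space_distr)
  also have "\<dots> = distr (distr gauss borel (\<lambda>x. x) \<Otimes>\<^sub>M distr gauss borel (\<lambda>y. ?r *\<^sub>R y)) borel
      (\<lambda>(x, s). c j *\<^sub>R x + s)"
    by (simp add: insert.IH)
  also have "\<dots> = distr (gauss \<Otimes>\<^sub>M gauss) borel (\<lambda>(x, y). c j *\<^sub>R x + ?r *\<^sub>R y)"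
    by (subst pair_measure_distr)
      (auto simp: distr_distr comp_def split_beta' intro!: prob_space_imp_sigma_finite gauss.prob_space_distr)
  also have "\<dots> = distr gauss borel (\<lambda>x. ?R *\<^sub>R x)"
  proof (cases "?R = 0")
    case True
    then have "c j = 0" "?r = 0" using R by (auto simp: add_nonneg_eq_0_iff sum_nonneg)
    moreover have "distr (gauss \<Otimes>\<^sub>M gauss) borel (\<lambda>_. 0 :: 'a) = return borel 0"
      unfolding gauss_pair by (rule gauss.distr_const) simp
    moreover have "distr gauss borel (\<lambda>x. 0 :: 'a) = return borel (0 :: 'a)"
      by (rule gauss.distr_const) simp
    ultimately show ?thesis using True by (simp add: split_beta')
  next
    case False
    have "(c j / ?R)\<^sup>2 + (?r / ?R)\<^sup>2 = ((c j)\<^sup>2 + ?r\<^sup>2) / ?R\<^sup>2"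
      by (simp only: power_divide add_divide_distrib)
    also have "\<dots> = 1"
      unfolding R[symmetric] by (rule divide_self) (use False in \<open>simp only: power_not_zero not_False_eq_True\<close>)
    finally have "(c j / ?R)\<^sup>2 + (?r / ?R)\<^sup>2 = 1" .
    from gauss_rotation[OF this, where 'a = 'a]
    have "distr gauss borel (\<lambda>x. ?R *\<^sub>R x) =
        distr (distr (gauss \<Otimes>\<^sub>M gauss) borel (\<lambda>(x::'a, y). (c j / ?R) *\<^sub>R x + (?r / ?R) *\<^sub>R y))
          borel (\<lambda>x. ?R *\<^sub>R x)" by simp
    also have "\<dots> = distr (gauss \<Otimes>\<^sub>M gauss) borel (\<lambda>(x::'a, y). c j *\<^sub>R x + ?r *\<^sub>R y)"
      using False by (subst distr_distr) (auto simp: comp_def split_beta' scaleR_add_right)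
    finally show ?thesis by simp
  qed
  finally show ?case .
qed

lemma component_measurable [measurable]: "(\<lambda>x::real^'p. x $ i) \<in> borel_measurable borel"
  by (intro borel_measurable_continuous_onI continuous_intros)

text \<open>The law with independent standard normal coordinates is compared with \<open>gauss\<close> on boxes, where both
  factorise over the coordinates.\<close>

lemma std_normal_vec_eq_gauss: "std_normal_vec = (gauss :: (real ^ 'p) measure)"
proof -
  let ?N = "\<Pi>\<^sub>M i\<in>(UNIV :: 'p set). std_normal_distribution"
  interpret N: prob_space std_normal_distribution
    using prob_space_normal_density[of 1 0] by simp
  interpret product_sigma_finite "\<lambda>_::'p. std_normal_distribution" ..
  have sets: "sets ?N = sets (\<Pi>\<^sub>M i\<in>(UNIV :: 'p set). borel)"
    by (rule sets_PiM_cong) auto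
  have m [measurable]: "vec_nth \<in> measurable gauss ?N"
    by (subst measurable_cong_sets[OF sets_gauss sets], rule measurable_PiM_single') auto
  have "distr gauss ?N vec_nth = ?N"
  proof (rule PiM_eqI)
    fix A :: "'p \<Rightarrow> real set" assume "\<And>i. i \<in> UNIV \<Longrightarrow> A i \<in> sets std_normal_distribution"
    then have A [measurable]: "A i \<in> sets borel" for i by simp
    \<comment> \<open>\<open>axis_index\<close> translates basis vectors back to coordinates.\<close>
    let ?f = "\<lambda>b::real^'p. \<lambda>t. ennreal (std_normal_density t) * indicator (A (axis_index b)) t"
    have B: "(Basis :: (real^'p) set) = range (\<lambda>i. axis i 1)" by (auto simp: Basis_vec_def)
    have inj: "inj (\<lambda>i::'p. axis i (1::real))" by (auto simp: inj_on_def axis_eq_axis)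
    have "emeasure (distr gauss ?N vec_nth) (Pi\<^sub>E UNIV A) =
        emeasure gauss (vec_nth -` Pi\<^sub>E UNIV A \<inter> space gauss)"
      by (rule emeasure_distr[OF m]) (auto intro!: sets_PiM_I_finite)
    also have "\<dots> = (\<integral>\<^sup>+x. ennreal (\<Prod>b\<in>Basis. std_normal_density (x \<bullet> b)) * indicator (vec_nth -` Pi\<^sub>E UNIV A) x \<partial>lborel)"
    proof -
      have "vec_nth -` Pi\<^sub>E UNIV A \<inter> space gauss \<in> sets gauss"
        using m by (rule measurable_sets) (auto intro!: sets_PiM_I_finite)
      then show ?thesis unfolding gauss_def by (subst emeasure_density) auto
    qed
    also have "\<dots> = (\<integral>\<^sup>+x. (\<Prod>b\<in>Basis. ?f b (x \<bullet> b)) \<partial>lborel)"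
    proof (rule nn_integral_cong)
      fix x :: "real^'p"
      have "indicator (vec_nth -` Pi\<^sub>E UNIV A) x = (\<Prod>i\<in>UNIV. indicator (A i) (x $ i) :: ennreal)"
        by (auto simp: indicator_def PiE_iff prod_zero_iff)
      also have "\<dots> = (\<Prod>b\<in>Basis. indicator (A (axis_index b)) (x \<bullet> b))"
        unfolding B by (subst prod.reindex[OF inj]) (simp add: inner_axis)
      finally show "ennreal (\<Prod>b\<in>Basis. std_normal_density (x \<bullet> b)) * indicator (vec_nth -` Pi\<^sub>E UNIV A) x =
          (\<Prod>b\<in>Basis. ?f b (x \<bullet> b))"
        by (simp add: prod.distrib prod_ennreal)
    qed
    also have "\<dots> = (\<Prod>b\<in>Basis. \<integral>\<^sup>+t. ?f b t \<partial>lborel)"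
      by (rule nn_integral_lborel_prod) auto
    also have "\<dots> = (\<Prod>i\<in>UNIV. emeasure std_normal_distribution (A i))"
      unfolding B by (subst prod.reindex[OF inj]) (simp add: emeasure_density)
    finally show "emeasure (distr gauss ?N vec_nth) (Pi\<^sub>E UNIV A) =
        (\<Prod>i\<in>UNIV. emeasure std_normal_distribution (A i))" .
  qed auto
  moreover have "(\<lambda>z. \<chi> i. z i) \<in> borel_measurable ?N"
    by (subst borel_measurable_euclidean_space)
      (auto simp: Basis_vec_def inner_axis measurable_cong_sets[OF sets refl])
  ultimately have "std_normal_vec = distr gauss borel (\<lambda>x::real^'p. \<chi> i. x $ i)"
    unfolding std_normal_vec_def by (subst \<open>distr gauss ?N vec_nth = ?N\<close>[symmetric], subst distr_distr)
      (auto simp: comp_def)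
  also have "\<dots> = distr gauss gauss (\<lambda>x. x)" by (rule distr_cong) auto
  finally show ?thesis by (simp add: distr_id)
qed

section \<open>Likelihood ratios of spiked normal samples\<close>

lemma emeasure_eq_nn_integral_indicator_distr:
  assumes [measurable]: "f \<in> measurable M N" "A \<in> sets N"
  shows "emeasure (distr M N f) A = (\<integral>\<^sup>+x. indicator A (f x) \<partial>M)"
proof -
  have "emeasure (distr M N f) A = (\<integral>\<^sup>+y. indicator A y \<partial>distr M N f)" by simp
  also have "\<dots> = (\<integral>\<^sup>+x. indicator A (f x) \<partial>M)" by (rule nn_integral_distr) auto
  finally show ?thesis .
qed

text \<open>A sample of functions of pairs can be drawn by first drawing all first and then all second
  components. Conditioning on the first components of the whole sample relies on this.\<close>

lemma distr_PiM_pair: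
  assumes I: "finite I" and M: "prob_space M" and N: "prob_space N"
    and h [measurable]: "h \<in> measurable (M \<Otimes>\<^sub>M N) L"
  shows "distr ((\<Pi>\<^sub>M i\<in>I. M) \<Otimes>\<^sub>M (\<Pi>\<^sub>M i\<in>I. N)) (\<Pi>\<^sub>M i\<in>I. L) (\<lambda>(s, y). \<lambda>i\<in>I. h (s i, y i)) =
    (\<Pi>\<^sub>M i\<in>I. distr (M \<Otimes>\<^sub>M N) L h)"
proof -
  interpret M: prob_space M by fact
  interpret N: prob_space N by fact
  interpret MN: pair_prob_space M N ..
  interpret D: prob_space "distr (M \<Otimes>\<^sub>M N) L h" by (rule MN.prob_space_distr) fact
  interpret PM: product_sigma_finite "\<lambda>_. M" ..
  interpret PN: product_sigma_finite "\<lambda>_. N" ..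
  interpret PD: product_sigma_finite "\<lambda>_. distr (M \<Otimes>\<^sub>M N) L h" ..
  interpret N': prob_space "\<Pi>\<^sub>M i\<in>I. N" by (rule prob_space_PiM) (rule N)
  have H [measurable]: "(\<lambda>(s, y). \<lambda>i\<in>I. h (s i, y i)) \<in>
      measurable ((\<Pi>\<^sub>M i\<in>I. M) \<Otimes>\<^sub>M (\<Pi>\<^sub>M i\<in>I. N)) (\<Pi>\<^sub>M i\<in>I. L)"
    by measurable
  show ?thesis
  proof (rule PD.PiM_eqI[OF I])
    show "sets (distr ((\<Pi>\<^sub>M i\<in>I. M) \<Otimes>\<^sub>M (\<Pi>\<^sub>M i\<in>I. N)) (\<Pi>\<^sub>M i\<in>I. L) (\<lambda>(s, y). \<lambda>i\<in>I. h (s i, y i))) =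
        sets (\<Pi>\<^sub>M i\<in>I. distr (M \<Otimes>\<^sub>M N) L h)"
      by (simp cong: sets_PiM_cong)
    fix A assume "\<And>i. i \<in> I \<Longrightarrow> A i \<in> sets (distr (M \<Otimes>\<^sub>M N) L h)"
    then have A [measurable]: "\<And>i. i \<in> I \<Longrightarrow> A i \<in> sets L" by simp
    have "emeasure (distr ((\<Pi>\<^sub>M i\<in>I. M) \<Otimes>\<^sub>M (\<Pi>\<^sub>M i\<in>I. N)) (\<Pi>\<^sub>M i\<in>I. L) (\<lambda>(s, y). \<lambda>i\<in>I. h (s i, y i)))
        (Pi\<^sub>E I A) =
        (\<integral>\<^sup>+p. indicator (Pi\<^sub>E I A) ((\<lambda>(s, y). \<lambda>i\<in>I. h (s i, y i)) p) \<partial>((\<Pi>\<^sub>M i\<in>I. M) \<Otimes>\<^sub>M (\<Pi>\<^sub>M i\<in>I. N)))"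
      by (rule emeasure_eq_nn_integral_indicator_distr) (auto intro!: sets_PiM_I_finite I A)
    also have "\<dots> = (\<integral>\<^sup>+p. (\<Prod>i\<in>I. indicator (A i) (h (fst p i, snd p i))) \<partial>((\<Pi>\<^sub>M i\<in>I. M) \<Otimes>\<^sub>M (\<Pi>\<^sub>M i\<in>I. N)))"
      using I by (intro nn_integral_cong) (auto simp: indicator_def PiE_iff prod_zero_iff)
    also have "\<dots> = (\<integral>\<^sup>+s. \<integral>\<^sup>+y. (\<Prod>i\<in>I. indicator (A i) (h (s i, y i))) \<partial>(\<Pi>\<^sub>M i\<in>I. N) \<partial>(\<Pi>\<^sub>M i\<in>I. M))"
      by (subst N'.nn_integral_fst[symmetric]) auto
    also have "\<dots> = (\<integral>\<^sup>+s. (\<Prod>i\<in>I. \<integral>\<^sup>+y. indicator (A i) (h (s i, y)) \<partial>N) \<partial>(\<Pi>\<^sub>M i\<in>I. M))"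
    proof (rule nn_integral_cong)
      fix s assume "s \<in> space (\<Pi>\<^sub>M i\<in>I. M)"
      then have "i \<in> I \<Longrightarrow> s i \<in> space M" for i by (auto simp: space_PiM)
      then show "(\<integral>\<^sup>+y. (\<Prod>i\<in>I. indicator (A i) (h (s i, y i))) \<partial>(\<Pi>\<^sub>M i\<in>I. N)) =
          (\<Prod>i\<in>I. \<integral>\<^sup>+y. indicator (A i) (h (s i, y)) \<partial>N)"
        by (intro PN.product_nn_integral_prod I) auto
    qed
    also have "\<dots> = (\<Prod>i\<in>I. \<integral>\<^sup>+s. \<integral>\<^sup>+y. indicator (A i) (h (s, y)) \<partial>N \<partial>M)"
      by (intro PM.product_nn_integral_prod I) auto
    also have "\<dots> = (\<Prod>i\<in>I. emeasure (distr (M \<Otimes>\<^sub>M N) L h) (A i))"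
    proof (rule prod.cong[OF refl])
      fix i assume [simp]: "i \<in> I"
      have "emeasure (distr (M \<Otimes>\<^sub>M N) L h) (A i) = (\<integral>\<^sup>+p. indicator (A i) (h p) \<partial>(M \<Otimes>\<^sub>M N))"
        by (rule emeasure_eq_nn_integral_indicator_distr) auto
      also have "\<dots> = (\<integral>\<^sup>+s. \<integral>\<^sup>+y. indicator (A i) (h (s, y)) \<partial>N \<partial>M)"
        by (subst N.nn_integral_fst[symmetric]) auto
      finally show "(\<integral>\<^sup>+s. \<integral>\<^sup>+y. indicator (A i) (h (s, y)) \<partial>N \<partial>M) =
          emeasure (distr (M \<Otimes>\<^sub>M N) L h) (A i)" ..
    qed
    finally show "emeasure (distr ((\<Pi>\<^sub>M i\<in>I. M) \<Otimes>\<^sub>M (\<Pi>\<^sub>M i\<in>I. N)) (\<Pi>\<^sub>M i\<in>I. L) (\<lambda>(s, y). \<lambda>i\<in>I. h (s i, y i)))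
        (Pi\<^sub>E I A) = (\<Prod>i\<in>I. emeasure (distr (M \<Otimes>\<^sub>M N) L h) (A i))" .
  qed
qed

lemma PiM_density:
  assumes I: "finite I" and M: "prob_space M" and g [measurable]: "g \<in> borel_measurable M"
    and D: "prob_space (density M g)"
  shows "(\<Pi>\<^sub>M i\<in>I. density M g) = density (\<Pi>\<^sub>M i\<in>I. M) (\<lambda>x. \<Prod>i\<in>I. g (x i))"
proof -
  interpret M: prob_space M by fact
  interpret D: prob_space "density M g" by fact
  interpret PM: product_sigma_finite "\<lambda>_. M" ..
  interpret PD: product_sigma_finite "\<lambda>_. density M g" ..
  show ?thesis
  proof (rule PD.PiM_eqI[OF I, symmetric])
    show "sets (density (\<Pi>\<^sub>M i\<in>I. M) (\<lambda>x. \<Prod>i\<in>I. g (x i))) = sets (\<Pi>\<^sub>M i\<in>I. density M g)"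
      by (simp cong: sets_PiM_cong)
    fix A assume "\<And>i. i \<in> I \<Longrightarrow> A i \<in> sets (density M g)"
    then have A [measurable]: "\<And>i. i \<in> I \<Longrightarrow> A i \<in> sets M" by simp
    have "emeasure (density (\<Pi>\<^sub>M i\<in>I. M) (\<lambda>x. \<Prod>i\<in>I. g (x i))) (Pi\<^sub>E I A) =
        (\<integral>\<^sup>+x. (\<Prod>i\<in>I. g (x i)) * indicator (Pi\<^sub>E I A) x \<partial>(\<Pi>\<^sub>M i\<in>I. M))"
      by (rule emeasure_density) (auto intro!: sets_PiM_I_finite I A)
    also have "\<dots> = (\<integral>\<^sup>+x. (\<Prod>i\<in>I. g (x i) * indicator (A i) (x i)) \<partial>(\<Pi>\<^sub>M i\<in>I. M))"
    proof (rule nn_integral_cong)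
      fix x assume "x \<in> space (\<Pi>\<^sub>M i\<in>I. M)"
      then have "indicator (Pi\<^sub>E I A) x = (\<Prod>i\<in>I. indicator (A i) (x i) :: ennreal)"
        using I by (auto simp: indicator_def PiE_iff prod_zero_iff space_PiM)
      then show "(\<Prod>i\<in>I. g (x i)) * indicator (Pi\<^sub>E I A) x = (\<Prod>i\<in>I. g (x i) * indicator (A i) (x i))"
        by (simp add: prod.distrib)
    qed
    also have "\<dots> = (\<Prod>i\<in>I. \<integral>\<^sup>+x. g x * indicator (A i) x \<partial>M)"
      by (intro PM.product_nn_integral_prod I) auto
    also have "\<dots> = (\<Prod>i\<in>I. emeasure (density M g) (A i))"
      by (intro prod.cong) (auto simp: emeasure_density)
    finally show "emeasure (density (\<Pi>\<^sub>M i\<in>I. M) (\<lambda>x. \<Prod>i\<in>I. g (x i))) (Pi\<^sub>E I A) =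
        (\<Prod>i\<in>I. emeasure (density M g) (A i))" .
  qed
qed

text \<open>For a unit vector \<open>\<theta>\<close> and \<open>s = \<surd>(1 + \<rho> v)\<close> this is the symmetric square root of the spiked covariance
  matrix: it multiplies by \<open>s\<close> along \<open>\<theta>\<close> and is the identity on the orthogonal complement.\<close>

definition stretch :: "'a::euclidean_space \<Rightarrow> real \<Rightarrow> 'a \<Rightarrow> 'a" where
  "stretch \<theta> s z = z + ((s - 1) * (\<theta> \<bullet> z)) *\<^sub>R \<theta>"

lemma stretch_measurable [measurable]: "stretch \<theta> s \<in> borel_measurable borel"
  unfolding stretch_def by measurable

lemma spiked_cov_mult_vec: "spiked_cov \<theta> \<rho> v *v w = w + (\<rho> * v * (\<theta> \<bullet> w)) *\<^sub>R \<theta>"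
  by (simp add: spiked_cov_def matrix_vector_mult_add_rdistrib scaleR_matrix_mult_vec outer_mult_vec)

lemma mv_normal_spiked:
  fixes \<theta> :: "real ^ 'p"
  assumes \<theta>: "norm \<theta> = 1" and c: "0 \<le> \<rho> * v"
  shows "mv_normal 0 (spiked_cov \<theta> \<rho> v) = distr gauss borel (stretch \<theta> (sqrt (1 + \<rho> * v)))"
proof -
  have "spiked_cov \<theta> \<rho> v = 1 *\<^sub>R (mat 1 - outer \<theta> \<theta>) + (1 + \<rho> * v) *\<^sub>R outer \<theta> \<theta>"
    by (simp add: spiked_cov_def algebra_simps)
  then have eq: "psd_sqrt (spiked_cov \<theta> \<rho> v) =
      sqrt 1 *\<^sub>R (mat 1 - outer \<theta> \<theta>) + sqrt (1 + \<rho> * v) *\<^sub>R outer \<theta> \<theta>"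
    using psd_sqrt_spiked(1)[OF \<theta>, of 1 "1 + \<rho> * v"] c by simp
  have "0 + psd_sqrt (spiked_cov \<theta> \<rho> v) *v z = stretch \<theta> (sqrt (1 + \<rho> * v)) z" for z
    unfolding eq by (simp add: stretch_def matrix_vector_mult_add_rdistrib matrix_vector_mult_diff_rdistrib
        scaleR_matrix_mult_vec outer_mult_vec algebra_simps)
  then show ?thesis by (simp add: mv_normal_def std_normal_vec_eq_gauss)
qed

lemma std_normal_scaled_density:
  assumes s: "s > 0"
  shows "distr gauss borel (\<lambda>x::real. s * x) =
    density gauss (\<lambda>x. ennreal (1 / s * exp ((1 - 1 / s\<^sup>2) / 2 * x\<^sup>2)))"
proof -
  have "distributed std_normal_distribution lborel (\<lambda>x. x) (normal_density 0 1)"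
    by (auto simp: distributed_def) (simp add: distr_id2)
  from prob_space.normal_density_affine[OF prob_space_normal_density this, of s 0] s
  have "distributed std_normal_distribution lborel (\<lambda>x. s * x) (normal_density 0 s)" by simp
  then have "distr std_normal_distribution lborel (\<lambda>x. s * x) = density lborel (normal_density 0 s)"
    by (simp add: distributed_def)
  also have "\<dots> = density std_normal_distribution (\<lambda>x. ennreal (1 / s * exp ((1 - 1 / s\<^sup>2) / 2 * x\<^sup>2)))"
  proof (subst density_density_eq)
    have "normal_density 0 s x = std_normal_density x * (1 / s * exp ((1 - 1 / s\<^sup>2) / 2 * x\<^sup>2))" for x
    proof -
      have "- x\<^sup>2 / 2 + (1 - 1 / s\<^sup>2) / 2 * x\<^sup>2 = - x\<^sup>2 / (2 * s\<^sup>2)"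
        using s by (simp add: field_simps)
      then have e: "exp (- x\<^sup>2 / 2) * exp ((1 - 1 / s\<^sup>2) / 2 * x\<^sup>2) = exp (- x\<^sup>2 / (2 * s\<^sup>2))"
        by (simp only: exp_add[symmetric])
      have "sqrt (2 * pi * s\<^sup>2) = sqrt (2 * pi) * s"
        using s by (simp add: real_sqrt_mult)
      then have "normal_density 0 s x = 1 / (sqrt (2 * pi) * s) * exp (- x\<^sup>2 / (2 * s\<^sup>2))"
        by (simp add: normal_density_def)
      then show ?thesis unfolding e[symmetric] std_normal_density_def by simp
    qed
    then have "ennreal (normal_density 0 s x) =
        ennreal (std_normal_density x) * ennreal (1 / s * exp ((1 - 1 / s\<^sup>2) / 2 * x\<^sup>2))" for x
      using s by (simp only: ennreal_mult normal_density_nonneg mult_nonneg_nonneg zero_le_divide_1_iff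
          less_imp_le exp_ge_zero)
    then show "density lborel (normal_density 0 s) =
        density lborel (\<lambda>x. ennreal (std_normal_density x) * ennreal (1 / s * exp ((1 - 1 / s\<^sup>2) / 2 * x\<^sup>2)))"
      by (simp only:)
  qed auto
  finally have *: "distr std_normal_distribution lborel (\<lambda>x. s * x) =
      density std_normal_distribution (\<lambda>x. ennreal (1 / s * exp ((1 - 1 / s\<^sup>2) / 2 * x\<^sup>2)))" .
  have "distr std_normal_distribution borel (\<lambda>x. s * x) = distr std_normal_distribution lborel (\<lambda>x. s * x)"
    by (rule distr_cong) auto
  then show ?thesis unfolding gauss_real * .
qed

text \<open>After splitting off the coordinate along \<open>\<theta>\<close>, stretching acts on that single coordinate, so the
  one-dimensional density carries over.\<close>

lemma gauss_stretch_density: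
  fixes \<theta> :: "'a::euclidean_space"
  assumes \<theta>: "norm \<theta> = 1" and s: "s > 0"
  shows "distr gauss borel (stretch \<theta> s) =
    density gauss (\<lambda>x. ennreal (1 / s * exp ((1 - 1 / s\<^sup>2) / 2 * (\<theta> \<bullet> x)\<^sup>2)))"
proof -
  have tt: "\<theta> \<bullet> \<theta> = 1" using \<theta> by (simp add: dot_square_norm)
  let ?h = "\<lambda>(t::real, y). t *\<^sub>R \<theta> + (y - (\<theta> \<bullet> y) *\<^sub>R \<theta>)"
  let ?g = "\<lambda>x. ennreal (1 / s * exp ((1 - 1 / s\<^sup>2) / 2 * x\<^sup>2))"
  note split = gauss_split[OF \<theta>]
  have "distr gauss borel (stretch \<theta> s) = distr (distr (gauss \<Otimes>\<^sub>M gauss) borel ?h) borel (stretch \<theta> s)"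
    by (simp add: split)
  also have "\<dots> = distr (gauss \<Otimes>\<^sub>M gauss) borel (\<lambda>(t, y). ?h (s * t, y))"
    by (subst distr_distr)
      (auto simp: comp_def split_beta' stretch_def inner_add_right inner_diff_right tt algebra_simps
        intro!: distr_cong)
  also have "\<dots> = distr (distr gauss borel (\<lambda>x. s * x) \<Otimes>\<^sub>M distr gauss borel (\<lambda>y. y)) borel ?h"
    by (subst pair_measure_distr)
      (auto simp: distr_distr comp_def split_beta' intro!: prob_space_imp_sigma_finite gauss.prob_space_distr)
  also have "\<dots> = distr (density gauss ?g \<Otimes>\<^sub>M density gauss (\<lambda>_. 1)) borel ?h"
  proof -
    have "distr gauss borel (\<lambda>y::'a. y) = density gauss (\<lambda>_. 1)"
      by (simp add: density_1 distr_id2)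
    then show ?thesis by (simp only: std_normal_scaled_density[OF s])
  qed
  also have "\<dots> = distr (density (gauss \<Otimes>\<^sub>M gauss) (\<lambda>(t, y). ?g t)) borel ?h"
    by (subst pair_measure_density)
      (auto simp: density_1 intro!: gauss.sigma_finite_measure_axioms)
  also have "\<dots> = distr (density (gauss \<Otimes>\<^sub>M gauss) (\<lambda>p. ?g (\<theta> \<bullet> ?h p))) borel ?h"
    by (simp add: split_beta' inner_add_right inner_diff_right tt)
  also have "\<dots> = density (distr (gauss \<Otimes>\<^sub>M gauss) borel ?h) (\<lambda>x. ?g (\<theta> \<bullet> x))"
    by (subst density_distr) (auto simp: split_beta')
  finally show ?thesis by (simp add: split)
qed

text \<open>Both laws have densities with respect to the standard normal law with the same normalising
  constant \<open>1 / \<surd>(1 + \<rho> v)\<close>, which cancels in the quotient.\<close>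

lemma mv_normal_spiked_density:
  fixes \<theta> :: "real ^ 'p"
  assumes \<theta>: "norm \<theta> = 1" and \<theta>': "norm \<theta>' = 1" and c: "0 \<le> \<rho> * v"
  defines "k \<equiv> \<rho> * v / (2 * (1 + \<rho> * v))"
  shows "mv_normal 0 (spiked_cov \<theta>' \<rho> v) =
    density (mv_normal 0 (spiked_cov \<theta> \<rho> v)) (\<lambda>x. ennreal (exp (k * ((\<theta>' \<bullet> x)\<^sup>2 - (\<theta> \<bullet> x)\<^sup>2))))"
proof -
  let ?s = "sqrt (1 + \<rho> * v)"
  have s: "?s > 0" using c by simp
  have k: "(1 - 1 / ?s\<^sup>2) / 2 = k"
    using c by (simp add: k_def field_simps)
  note d = gauss_stretch_density[OF _ s, unfolded k]
  show ?thesis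
    unfolding mv_normal_spiked[OF \<theta> c] mv_normal_spiked[OF \<theta>' c] d[OF \<theta>] d[OF \<theta>']
  proof (subst density_density_eq)
    have "exp (k * (\<theta>' \<bullet> x)\<^sup>2) =
        exp (k * (\<theta> \<bullet> x)\<^sup>2) * exp (k * ((\<theta>' \<bullet> x)\<^sup>2 - (\<theta> \<bullet> x)\<^sup>2))" for x
      by (subst exp_add[symmetric]) (simp add: right_diff_distrib)
    then have "1 / ?s * exp (k * (\<theta>' \<bullet> x)\<^sup>2) =
        1 / ?s * exp (k * (\<theta> \<bullet> x)\<^sup>2) * exp (k * ((\<theta>' \<bullet> x)\<^sup>2 - (\<theta> \<bullet> x)\<^sup>2))" for x
      by (simp only: mult.assoc)
    then have "ennreal (1 / ?s * exp (k * (\<theta>' \<bullet> x)\<^sup>2)) = ennreal (1 / ?s * exp (k * (\<theta> \<bullet> x)\<^sup>2)) *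
        ennreal (exp (k * ((\<theta>' \<bullet> x)\<^sup>2 - (\<theta> \<bullet> x)\<^sup>2)))" for x
      using s by (simp only: ennreal_mult mult_nonneg_nonneg zero_le_divide_1_iff
          less_imp_le exp_ge_zero)
    then show "density gauss (\<lambda>x. ennreal (1 / ?s * exp (k * (\<theta>' \<bullet> x)\<^sup>2))) =
        density gauss (\<lambda>x. ennreal (1 / ?s * exp (k * (\<theta> \<bullet> x)\<^sup>2)) *
          ennreal (exp (k * ((\<theta>' \<bullet> x)\<^sup>2 - (\<theta> \<bullet> x)\<^sup>2))))"
      by (simp only:)
  qed auto
qed

lemma prob_space_mv_normal:
  "prob_space (mv_normal (\<mu> :: real ^ 'p) \<Sigma>)"
proof -
  have "linear (\<lambda>z. psd_sqrt \<Sigma> *v z)" by (rule matrix_vector_mul_linear)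
  note [measurable] = linear_borel_measurable[OF this]
  show ?thesis unfolding mv_normal_def std_normal_vec_eq_gauss
    by (rule gauss.prob_space_distr) measurable
qed

lemma sets_mv_normal [simp, measurable_cong]: "sets (mv_normal \<mu> \<Sigma>) = sets borel"
  by (simp add: mv_normal_def)

lemma space_mv_normal [simp]: "space (mv_normal \<mu> \<Sigma>) = UNIV"
  by (simp add: mv_normal_def)

lemma prob_space_sample_law: "prob_space (sample_law n \<theta> \<rho> v)"
  unfolding sample_law_def by (intro prob_space_PiM prob_space_mv_normal)

lemma sets_sample_law [measurable_cong]: "sets (sample_law n \<theta> \<rho> v) = sets (\<Pi>\<^sub>M i\<in>{1..n}. borel)"
  unfolding sample_law_def by (intro sets_PiM_cong) auto

text \<open>The product of the one-observation densities is a version of the Radon-Nikodym derivative, and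
  such versions agree almost everywhere.\<close>

lemma AE_log_lik_ratio:
  assumes \<theta>: "norm \<theta> = 1" and \<theta>': "norm (\<theta> + \<nu> n *\<^sub>R \<tau> n) = 1" and c: "0 \<le> r n * v"
  shows "AE x in sample_law n \<theta> (r n) v. log_lik_ratio \<theta> r v \<nu> \<tau> n x =
    r n * v / (2 * (1 + r n * v)) * (\<Sum>i\<in>{1..n}. ((\<theta> + \<nu> n *\<^sub>R \<tau> n) \<bullet> x i)\<^sup>2 - (\<theta> \<bullet> x i)\<^sup>2)"
proof -
  let ?k = "r n * v / (2 * (1 + r n * v))" and ?t = "\<theta> + \<nu> n *\<^sub>R \<tau> n"
  let ?M = "mv_normal 0 (spiked_cov \<theta> (r n) v)"
  let ?g = "\<lambda>x. ennreal (exp (?k * ((?t \<bullet> x)\<^sup>2 - (\<theta> \<bullet> x)\<^sup>2)))"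
  interpret prob_space "sample_law n \<theta> (r n) v" by (rule prob_space_sample_law)
  have d: "mv_normal 0 (spiked_cov ?t (r n) v) = density ?M ?g"
    by (rule mv_normal_spiked_density[OF \<theta> \<theta>' c])
  have eq: "density (sample_law n \<theta> (r n) v) (\<lambda>x. \<Prod>i\<in>{1..n}. ?g (x i)) = sample_law n ?t (r n) v"
    unfolding sample_law_def d
  proof (rule PiM_density[symmetric])
    show "prob_space (density ?M ?g)" unfolding d[symmetric] by (rule prob_space_mv_normal)
  qed (auto intro: prob_space_mv_normal)
  have "AE x in sample_law n \<theta> (r n) v. (\<Prod>i\<in>{1..n}. ?g (x i)) =
      RN_deriv (sample_law n \<theta> (r n) v) (sample_law n ?t (r n) v) x"
    by (rule RN_deriv_unique[OF _ eq]) measurable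
  then show ?thesis
  proof eventually_elim
    case (elim x)
    have "(\<Prod>i\<in>{1..n}. ?g (x i)) = ennreal (exp (?k * (\<Sum>i\<in>{1..n}. (?t \<bullet> x i)\<^sup>2 - (\<theta> \<bullet> x i)\<^sup>2)))"
      by (simp only: prod_ennreal[OF exp_ge_zero] sum_distrib_left exp_sum[OF finite_atLeastAtMost])
    then show ?case unfolding log_lik_ratio_def elim[symmetric] by simp
  qed
qed

lemma log_lik_ratio_measurable [measurable]:
  "log_lik_ratio \<theta> r v \<nu> \<tau> n \<in> borel_measurable (sample_law n \<theta> (r n) v)"
  unfolding log_lik_ratio_def[abs_def] by measurable

section \<open>Fluctuations of the sample covariance matrix\<close>

text \<open>The mixed terms of the expanded square vanish by independence and centring. Writing each term as a
  product over all indices treats diagonal and mixed terms at once.\<close>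

lemma PiM_sum_square:
  fixes g :: "'a \<Rightarrow> real"
  assumes I: "finite I" and M: "prob_space M"
    and g: "integrable M g" "integrable M (\<lambda>x. (g x)\<^sup>2)" "(\<integral>x. g x \<partial>M) = 0"
  shows "integrable (\<Pi>\<^sub>M i\<in>I. M) (\<lambda>x. (\<Sum>i\<in>I. g (x i))\<^sup>2)"
    and "(\<integral>x. (\<Sum>i\<in>I. g (x i))\<^sup>2 \<partial>(\<Pi>\<^sub>M i\<in>I. M)) = real (card I) * (\<integral>x. (g x)\<^sup>2 \<partial>M)"
proof -
  interpret M: prob_space M by fact
  interpret PM: product_sigma_finite "\<lambda>_. M" ..
  let ?f = "\<lambda>i j k x. (if k = i then g x else 1) * (if k = j then g x else 1)"
  have prod: "g (x i) * g (x j) = (\<Prod>k\<in>I. ?f i j k (x k))" if "i \<in> I" "j \<in> I" for i j and x :: "_ \<Rightarrow> 'a"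
    using I that by (simp add: prod.distrib)
  have int: "integrable M (?f i j k)" for i j k
    using g by (cases "k = i"; cases "k = j") (auto simp: power2_eq_square)
  have intprod: "integrable (\<Pi>\<^sub>M i\<in>I. M) (\<lambda>x. g (x i) * g (x j))" if "i \<in> I" "j \<in> I" for i j
    unfolding prod[OF that] by (rule PM.product_integrable_prod[OF I int])
  have val: "(\<integral>x. g (x i) * g (x j) \<partial>(\<Pi>\<^sub>M i\<in>I. M)) = (if i = j then \<integral>x. (g x)\<^sup>2 \<partial>M else 0)"
    if ij: "i \<in> I" "j \<in> I" for i j
  proof -
    have "(\<integral>x. g (x i) * g (x j) \<partial>(\<Pi>\<^sub>M i\<in>I. M)) = (\<Prod>k\<in>I. \<integral>x. ?f i j k x \<partial>M)"
      unfolding prod[OF ij] by (rule PM.product_integral_prod[OF I int])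
    also have "\<dots> = (if i = j then \<integral>x. (g x)\<^sup>2 \<partial>M else 0)"
    proof (cases "i = j")
      case True
      have "(\<Prod>k\<in>I. \<integral>x. ?f i j k x \<partial>M) = (\<Prod>k\<in>I. if k = i then \<integral>x. (g x)\<^sup>2 \<partial>M else 1)"
        by (rule prod.cong) (auto simp: True power2_eq_square M.prob_space)
      then show ?thesis using I ij True by simp
    next
      case False
      have "(\<integral>x. ?f i j i x \<partial>M) = 0" using False g(3) by simp
      then have "(\<Prod>k\<in>I. \<integral>x. ?f i j k x \<partial>M) = 0"
        using ij by (intro prod_zero[OF I]) (rule bexI)
      then show ?thesis using False by (simp only: if_False)
    qed
    finally show ?thesis .
  qed
  have sq: "(\<Sum>i\<in>I. g (x i))\<^sup>2 = (\<Sum>i\<in>I. \<Sum>j\<in>I. g (x i) * g (x j))" for x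
    by (simp add: power2_eq_square sum_product)
  show "integrable (\<Pi>\<^sub>M i\<in>I. M) (\<lambda>x. (\<Sum>i\<in>I. g (x i))\<^sup>2)"
    unfolding sq by (intro Bochner_Integration.integrable_sum intprod)
  have "(\<integral>x. (\<Sum>i\<in>I. g (x i))\<^sup>2 \<partial>(\<Pi>\<^sub>M i\<in>I. M)) =
      (\<Sum>i\<in>I. \<Sum>j\<in>I. if i = j then \<integral>x. (g x)\<^sup>2 \<partial>M else 0)"
    unfolding sq
    by (simp add: Bochner_Integration.integral_sum Bochner_Integration.integrable_sum intprod val cong: sum.cong)
  also have "\<dots> = real (card I) * (\<integral>x. (g x)\<^sup>2 \<partial>M)"
    using I by simp
  finally show "(\<integral>x. (\<Sum>i\<in>I. g (x i))\<^sup>2 \<partial>(\<Pi>\<^sub>M i\<in>I. M)) = real (card I) * (\<integral>x. (g x)\<^sup>2 \<partial>M)" .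
qed

lemma gauss_inner_moment:
  fixes a :: "'a::euclidean_space"
  shows "integrable gauss (\<lambda>z. (a \<bullet> z) ^ k)"
    and "(\<integral>z. (a \<bullet> z) ^ k \<partial>gauss) = norm a ^ k * (\<integral>t. t ^ k \<partial>std_normal_distribution)"
proof -
  have i: "integrable gauss (\<lambda>t::real. t ^ k)"
    by (simp add: gauss_real integrable_density integrable_std_normal_moment)
  have "integrable (distr gauss borel ((\<bullet>) a)) (\<lambda>t. t ^ k)"
    unfolding gauss_inner_scaled using i by (simp add: integrable_distr_eq power_mult_distrib)
  then show "integrable gauss (\<lambda>z. (a \<bullet> z) ^ k)"
    by (simp add: integrable_distr_eq)
  have "(\<integral>z. (a \<bullet> z) ^ k \<partial>gauss) = (\<integral>t. t ^ k \<partial>distr gauss borel ((\<bullet>) a))"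
    by (simp add: integral_distr)
  also have "\<dots> = norm a ^ k * (\<integral>t. t ^ k \<partial>std_normal_distribution)"
    unfolding gauss_inner_scaled by (simp add: integral_distr power_mult_distrib gauss_real)
  finally show "(\<integral>z. (a \<bullet> z) ^ k \<partial>gauss) = norm a ^ k * (\<integral>t. t ^ k \<partial>std_normal_distribution)" .
qed

lemma gauss_inner_mean:
  "integrable gauss (\<lambda>z. a \<bullet> z)" "(\<integral>z. a \<bullet> z \<partial>gauss) = 0"
  using gauss_inner_moment[of a 1] integral_std_normal_distribution_moment_odd[of 1] by simp_all

lemma gauss_inner_square:
  "integrable gauss (\<lambda>z. (a \<bullet> z)\<^sup>2)" "(\<integral>z. (a \<bullet> z)\<^sup>2 \<partial>gauss) = (norm a)\<^sup>2"
  using gauss_inner_moment[of a 2] std_normal_distribution_even_moments[of 1] by simp_all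

lemma gauss_inner_fourth:
  "integrable gauss (\<lambda>z. (a \<bullet> z) ^ 4)" "(\<integral>z. (a \<bullet> z) ^ 4 \<partial>gauss) = 3 * norm a ^ 4"
  using gauss_inner_moment[of a 4] std_normal_distribution_even_moments[of 2]
  by (simp_all add: fact_numeral)

lemma gauss_inner_product:
  "integrable gauss (\<lambda>z. (a \<bullet> z) * (b \<bullet> z))" "(\<integral>z. (a \<bullet> z) * (b \<bullet> z) \<partial>gauss) = a \<bullet> b"
proof -
  have eq: "(a \<bullet> z) * (b \<bullet> z) = 1 / 4 * (((a + b) \<bullet> z)\<^sup>2 - ((a - b) \<bullet> z)\<^sup>2)" for z
    by (simp add: inner_add_left inner_diff_left power2_eq_square algebra_simps)
  show "integrable gauss (\<lambda>z. (a \<bullet> z) * (b \<bullet> z))"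
    unfolding eq by (intro integrable_mult_right Bochner_Integration.integrable_diff gauss_inner_square)
  show "(\<integral>z. (a \<bullet> z) * (b \<bullet> z) \<partial>gauss) = a \<bullet> b"
    unfolding eq
    by (simp add: gauss_inner_square Bochner_Integration.integral_diff)
      (simp add: power2_norm_eq_inner inner_add_left inner_diff_left inner_add_right inner_diff_right
        inner_commute algebra_simps)
qed

text \<open>The crude bound \<open>(p q - c)\<^sup>2 \<le> p\<^sup>4 + q\<^sup>4 + 2 c\<^sup>2\<close> reduces the variance to fourth moments.\<close>

lemma gauss_inner_product_variance:
  "integrable gauss (\<lambda>z. ((a \<bullet> z) * (b \<bullet> z) - a \<bullet> b)\<^sup>2)"
  "(\<integral>z. ((a \<bullet> z) * (b \<bullet> z) - a \<bullet> b)\<^sup>2 \<partial>gauss) \<le> 3 * norm a ^ 4 + 3 * norm b ^ 4 + 2 * (a \<bullet> b)\<^sup>2"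
proof -
  let ?u = "\<lambda>z. (a \<bullet> z) ^ 4 + (b \<bullet> z) ^ 4 + 2 * (a \<bullet> b)\<^sup>2"
  have le: "(p * q - c)\<^sup>2 \<le> p ^ 4 + q ^ 4 + 2 * c\<^sup>2" for p q c :: real
  proof -
    have "(p * q - c)\<^sup>2 \<le> 2 * (p\<^sup>2 * q\<^sup>2) + 2 * c\<^sup>2"
      using zero_le_power2[of "p * q + c"] by (simp add: power2_eq_square algebra_simps)
    also have "2 * (p\<^sup>2 * q\<^sup>2) \<le> p ^ 4 + q ^ 4"
      using zero_le_power2[of "p\<^sup>2 - q\<^sup>2"] by (simp add: power2_eq_square power4_eq_xxxx algebra_simps)
    finally show ?thesis by simp
  qed
  have u: "integrable gauss ?u"
    by (intro Bochner_Integration.integrable_add gauss_inner_fourth gauss.integrable_const)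
  show i: "integrable gauss (\<lambda>z. ((a \<bullet> z) * (b \<bullet> z) - a \<bullet> b)\<^sup>2)"
    by (rule Bochner_Integration.integrable_bound[OF u]) (auto intro!: order_trans[OF le] AE_I2)
  have "(\<integral>z. ((a \<bullet> z) * (b \<bullet> z) - a \<bullet> b)\<^sup>2 \<partial>gauss) \<le> (\<integral>z. ?u z \<partial>gauss)"
    by (rule integral_mono[OF i u]) (rule le)
  also have "\<dots> = 3 * norm a ^ 4 + 3 * norm b ^ 4 + 2 * (a \<bullet> b)\<^sup>2"
    by (simp add: gauss_inner_fourth gauss.prob_space[simplified])
  finally show "(\<integral>z. ((a \<bullet> z) * (b \<bullet> z) - a \<bullet> b)\<^sup>2 \<partial>gauss) \<le> 3 * norm a ^ 4 + 3 * norm b ^ 4 + 2 * (a \<bullet> b)\<^sup>2" .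
qed

lemma inner_stretch: "a \<bullet> stretch \<theta> s z = stretch \<theta> s a \<bullet> z"
  by (simp add: stretch_def inner_add_left inner_add_right inner_commute)

lemma stretch_inner_stretch:
  assumes "norm \<theta> = 1"
  shows "stretch \<theta> s a \<bullet> stretch \<theta> s b = a \<bullet> b + (s\<^sup>2 - 1) * (\<theta> \<bullet> a) * (\<theta> \<bullet> b)"
proof -
  have "\<theta> \<bullet> \<theta> = 1" using assms by (simp add: dot_square_norm)
  then show ?thesis
    by (simp add: stretch_def inner_add_left inner_add_right inner_commute power2_eq_square algebra_simps)
qed

lemma norm_stretch_le:
  assumes \<theta>: "norm \<theta> = 1" and s: "1 \<le> s"
  shows "norm (stretch \<theta> s a) \<le> s * norm a"
proof -
  have "(\<theta> \<bullet> a)\<^sup>2 \<le> (norm a)\<^sup>2"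
    using Cauchy_Schwarz_ineq[of \<theta> a] \<theta> by (simp add: power2_norm_eq_inner[symmetric])
  then have "(s\<^sup>2 - 1) * (\<theta> \<bullet> a)\<^sup>2 \<le> (s\<^sup>2 - 1) * (norm a)\<^sup>2"
    using s by (intro mult_left_mono) auto
  then have "(norm (stretch \<theta> s a))\<^sup>2 \<le> (s * norm a)\<^sup>2"
    unfolding power2_norm_eq_inner[of "stretch \<theta> s a"] stretch_inner_stretch[OF \<theta>]
    by (simp add: power2_norm_eq_inner[symmetric] power_mult_distrib power2_eq_square[of "\<theta> \<bullet> a"] algebra_simps)
  then show ?thesis by (rule power2_le_imp_le) (use s in auto)
qed

lemma mv_normal_entry_moments:
  fixes \<theta> :: "real ^ 'p"
  assumes \<theta>: "norm \<theta> = 1" and c: "0 \<le> \<rho> * v"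
  defines "M \<equiv> mv_normal 0 (spiked_cov \<theta> \<rho> v)"
  shows "integrable M (\<lambda>x. x $ i)" "(\<integral>x. x $ i \<partial>M) = 0"
    and "integrable M (\<lambda>x. (x $ i)\<^sup>2)" "(\<integral>x. (x $ i)\<^sup>2 \<partial>M) \<le> 1 + \<rho> * v"
    and "integrable M (\<lambda>x. x $ i * x $ j - spiked_cov \<theta> \<rho> v $ i $ j)"
    and "(\<integral>x. x $ i * x $ j - spiked_cov \<theta> \<rho> v $ i $ j \<partial>M) = 0"
    and "integrable M (\<lambda>x. (x $ i * x $ j - spiked_cov \<theta> \<rho> v $ i $ j)\<^sup>2)"
    and "(\<integral>x. (x $ i * x $ j - spiked_cov \<theta> \<rho> v $ i $ j)\<^sup>2 \<partial>M) \<le> 8 * (1 + \<rho> * v)\<^sup>2"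
proof -
  let ?s = "sqrt (1 + \<rho> * v)"
  let ?a = "\<lambda>i. stretch \<theta> ?s (axis i 1) :: real ^ 'p"
  have s: "1 \<le> ?s" "?s\<^sup>2 = 1 + \<rho> * v" using c by auto
  have M: "M = distr gauss borel (stretch \<theta> ?s)" unfolding M_def by (rule mv_normal_spiked[OF \<theta> c])
  have comp: "stretch \<theta> ?s z $ i = ?a i \<bullet> z" for i z
    by (subst inner_stretch[symmetric]) (simp add: inner_axis')
  have cov: "spiked_cov \<theta> \<rho> v $ i $ j = ?a i \<bullet> ?a j" for i j
    unfolding stretch_inner_stretch[OF \<theta>] s(2)
    by (simp add: spiked_cov_def mat_def outer_def inner_axis inner_axis_axis) (auto simp: axis_def)
  have na: "norm (?a i) \<le> ?s" for i
    using norm_stretch_le[OF \<theta> s(1), of "axis i 1"] by simp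
  show "integrable M (\<lambda>x. x $ i)" "(\<integral>x. x $ i \<partial>M) = 0"
    unfolding M by (simp_all add: integrable_distr_eq integral_distr comp gauss_inner_mean)
  show "integrable M (\<lambda>x. (x $ i)\<^sup>2)"
    unfolding M by (simp add: integrable_distr_eq comp gauss_inner_square)
  have "(norm (?a i))\<^sup>2 \<le> ?s\<^sup>2" using na by (intro power_mono) auto
  then show "(\<integral>x. (x $ i)\<^sup>2 \<partial>M) \<le> 1 + \<rho> * v"
    unfolding M using s(2) by (simp add: integral_distr comp gauss_inner_square)
  show "integrable M (\<lambda>x. x $ i * x $ j - spiked_cov \<theta> \<rho> v $ i $ j)"
    unfolding M by (subst integrable_distr_eq) (simp_all add: comp cov gauss_inner_product)
  show "(\<integral>x. x $ i * x $ j - spiked_cov \<theta> \<rho> v $ i $ j \<partial>M) = 0"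
    unfolding M by (subst integral_distr) (simp_all add: comp cov gauss_inner_product gauss.prob_space[simplified])
  show "integrable M (\<lambda>x. (x $ i * x $ j - spiked_cov \<theta> \<rho> v $ i $ j)\<^sup>2)"
    unfolding M by (simp add: integrable_distr_eq comp cov gauss_inner_product_variance)
  have "(\<integral>x. (x $ i * x $ j - spiked_cov \<theta> \<rho> v $ i $ j)\<^sup>2 \<partial>M) \<le>
      3 * norm (?a i) ^ 4 + 3 * norm (?a j) ^ 4 + 2 * (?a i \<bullet> ?a j)\<^sup>2"
    unfolding M by (simp add: integral_distr comp cov gauss_inner_product_variance)
  also have "\<dots> \<le> 3 * ?s ^ 4 + 3 * ?s ^ 4 + 2 * ?s ^ 4"
  proof -
    have "\<bar>?a i \<bullet> ?a j\<bar> \<le> norm (?a i) * norm (?a j)" by (rule Cauchy_Schwarz_ineq2)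
    also have "\<dots> \<le> ?s * ?s" using na s by (intro mult_mono) auto
    finally have "\<bar>?a i \<bullet> ?a j\<bar>\<^sup>2 \<le> (?s * ?s)\<^sup>2" by (intro power_mono) auto
    then have "(?a i \<bullet> ?a j)\<^sup>2 \<le> ?s ^ 4" by (simp add: power2_eq_square power4_eq_xxxx mult.assoc)
    moreover have "norm (?a k) ^ 4 \<le> ?s ^ 4" for k using na by (intro power_mono) auto
    ultimately show ?thesis by (intro add_mono mult_left_mono) auto
  qed
  also have "\<dots> = 8 * (?s\<^sup>2)\<^sup>2" by (simp only: power_mult[symmetric]) simp
  finally show "(\<integral>x. (x $ i * x $ j - spiked_cov \<theta> \<rho> v $ i $ j)\<^sup>2 \<partial>M) \<le> 8 * (1 + \<rho> * v)\<^sup>2"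
    unfolding s(2) .
qed

definition scaled_error :: "real ^ 'p \<Rightarrow> real \<Rightarrow> real \<Rightarrow> nat \<Rightarrow> (nat \<Rightarrow> real ^ 'p) \<Rightarrow> real ^ 'p ^ 'p" where
  "scaled_error \<theta> \<rho> v n x = sqrt (real n) *\<^sub>R (sample_cov n x - spiked_cov \<theta> \<rho> v)"

text \<open>One random variable that dominates every stochastic term of the expansions: all bilinear forms in
  \<open>scaled_error\<close>, the squared scaled mean, and, through the summand 1, all deterministic errors.\<close>

definition fluct :: "real ^ 'p \<Rightarrow> real \<Rightarrow> real \<Rightarrow> nat \<Rightarrow> (nat \<Rightarrow> real ^ 'p) \<Rightarrow> real" where
  "fluct \<theta> \<rho> v n x =
     1 + (\<Sum>i\<in>UNIV. \<Sum>j\<in>UNIV. \<bar>scaled_error \<theta> \<rho> v n x $ i $ j\<bar>) + real n * (norm (sample_mean n x))\<^sup>2"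

lemma sample_cov_entry:
  assumes "n \<ge> 1"
  shows "sample_cov n x $ i $ j =
    (1 / real n) * (\<Sum>k\<in>{1..n}. x k $ i * x k $ j) - sample_mean n x $ i * sample_mean n x $ j"
proof -
  let ?m = "sample_mean n x"
  have m: "(\<Sum>k\<in>{1..n}. x k $ l) = real n * ?m $ l" for l
    using assms by (simp add: sample_mean_def)
  have "(\<Sum>k\<in>{1..n}. (x k $ i - ?m $ i) * (x k $ j - ?m $ j)) =
      (\<Sum>k\<in>{1..n}. x k $ i * x k $ j) - ?m $ j * (\<Sum>k\<in>{1..n}. x k $ i)
        - ?m $ i * (\<Sum>k\<in>{1..n}. x k $ j) + real n * (?m $ i * ?m $ j)"
    by (simp add: algebra_simps sum.distrib sum_subtractf sum_distrib_left)
  also have "\<dots> = (\<Sum>k\<in>{1..n}. x k $ i * x k $ j) - real n * (?m $ i * ?m $ j)"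
    unfolding m by (simp add: algebra_simps)
  finally show ?thesis
    using assms by (simp add: sample_cov_def outer_def right_diff_distrib)
qed

lemma sample_mean_measurable [measurable]:
  "sample_mean n \<in> borel_measurable (sample_law n \<theta> \<rho> v)"
  unfolding sample_mean_def[abs_def] by measurable

lemma sample_cov_mult_vec:
  fixes w :: "real ^ 'p"
  shows "sample_cov n x *v w =
    (1 / real n) *\<^sub>R (\<Sum>i\<in>{1..n}. ((x i - sample_mean n x) \<bullet> w) *\<^sub>R (x i - sample_mean n x))"
proof -
  have "(\<Sum>i\<in>I. A i) *v w = (\<Sum>i\<in>I. A i *v w)" if "finite I" for I and A :: "nat \<Rightarrow> real ^ 'p ^ 'p"
    using that by induction (auto simp: matrix_vector_mult_add_rdistrib)
  from this[of "{1..n}"] show ?thesis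
    unfolding sample_cov_def scaleR_matrix_mult_vec by (simp only: outer_mult_vec finite_atLeastAtMost)
qed

lemma sample_cov_mult_vec_measurable [measurable]:
  "(\<lambda>x. sample_cov n x *v w) \<in> borel_measurable (sample_law n \<theta> \<rho> v)"
  unfolding sample_cov_mult_vec by measurable

lemma sample_cov_entry_measurable [measurable]:
  "(\<lambda>x. sample_cov n x $ i $ j) \<in> borel_measurable (sample_law n \<theta> \<rho> v)"
  unfolding sample_cov_def outer_def by simp

lemma fluct_ge_1: "1 \<le> fluct \<theta> \<rho> v n x"
  unfolding fluct_def by (simp add: sum_nonneg)

lemma fluct_measurable [measurable]:
  "fluct \<theta> \<rho> v n \<in> borel_measurable (sample_law n \<theta> \<rho> v)"
  unfolding fluct_def[abs_def] scaled_error_def by simp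

lemma fluct_mean_le: "real n * (norm (sample_mean n x))\<^sup>2 \<le> fluct \<theta> \<rho> v n x"
  unfolding fluct_def by (simp add: sum_nonneg add_nonneg_nonneg)

lemma fluct_bilinear:
  "\<bar>a \<bullet> (scaled_error \<theta> \<rho> v n x *v w)\<bar> \<le> norm a * norm w * fluct \<theta> \<rho> v n x"
proof -
  let ?A = "scaled_error \<theta> \<rho> v n x"
  have "\<bar>a \<bullet> (?A *v w)\<bar> = \<bar>\<Sum>i\<in>UNIV. \<Sum>j\<in>UNIV. a $ i * (?A $ i $ j * w $ j)\<bar>"
    by (simp add: inner_vec_def matrix_vector_mult_def sum_distrib_left)
  also have "\<dots> \<le> (\<Sum>i\<in>UNIV. \<Sum>j\<in>UNIV. \<bar>a $ i * (?A $ i $ j * w $ j)\<bar>)"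
    by (intro order_trans[OF sum_abs] sum_mono sum_abs)
  also have "\<dots> \<le> (\<Sum>i\<in>UNIV. \<Sum>j\<in>UNIV. norm a * norm w * \<bar>?A $ i $ j\<bar>)"
  proof (intro sum_mono)
    fix i j
    have "\<bar>a $ i\<bar> * \<bar>w $ j\<bar> * \<bar>?A $ i $ j\<bar> \<le> norm a * norm w * \<bar>?A $ i $ j\<bar>"
      by (intro mult_right_mono mult_mono component_le_norm_cart) auto
    then show "\<bar>a $ i * (?A $ i $ j * w $ j)\<bar> \<le> norm a * norm w * \<bar>?A $ i $ j\<bar>"
      by (simp add: abs_mult ac_simps)
  qed
  also have "\<dots> \<le> norm a * norm w * fluct \<theta> \<rho> v n x"
    unfolding fluct_def sum_distrib_left[symmetric] by (intro mult_left_mono) auto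
  finally show ?thesis .
qed

lemma fluct_bilinear_le:
  assumes "norm a \<le> A" "norm w \<le> W"
  shows "\<bar>a \<bullet> (scaled_error \<theta> \<rho> v n x *v w)\<bar> \<le> A * W * fluct \<theta> \<rho> v n x"
proof -
  have "0 \<le> A" "0 \<le> W" using assms norm_ge_zero order_trans by blast+
  moreover have "0 \<le> fluct \<theta> \<rho> v n x" using fluct_ge_1[of \<theta> \<rho> v n x] by simp
  ultimately have "norm a * norm w * fluct \<theta> \<rho> v n x \<le> A * W * fluct \<theta> \<rho> v n x"
    using assms by (intro mult_right_mono mult_mono) auto
  with fluct_bilinear show ?thesis by (rule order_trans)
qed

lemma abs_le_one_plus_square: "\<bar>t\<bar> \<le> 1 + t\<^sup>2" for t :: real
proof -
  have "0 \<le> (\<bar>t\<bar> - 1)\<^sup>2" by simp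
  also have "\<dots> = t\<^sup>2 - 2 * \<bar>t\<bar> + 1" by (simp add: power2_diff)
  finally show ?thesis using abs_ge_zero[of t] by linarith
qed

text \<open>Each entry of \<open>\<surd>n (S - \<Sigma>)\<close> is a centred and normalised sum of independent terms minus a product
  of sample means. First absolute moments are bounded through \<open>|t| \<le> 1 + t\<^sup>2\<close>, hence by variances that
  do not depend on \<open>n\<close>.\<close>

lemma fluct_bounded_expectation:
  fixes \<theta> :: "real ^ 'p"
  assumes \<theta>: "norm \<theta> = 1" and c: "0 \<le> \<rho> * v" "\<rho> * v \<le> B" and n: "n \<ge> 1"
  defines "d \<equiv> real CARD('p)"
  shows "integrable (sample_law n \<theta> \<rho> v) (fluct \<theta> \<rho> v n)"
    and "(\<integral>x. fluct \<theta> \<rho> v n x \<partial>sample_law n \<theta> \<rho> v) \<le>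
      1 + d\<^sup>2 * (1 + 8 * (1 + B)\<^sup>2) + (1 + d\<^sup>2) * (d * (1 + B))"
proof -
  let ?M = "mv_normal 0 (spiked_cov \<theta> \<rho> v)" and ?P = "sample_law n \<theta> \<rho> v"
  interpret P: prob_space ?P by (rule prob_space_sample_law)
  let ?g = "\<lambda>i j x. x $ i * x $ j - spiked_cov \<theta> \<rho> v $ i $ j"
  let ?G = "\<lambda>i j x. (1 / sqrt n) * (\<Sum>k\<in>{1..n}. ?g i j (x k))"
  let ?F = "\<lambda>i x. (1 / sqrt n) * (\<Sum>k\<in>{1..n}. x k $ i)"
  note m = mv_normal_entry_moments[OF \<theta> c(1)]
  have G: "integrable ?P (\<lambda>x. (?G i j x)\<^sup>2)" "(\<integral>x. (?G i j x)\<^sup>2 \<partial>?P) \<le> 8 * (1 + B)\<^sup>2" for i j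
  proof -
    note S = PiM_sum_square[OF _ prob_space_mv_normal m(5) m(7) m(6), of "{1..n}" i j, folded sample_law_def]
    show "integrable ?P (\<lambda>x. (?G i j x)\<^sup>2)"
      unfolding power_mult_distrib using S(1) by simp
    have "(\<integral>x. (?G i j x)\<^sup>2 \<partial>?P) = (\<integral>x. (?g i j x)\<^sup>2 \<partial>?M)"
      unfolding power_mult_distrib using S(2) n by (simp add: power_divide)
    also have "\<dots> \<le> 8 * (1 + \<rho> * v)\<^sup>2" by (rule m(8))
    also have "\<dots> \<le> 8 * (1 + B)\<^sup>2" using c by (intro mult_left_mono power_mono) auto
    finally show "(\<integral>x. (?G i j x)\<^sup>2 \<partial>?P) \<le> 8 * (1 + B)\<^sup>2" .
  qed
  have F: "integrable ?P (\<lambda>x. (?F i x)\<^sup>2)" "(\<integral>x. (?F i x)\<^sup>2 \<partial>?P) \<le> 1 + B" for i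
  proof -
    note S = PiM_sum_square[OF _ prob_space_mv_normal m(1) m(3) m(2), of "{1..n}" i, folded sample_law_def]
    show "integrable ?P (\<lambda>x. (?F i x)\<^sup>2)"
      unfolding power_mult_distrib using S(1) by simp
    have "(\<integral>x. (?F i x)\<^sup>2 \<partial>?P) = (\<integral>x. (x $ i)\<^sup>2 \<partial>?M)"
      unfolding power_mult_distrib using S(2) n by (simp add: power_divide)
    also have "\<dots> \<le> 1 + B" using m(4)[of i] c by simp
    finally show "(\<integral>x. (?F i x)\<^sup>2 \<partial>?P) \<le> 1 + B" .
  qed
  let ?U = "\<lambda>x. 1 + (\<Sum>i\<in>UNIV. \<Sum>j\<in>UNIV. 1 + (?G i j x)\<^sup>2) + (1 + d\<^sup>2) * (\<Sum>i\<in>UNIV. (?F i x)\<^sup>2)"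
  have mean: "real n * (norm (sample_mean n x))\<^sup>2 = (\<Sum>i\<in>UNIV. (?F i x)\<^sup>2)" for x
  proof -
    have "(?F i x)\<^sup>2 = real n * (sample_mean n x $ i)\<^sup>2" for i
      using n by (simp add: sample_mean_def power_mult_distrib power_divide power2_eq_square)
    then have "(\<Sum>i\<in>UNIV. (?F i x)\<^sup>2) = (\<Sum>i\<in>UNIV. real n * (sample_mean n x $ i)\<^sup>2)"
      by (intro sum.cong) auto
    also have "\<dots> = real n * (norm (sample_mean n x))\<^sup>2"
      unfolding power2_norm_eq_inner inner_vec_def by (simp add: sum_distrib_left power2_eq_square)
    finally show ?thesis ..
  qed
  have le: "fluct \<theta> \<rho> v n x \<le> ?U x" for x
  proof -
    have "\<bar>scaled_error \<theta> \<rho> v n x $ i $ j\<bar> \<le> (1 + (?G i j x)\<^sup>2) + (\<Sum>i\<in>UNIV. (?F i x)\<^sup>2)" for i j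
    proof -
      let ?m = "sample_mean n x"
      have nn: "real n * (1 / sqrt n) = sqrt n" "sqrt n * (1 / real n) = 1 / sqrt n"
        using n by (simp_all add: real_div_sqrt field_simps)
      have nn': "real n * y / sqrt n = sqrt n * y" for y
        by (subst nn(1)[symmetric]) simp
      have "scaled_error \<theta> \<rho> v n x $ i $ j = ?G i j x - sqrt n * (?m $ i * ?m $ j)"
      proof -
        have "scaled_error \<theta> \<rho> v n x $ i $ j = (sqrt n * (1 / real n)) * (\<Sum>k\<in>{1..n}. x k $ i * x k $ j)
            - sqrt n * (?m $ i * ?m $ j) - sqrt n * spiked_cov \<theta> \<rho> v $ i $ j"
          by (simp add: scaled_error_def sample_cov_entry[OF n] right_diff_distrib mult.assoc)
        also have "\<dots> = ?G i j x - sqrt n * (?m $ i * ?m $ j)"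
          unfolding nn(2) by (simp add: sum_subtractf right_diff_distrib nn' algebra_simps)
        finally show ?thesis .
      qed
      moreover have "\<bar>?G i j x\<bar> \<le> 1 + (?G i j x)\<^sup>2" by (rule abs_le_one_plus_square)
      moreover have "\<bar>sqrt n * (?m $ i * ?m $ j)\<bar> \<le> real n * (norm ?m)\<^sup>2"
      proof -
        have "\<bar>?m $ i * ?m $ j\<bar> \<le> norm ?m * norm ?m"
          unfolding abs_mult by (intro mult_mono component_le_norm_cart) auto
        moreover have "sqrt n \<le> real n" using n by (intro real_le_lsqrt) (auto simp: power2_eq_square)
        ultimately show ?thesis
          unfolding abs_mult[of "sqrt n"] power2_eq_square by (intro mult_mono) auto
      qed
      ultimately show ?thesis unfolding mean[symmetric] by linarith
    qed
    then have "(\<Sum>i\<in>UNIV. \<Sum>j\<in>UNIV. \<bar>scaled_error \<theta> \<rho> v n x $ i $ j\<bar>) \<le>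
        (\<Sum>i\<in>(UNIV::'p set). \<Sum>j\<in>(UNIV::'p set). (1 + (?G i j x)\<^sup>2) + (\<Sum>i\<in>UNIV. (?F i x)\<^sup>2))"
      by (intro sum_mono)
    also have "\<dots> = (\<Sum>i\<in>UNIV. \<Sum>j\<in>UNIV. 1 + (?G i j x)\<^sup>2) + d\<^sup>2 * (\<Sum>i\<in>UNIV. (?F i x)\<^sup>2)"
      unfolding sum.distrib[of _ "\<lambda>_. sum _ _"] by (simp add: sum.distrib d_def power2_eq_square algebra_simps)
    finally show ?thesis unfolding fluct_def mean by (simp add: algebra_simps)
  qed
  have U: "integrable ?P ?U"
    by (intro Bochner_Integration.integrable_add Bochner_Integration.integrable_sum integrable_mult_right G F)
      auto
  have "norm (fluct \<theta> \<rho> v n x) \<le> norm (?U x)" for x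
    using fluct_ge_1[of \<theta> \<rho> v n x] le[of x] unfolding real_norm_def by linarith
  then show i: "integrable ?P (fluct \<theta> \<rho> v n)"
    by (intro Bochner_Integration.integrable_bound[OF U] AE_I2) simp_all
  have "(\<integral>x. fluct \<theta> \<rho> v n x \<partial>?P) \<le> (\<integral>x. ?U x \<partial>?P)"
    by (rule integral_mono[OF i U]) (rule le)
  also have "\<dots> = 1 + (\<Sum>i\<in>UNIV. \<Sum>j\<in>UNIV. 1 + (\<integral>x. (?G i j x)\<^sup>2 \<partial>?P)) + (1 + d\<^sup>2) * (\<Sum>i\<in>UNIV. \<integral>x. (?F i x)\<^sup>2 \<partial>?P)"
    using G(1) F(1) by (simp add: P.prob_space del: power_mult_distrib)
  also have "\<dots> \<le> 1 + (\<Sum>i\<in>(UNIV::'p set). \<Sum>j\<in>(UNIV::'p set). 1 + 8 * (1 + B)\<^sup>2) + (1 + d\<^sup>2) * (\<Sum>i\<in>(UNIV::'p set). 1 + B)"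
    by (intro add_mono sum_mono mult_left_mono order_refl G F) auto
  also have "\<dots> = 1 + d\<^sup>2 * (1 + 8 * (1 + B)\<^sup>2) + (1 + d\<^sup>2) * (d * (1 + B))"
    by (simp add: d_def power2_eq_square)
  finally show "(\<integral>x. fluct \<theta> \<rho> v n x \<partial>?P) \<le> 1 + d\<^sup>2 * (1 + 8 * (1 + B)\<^sup>2) + (1 + d\<^sup>2) * (d * (1 + B))" .
qed

section \<open>Expansion of the log-likelihood ratio\<close>

text \<open>Markov's inequality.\<close>

lemma is_oP1_dominated:
  assumes M: "\<And>n. prob_space (M n)" and X: "\<And>n. X n \<in> borel_measurable (M n)"
    and T: "\<And>n. n \<ge> 1 \<Longrightarrow> integrable (M n) (T n)" "\<And>n x. n \<ge> 1 \<Longrightarrow> 0 \<le> T n x"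
    and K: "\<And>n. n \<ge> 1 \<Longrightarrow> (\<integral>x. T n x \<partial>M n) \<le> K"
    and le: "\<And>n. n \<ge> 1 \<Longrightarrow> AE x in M n. \<bar>X n x\<bar> \<le> a n * T n x"
    and a: "\<And>n. n \<ge> 1 \<Longrightarrow> 0 \<le> a n" "a \<longlonglongrightarrow> 0"
  shows "is_oP1 M X"
  unfolding is_oP1_def
proof (intro conjI allI impI X)
  fix \<epsilon> :: real assume \<epsilon>: "\<epsilon> > 0"
  have "measure (M n) {x \<in> space (M n). \<bar>X n x\<bar> > \<epsilon>} \<le> a n * K / \<epsilon>" if n: "n \<ge> 1" for n
  proof -
    interpret prob_space "M n" by (rule M)
    note [measurable] = X[of n] borel_measurable_integrable[OF T(1)[OF n]]
    have "measure (M n) {x \<in> space (M n). \<bar>X n x\<bar> > \<epsilon>} \<le> measure (M n) {x \<in> space (M n). a n * T n x \<ge> \<epsilon>}"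
    proof (rule finite_measure_mono_AE)
      show "AE x in M n. x \<in> {x \<in> space (M n). \<bar>X n x\<bar> > \<epsilon>} \<longrightarrow> x \<in> {x \<in> space (M n). a n * T n x \<ge> \<epsilon>}"
        using le[OF n] by eventually_elim auto
    qed measurable
    also have "\<dots> \<le> (\<integral>x. a n * T n x \<partial>M n) / \<epsilon>"
      using T[OF n] a(1)[OF n] \<epsilon> by (intro integral_Markov_inequality_measure[where A = "{}"]) auto
    also have "\<dots> = a n * (\<integral>x. T n x \<partial>M n) / \<epsilon>" by simp
    also have "\<dots> \<le> a n * K / \<epsilon>"
      using K[OF n] a(1)[OF n] \<epsilon> by (intro divide_right_mono mult_left_mono) auto
    finally show ?thesis .
  qed
  then have "\<forall>\<^sub>F n in sequentially. measure (M n) {x \<in> space (M n). \<bar>X n x\<bar> > \<epsilon>} \<le> a n * K / \<epsilon>"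
    by (auto simp: eventually_sequentially)
  moreover have "(\<lambda>n. a n * K / \<epsilon>) \<longlonglongrightarrow> 0"
    using a(2) \<epsilon> by (auto intro!: tendsto_eq_intros)
  ultimately show "(\<lambda>n. measure (M n) {x \<in> space (M n). \<bar>X n x\<bar> > \<epsilon>}) \<longlonglongrightarrow> 0"
    by (rule tendsto_sandwich[OF _ _ tendsto_const, rotated]) auto
qed

lemma sample_law_is_oP1:
  fixes \<theta> :: "real ^ 'p"
  assumes \<theta>: "norm \<theta> = 1" and v: "v > 0" and r: "\<forall>n\<ge>1. r n > 0" "bounded (r ` {1..})"
    and X: "\<And>n. X n \<in> borel_measurable (sample_law n \<theta> (r n) v)"
    and le: "\<And>n. n \<ge> 1 \<Longrightarrow> AE x in sample_law n \<theta> (r n) v. \<bar>X n x\<bar> \<le> a n * fluct \<theta> (r n) v n x"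
    and a: "a \<longlonglongrightarrow> 0"
  shows "is_oP1 (\<lambda>n. sample_law n \<theta> (r n) v) X"
proof -
  obtain R where R: "\<And>n. n \<ge> 1 \<Longrightarrow> \<bar>r n\<bar> \<le> R"
    using r(2) by (auto simp: bounded_iff)
  have rv: "0 \<le> r n * v" "r n * v \<le> R * v" if "n \<ge> 1" for n
    using r(1) R[OF that] v that by (auto intro: less_imp_le)
  note E = fluct_bounded_expectation[OF \<theta> rv]
  show ?thesis
  proof (rule is_oP1_dominated[where T = "\<lambda>n. fluct \<theta> (r n) v n" and a = "\<lambda>n. \<bar>a n\<bar>", OF prob_space_sample_law X])
    show "0 \<le> fluct \<theta> (r n) v n x" for n x using fluct_ge_1[of \<theta> "r n" v n x] by simp
    fix n :: nat assume n: "n \<ge> 1"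
    show "AE x in sample_law n \<theta> (r n) v. \<bar>X n x\<bar> \<le> \<bar>a n\<bar> * fluct \<theta> (r n) v n x"
      using le[OF n]
    proof eventually_elim
      case (elim x)
      also have "a n * fluct \<theta> (r n) v n x \<le> \<bar>a n\<bar> * fluct \<theta> (r n) v n x"
        using fluct_ge_1[of \<theta> "r n" v n x] by (intro mult_right_mono) auto
      finally show ?case .
    qed
    show "integrable (sample_law n \<theta> (r n) v) (fluct \<theta> (r n) v n)"
      "(\<integral>x. fluct \<theta> (r n) v n x \<partial>sample_law n \<theta> (r n) v) \<le>
        1 + (real CARD('p))\<^sup>2 * (1 + 8 * (1 + R * v)\<^sup>2) + (1 + (real CARD('p))\<^sup>2) * (real CARD('p) * (1 + R * v))"
      by (rule E[OF n n n])+
  next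
    show "(\<lambda>n. \<bar>a n\<bar>) \<longlonglongrightarrow> 0" using a by (rule tendsto_rabs_zero)
  qed simp
qed

text \<open>Expanding \<open>|\<theta> + \<nu>\<tau>|\<^sup>2 = 1\<close> determines the component of \<open>\<tau>\<close> along \<open>\<theta>\<close>. This second-order
  component is responsible for the quadratic term of the expansion.\<close>

lemma unit_perturbation:
  fixes \<theta> \<tau> :: "'a::real_inner"
  assumes "norm \<theta> = 1" "norm (\<theta> + \<nu> *\<^sub>R \<tau>) = 1" "\<nu> > 0"
  shows "\<theta> \<bullet> \<tau> = - \<nu> / 2 * (norm \<tau>)\<^sup>2" and "\<nu> * norm \<tau> \<le> 2"
proof -
  have "(norm (\<theta> + \<nu> *\<^sub>R \<tau>))\<^sup>2 = (norm \<theta>)\<^sup>2 + \<nu> * (2 * (\<theta> \<bullet> \<tau>) + \<nu> * (norm \<tau>)\<^sup>2)"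
    unfolding power2_norm_eq_inner
    by (simp add: inner_add_left inner_add_right inner_commute algebra_simps)
  then have "\<nu> * (2 * (\<theta> \<bullet> \<tau>) + \<nu> * (norm \<tau>)\<^sup>2) = 0" unfolding assms(1,2) by simp
  then have "2 * (\<theta> \<bullet> \<tau>) + \<nu> * (norm \<tau>)\<^sup>2 = 0" using assms(3) by simp
  then show "\<theta> \<bullet> \<tau> = - \<nu> / 2 * (norm \<tau>)\<^sup>2" by linarith
  have "\<nu> * norm \<tau> = norm ((\<theta> + \<nu> *\<^sub>R \<tau>) - \<theta>)" using assms(3) by simp
  also have "\<dots> \<le> norm (\<theta> + \<nu> *\<^sub>R \<tau>) + norm \<theta>" by (rule norm_triangle_ineq4)
  finally show "\<nu> * norm \<tau> \<le> 2" unfolding assms(1,2) by simp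
qed

lemma sample_cov_sym: "a \<bullet> (sample_cov n x *v b) = b \<bullet> (sample_cov n x *v a)"
  unfolding sample_cov_mult_vec
  by (simp add: inner_sum_right inner_commute mult.commute)

text \<open>The likelihood ratio involves uncentred second moments and the statistics involve the sample
  covariance; the difference is the squared sample mean.\<close>

lemma sum_squares_sample_cov:
  assumes n: "n \<ge> 1"
  shows "(\<Sum>i\<in>{1..n}. (a \<bullet> x i)\<^sup>2) = real n * (a \<bullet> (sample_cov n x *v a)) + real n * (a \<bullet> sample_mean n x)\<^sup>2"
proof -
  let ?m = "sample_mean n x"
  have m: "(\<Sum>i\<in>{1..n}. a \<bullet> x i) = real n * (a \<bullet> ?m)"
    using n by (simp add: sample_mean_def inner_sum_right)
  have "real n * (a \<bullet> (sample_cov n x *v a)) = (\<Sum>i\<in>{1..n}. (a \<bullet> x i - a \<bullet> ?m)\<^sup>2)"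
    using n unfolding sample_cov_mult_vec
    by (simp add: inner_sum_right inner_diff_left inner_diff_right inner_commute power2_eq_square)
  also have "\<dots> = (\<Sum>i\<in>{1..n}. (a \<bullet> x i)\<^sup>2) - 2 * (a \<bullet> ?m) * (\<Sum>i\<in>{1..n}. a \<bullet> x i) + real n * (a \<bullet> ?m)\<^sup>2"
    by (simp add: power2_diff sum.distrib sum_subtractf sum_distrib_left ac_simps)
  finally show ?thesis unfolding m by (simp add: power2_eq_square)
qed

lemma scaled_error_mult_vec:
  "scaled_error \<theta> \<rho> v n x *v w = sqrt (real n) *\<^sub>R ((sample_cov n x - spiked_cov \<theta> \<rho> v) *v w)"
  by (simp add: scaled_error_def scaleR_matrix_mult_vec)

lemma scaled_error_measurable [measurable]:
  "(\<lambda>x. scaled_error \<theta> \<rho> v n x *v w) \<in> borel_measurable (sample_law n \<theta> \<rho> v)"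
  unfolding scaled_error_mult_vec matrix_vector_mult_diff_rdistrib by measurable

text \<open>The expansion that all regimes share. Replacing the uncentred second-moment matrix by the sample
  covariance matrix is the only source of the error bound; its constant comes from
  \<open>2 + \<nu> |\<tau>| \<le> 4\<close>.\<close>

lemma log_lik_ratio_expansion:
  fixes \<theta> :: "real ^ 'p"
  assumes \<theta>: "norm \<theta> = 1" and v: "v > 0" and r: "r n > 0" and n: "n \<ge> 1" and \<nu>: "\<nu> n > 0"
    and \<theta>': "norm (\<theta> + \<nu> n *\<^sub>R \<tau> n) = 1"
  defines "H \<equiv> scaled_error \<theta> (r n) v n" and "c \<equiv> v / (1 + r n * v)" and "\<kappa> \<equiv> sqrt (real n) * r n * \<nu> n"
  shows "AE x in sample_law n \<theta> (r n) v.
    \<bar>log_lik_ratio \<theta> r v \<nu> \<tau> n x -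
      (\<kappa>\<^sup>2 * v * c / 2 * (- (norm (\<tau> n))\<^sup>2 + (\<nu> n)\<^sup>2 * norm (\<tau> n) ^ 4 / 4)
       + \<kappa> * c / 2 * (2 * (\<tau> n \<bullet> (H x *v \<theta>)) + \<nu> n * (\<tau> n \<bullet> (H x *v \<tau> n))))\<bar>
    \<le> 2 * v * \<kappa> * norm (\<tau> n) / sqrt (real n) * fluct \<theta> (r n) v n x"
proof -
  let ?t = "\<tau> n" and ?\<nu> = "\<nu> n" and ?\<rho> = "r n"
  let ?N = "norm (\<tau> n)"
  have rv: "0 \<le> ?\<rho> * v" using r v by simp
  have \<theta>\<theta>: "\<theta> \<bullet> \<theta> = 1" using \<theta> by (simp add: dot_square_norm)
  note up = unit_perturbation[OF \<theta> \<theta>' \<nu>]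
  have c0: "0 \<le> c" "c \<le> v" using rv v by (auto simp: c_def field_simps)
  have \<kappa>0: "0 \<le> \<kappa>" using r \<nu> by (simp add: \<kappa>_def)
  have sn: "sqrt (real n) > 0" "sqrt (real n) * sqrt (real n) = real n" using n by auto
  show ?thesis
    using AE_log_lik_ratio[where r = r and \<nu> = \<nu> and \<tau> = \<tau> and n = n, OF \<theta> \<theta>' rv]
  proof eventually_elim
    case (elim x)
    let ?m = "sample_mean n x" and ?S = "\<lambda>a b. a \<bullet> (sample_cov n x *v b)"
    have S: "?S a b = a \<bullet> b + ?\<rho> * v * (\<theta> \<bullet> a) * (\<theta> \<bullet> b) + (a \<bullet> (H x *v b)) / sqrt (real n)" for a b
      using sn unfolding H_def scaled_error_mult_vec matrix_vector_mult_diff_rdistrib spiked_cov_mult_vec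
      by (simp add: inner_diff_right inner_add_right inner_commute)
    have k: "?\<rho> * v / (2 * (1 + ?\<rho> * v)) = ?\<rho> * c / 2" by (simp add: c_def)
    let ?q = "?S \<theta> ?t" and ?p = "?S ?t ?t"
    let ?Z = "2 * (?t \<bullet> ?m) * (\<theta> \<bullet> ?m) + ?\<nu> * (?t \<bullet> ?m)\<^sup>2"
    have "(\<Sum>i\<in>{1..n}. ((\<theta> + ?\<nu> *\<^sub>R ?t) \<bullet> x i)\<^sup>2 - (\<theta> \<bullet> x i)\<^sup>2) =
        real n * ?\<nu> * (2 * ?S ?t \<theta> + ?\<nu> * ?S ?t ?t + ?Z)"
      unfolding sum_subtractf sum_squares_sample_cov[OF n]
      by (simp add: inner_add_left matrix_vector_right_distrib inner_add_right matrix_vector_mult_scaleR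
          sample_cov_sym[of \<theta> n x ?t] power2_eq_square algebra_simps)
    moreover have "2 * ?S ?t \<theta> + ?\<nu> * ?S ?t ?t =
        ?\<rho> * v * ?\<nu> * (- ?N\<^sup>2 + ?\<nu>\<^sup>2 * ?N ^ 4 / 4)
        + (2 * (?t \<bullet> (H x *v \<theta>)) + ?\<nu> * (?t \<bullet> (H x *v ?t))) / sqrt (real n)"
    proof -
      have "?t \<bullet> ?t = ?N\<^sup>2" by (simp add: power2_norm_eq_inner)
      then show ?thesis
        unfolding S \<theta>\<theta> inner_commute[of ?t \<theta>] up(1)
        by (simp add: add_divide_distrib power2_eq_square power4_eq_xxxx algebra_simps)
    qed
    ultimately have L: "log_lik_ratio \<theta> r v \<nu> \<tau> n x = ?\<rho> * c / 2 * (real n * ?\<nu> *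
        (?\<rho> * v * ?\<nu> * (- ?N\<^sup>2 + ?\<nu>\<^sup>2 * ?N ^ 4 / 4)
        + (2 * (?t \<bullet> (H x *v \<theta>)) + ?\<nu> * (?t \<bullet> (H x *v ?t))) / sqrt (real n) + ?Z))"
      unfolding elim k by simp
    have "log_lik_ratio \<theta> r v \<nu> \<tau> n x -
      (\<kappa>\<^sup>2 * v * c / 2 * (- ?N\<^sup>2 + ?\<nu>\<^sup>2 * ?N ^ 4 / 4)
       + \<kappa> * c / 2 * (2 * (?t \<bullet> (H x *v \<theta>)) + ?\<nu> * (?t \<bullet> (H x *v ?t)))) = \<kappa> * c / 2 * sqrt (real n) * ?Z"
    proof -
      have alg: "\<rho> * c / 2 * (s * s * \<nu> * (\<rho> * v * \<nu> * A + B / s + Z)) -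
          ((s * \<rho> * \<nu>)\<^sup>2 * v * c / 2 * A + s * \<rho> * \<nu> * c / 2 * B) = s * \<rho> * \<nu> * c / 2 * s * Z"
        if "s > 0" for s \<rho> \<nu> A B Z :: real
      proof -
        define b where "b = B / s"
        have B: "B = s * b" using that by (simp add: b_def)
        show ?thesis unfolding B using that by (simp add: power2_eq_square) (simp add: algebra_simps)
      qed
      show ?thesis unfolding L \<kappa>_def using alg[OF sn(1)] unfolding sn(2) .
    qed
    moreover have "\<bar>\<kappa> * c / 2 * sqrt (real n) * ?Z\<bar> \<le> 2 * v * \<kappa> * ?N / sqrt (real n) * fluct \<theta> ?\<rho> v n x"
    proof -
      have tm: "\<bar>?t \<bullet> ?m\<bar> \<le> ?N * norm ?m" and \<theta>m: "\<bar>\<theta> \<bullet> ?m\<bar> \<le> norm ?m"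
        using Cauchy_Schwarz_ineq2[of ?t ?m] Cauchy_Schwarz_ineq2[of \<theta> ?m] \<theta> by auto
      have "\<bar>?Z\<bar> \<le> 2 * \<bar>?t \<bullet> ?m\<bar> * \<bar>\<theta> \<bullet> ?m\<bar> + ?\<nu> * (\<bar>?t \<bullet> ?m\<bar> * \<bar>?t \<bullet> ?m\<bar>)"
        using \<nu> by (intro order_trans[OF abs_triangle_ineq]) (simp add: abs_mult power2_eq_square)
      also have "\<dots> \<le> 2 * (?N * norm ?m) * norm ?m + ?\<nu> * ((?N * norm ?m) * (?N * norm ?m))"
        using tm \<theta>m \<nu> by (intro add_mono mult_mono) auto
      also have "\<dots> = (2 + ?\<nu> * ?N) * ?N * (norm ?m)\<^sup>2" by (simp add: power2_eq_square algebra_simps)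
      also have "\<dots> \<le> 4 * ?N * (norm ?m)\<^sup>2" using up(2) by (intro mult_right_mono) auto
      finally have Z: "\<bar>?Z\<bar> \<le> 4 * ?N * (norm ?m)\<^sup>2" .
      have "\<bar>\<kappa> * c / 2 * sqrt (real n) * ?Z\<bar> = \<kappa> * c / 2 * sqrt (real n) * \<bar>?Z\<bar>"
        using \<kappa>0 c0 by (simp add: abs_mult)
      also have "\<dots> \<le> \<kappa> * v / 2 * sqrt (real n) * (4 * ?N * (norm ?m)\<^sup>2)"
        using \<kappa>0 c0 v Z by (intro mult_mono divide_right_mono) auto
      also have "\<dots> = 2 * v * \<kappa> * ?N / sqrt (real n) * (real n * (norm ?m)\<^sup>2)"
      proof -
        have alg: "\<kappa> * v / 2 * s * (4 * N * q) = 2 * v * \<kappa> * N / s * (s * s * q)" if "s > 0" for s N q :: real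
          using that by simp
        show ?thesis using alg[OF sn(1)] unfolding sn(2) .
      qed
      also have "\<dots> \<le> 2 * v * \<kappa> * ?N / sqrt (real n) * fluct \<theta> ?\<rho> v n x"
        using v \<kappa>0 by (intro mult_left_mono fluct_mean_le) auto
      finally show ?thesis .
    qed
    ultimately show ?case by (simp only:)
  qed
qed

lemma perp_mult_vec: "(mat 1 - outer \<theta> \<theta>) *v (y :: real ^ 'p) = y - (\<theta> \<bullet> y) *\<^sub>R \<theta>"
  by (simp add: matrix_vector_mult_diff_rdistrib outer_mult_vec)

lemma perp_linear: "linear (\<lambda>u. (mat 1 - outer \<theta> \<theta>) *v u)"
  by (rule matrix_vector_mul_linear)

lemma admissible_bound:
  assumes "admissible \<theta> \<nu> \<tau>"
  obtains T where "T > 0" "\<And>n. n \<ge> 1 \<Longrightarrow> norm (\<tau> n) \<le> T" "\<And>n. n \<ge> 1 \<Longrightarrow> norm (\<theta> + \<nu> n *\<^sub>R \<tau> n) = 1"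
proof -
  have "\<exists>T>0. \<forall>x\<in>\<tau> ` {1..}. norm x \<le> T"
    using assms by (simp add: admissible_def bounded_pos)
  with that assms show ?thesis by (auto simp: admissible_def)
qed

lemma quartic_bound:
  assumes "0 \<le> \<nu>" "\<nu> * N \<le> 2" "0 \<le> N" "N \<le> (T::real)"
  shows "\<bar>- N\<^sup>2 + \<nu>\<^sup>2 * N ^ 4 / 4\<bar> \<le> T\<^sup>2"
proof -
  have "(\<nu> * N)\<^sup>2 \<le> 2\<^sup>2" using assms by (intro power_mono) auto
  then have "(\<nu> * N)\<^sup>2 * N\<^sup>2 \<le> 4 * N\<^sup>2" by (intro mult_right_mono) auto
  then have "\<nu>\<^sup>2 * N ^ 4 / 4 \<le> N\<^sup>2" by (simp add: power2_eq_square power4_eq_xxxx ac_simps)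
  moreover have "0 \<le> \<nu>\<^sup>2 * N ^ 4 / 4" by simp
  moreover have "N\<^sup>2 \<le> T\<^sup>2" using assms by (intro power_mono) auto
  ultimately show ?thesis by linarith
qed

lemma inverse_sqrt_tendsto_0: "(\<lambda>n. 1 / sqrt (real n)) \<longlonglongrightarrow> 0"
  by (intro real_tendsto_divide_at_top[OF tendsto_const] filterlim_compose[OF sqrt_at_top filterlim_real_sequentially])

text \<open>The regimes with \<open>\<kappa> = 1\<close> and \<open>\<nu> \<rightarrow> 0\<close>. They differ only in the limit \<open>c\<close> of \<open>v / (1 + r\<^sub>n v)\<close>. With
  \<open>c\<close> in place of that sequence the quartic term cancels exactly: it is the contribution of \<open>(\<theta> \<bullet> \<tau>)\<^sup>2\<close> to the quadratic form of \<open>\<Gamma>\<close>.\<close>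

lemma lan_expansion:
  fixes \<theta> :: "real ^ 'p"
  assumes \<theta>: "norm \<theta> = 1" and v: "v > 0" and r: "\<forall>n\<ge>1. r n > 0" "bounded (r ` {1..})"
    and \<nu>: "\<And>n. n \<ge> 1 \<Longrightarrow> \<nu> n > 0" "\<And>n. n \<ge> 1 \<Longrightarrow> sqrt (real n) * r n * \<nu> n = 1" "\<nu> \<longlonglongrightarrow> 0"
    and c: "(\<lambda>n. v / (1 + r n * v)) \<longlonglongrightarrow> c"
    and \<tau>: "admissible \<theta> \<nu> \<tau>"
  shows "is_oP1 (\<lambda>n. sample_law n \<theta> (r n) v)
    (\<lambda>n x. log_lik_ratio \<theta> r v \<nu> \<tau> n x - (\<tau> n \<bullet> ((c * sqrt (real n)) *\<^sub>R
         ((mat 1 - outer \<theta> \<theta>) *v ((sample_cov n x - spiked_cov \<theta> (r n) v) *v \<theta>)))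
       - 1 / 2 * (\<tau> n \<bullet> (((v * c) *\<^sub>R (mat 1 - outer \<theta> \<theta>)) *v \<tau> n))))"
proof -
  obtain T where T: "T > 0" "\<And>n. n \<ge> 1 \<Longrightarrow> norm (\<tau> n) \<le> T" "\<And>n. n \<ge> 1 \<Longrightarrow> norm (\<theta> + \<nu> n *\<^sub>R \<tau> n) = 1"
    by (rule admissible_bound[OF \<tau>]) blast
  define C where "C n = v / (1 + r n * v)" for n
  let ?H = "\<lambda>n. scaled_error \<theta> (r n) v n"
  have eq: "\<tau> n \<bullet> ((c * sqrt (real n)) *\<^sub>R ((mat 1 - outer \<theta> \<theta>) *v ((sample_cov n x - spiked_cov \<theta> (r n) v) *v \<theta>)))
       - 1 / 2 * (\<tau> n \<bullet> (((v * c) *\<^sub>R (mat 1 - outer \<theta> \<theta>)) *v \<tau> n)) =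
     c * (\<tau> n \<bullet> (?H n x *v \<theta>) - (\<theta> \<bullet> \<tau> n) * (\<theta> \<bullet> (?H n x *v \<theta>)))
       - v * c / 2 * ((norm (\<tau> n))\<^sup>2 - (\<theta> \<bullet> \<tau> n)\<^sup>2)" for n x
    unfolding scaled_error_mult_vec scaleR_matrix_mult_vec perp_mult_vec power2_norm_eq_inner
    by (simp add: inner_diff_right power2_eq_square inner_commute algebra_simps)
  let ?a = "\<lambda>n. (v * T\<^sup>2 + T) * \<bar>C n - c\<bar> + (\<bar>c\<bar> + v) * T\<^sup>2 / 2 * \<nu> n + 2 * v * T * (1 / sqrt (real n))"
  show ?thesis
    unfolding eq
  proof (rule sample_law_is_oP1[OF \<theta> v r, where a = ?a])
    show "(\<lambda>x. log_lik_ratio \<theta> r v \<nu> \<tau> n x - (c * (\<tau> n \<bullet> (?H n x *v \<theta>) - (\<theta> \<bullet> \<tau> n) * (\<theta> \<bullet> (?H n x *v \<theta>)))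
       - v * c / 2 * ((norm (\<tau> n))\<^sup>2 - (\<theta> \<bullet> \<tau> n)\<^sup>2))) \<in> borel_measurable (sample_law n \<theta> (r n) v)" for n
      by measurable
    have "?a \<longlonglongrightarrow> (v * T\<^sup>2 + T) * \<bar>c - c\<bar> + (\<bar>c\<bar> + v) * T\<^sup>2 / 2 * 0 + 2 * v * T * 0"
      using c \<nu>(3) inverse_sqrt_tendsto_0 unfolding C_def by (intro tendsto_intros)
    then show "?a \<longlonglongrightarrow> 0" by simp
    fix n :: nat assume n: "n \<ge> 1"
    let ?N = "norm (\<tau> n)"
    have rn: "r n > 0" using r n by simp
    have rv: "0 \<le> r n * v" using rn v by simp
    have C: "0 \<le> C n" "C n \<le> v" using rv v by (auto simp: C_def field_simps)
    note up = unit_perturbation[OF \<theta> T(3)[OF n] \<nu>(1)[OF n]]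
    note e = log_lik_ratio_expansion[where r = r and \<nu> = \<nu> and \<tau> = \<tau> and n = n, OF \<theta> v rn n \<nu>(1)[OF n] T(3)[OF n], folded C_def, unfolded \<nu>(2)[OF n]]
    show "AE x in sample_law n \<theta> (r n) v. \<bar>log_lik_ratio \<theta> r v \<nu> \<tau> n x - (c * (\<tau> n \<bullet> (?H n x *v \<theta>) - (\<theta> \<bullet> \<tau> n) * (\<theta> \<bullet> (?H n x *v \<theta>)))
       - v * c / 2 * (?N\<^sup>2 - (\<theta> \<bullet> \<tau> n)\<^sup>2))\<bar> \<le> ?a n * fluct \<theta> (r n) v n x"
      using e
    proof eventually_elim
      case (elim x)
      let ?F = "fluct \<theta> (r n) v n x" and ?L = "log_lik_ratio \<theta> r v \<nu> \<tau> n x"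
      let ?Q = "- ?N\<^sup>2 + (\<nu> n)\<^sup>2 * ?N ^ 4 / 4"
      let ?h1 = "\<tau> n \<bullet> (?H n x *v \<theta>)" and ?h2 = "\<tau> n \<bullet> (?H n x *v \<tau> n)" and ?h0 = "\<theta> \<bullet> (?H n x *v \<theta>)"
      have F: "1 \<le> ?F" by (rule fluct_ge_1)
      have N: "?N \<le> T" using T(2)[OF n] .
      have h1: "\<bar>?h1\<bar> \<le> T * ?F"
        using fluct_bilinear_le[OF N, of \<theta> 1 \<theta> "r n" v n x] \<theta> by simp
      have h2: "\<bar>?h2\<bar> \<le> T\<^sup>2 * ?F"
        unfolding power2_eq_square by (rule fluct_bilinear_le[OF N N])
      have h0: "\<bar>?h0\<bar> \<le> ?F"
        using fluct_bilinear_le[of \<theta> 1 \<theta> 1 \<theta> "r n" v n x] \<theta> by simp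
      have Q: "\<bar>?Q\<bar> \<le> T\<^sup>2 * ?F"
      proof -
        have "\<bar>?Q\<bar> \<le> T\<^sup>2" using up(2) \<nu>(1)[OF n] N by (intro quartic_bound) auto
        also have "\<dots> \<le> T\<^sup>2 * ?F" using mult_left_mono[OF F zero_le_power2[of T]] by simp
        finally show ?thesis .
      qed
      have tt: "\<bar>\<theta> \<bullet> \<tau> n\<bar> \<le> \<nu> n * T\<^sup>2 / 2"
      proof -
        have "?N\<^sup>2 \<le> T\<^sup>2" using N by (intro power_mono) auto
        then show ?thesis unfolding up(1) using \<nu>(1)[OF n] by (simp add: abs_mult)
      qed
      have D: "?L - (c * (?h1 - (\<theta> \<bullet> \<tau> n) * ?h0) - v * c / 2 * (?N\<^sup>2 - (\<theta> \<bullet> \<tau> n)\<^sup>2)) =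
          (?L - (1\<^sup>2 * v * C n / 2 * ?Q + 1 * C n / 2 * (2 * ?h1 + \<nu> n * ?h2)))
          + v / 2 * (C n - c) * ?Q + (C n - c) * ?h1 + C n * \<nu> n / 2 * ?h2 + c * (\<theta> \<bullet> \<tau> n) * ?h0"
      proof -
        have "(\<theta> \<bullet> \<tau> n)\<^sup>2 = (\<nu> n)\<^sup>2 * ?N ^ 4 / 4"
          unfolding up(1) by (simp add: power2_eq_square power4_eq_xxxx)
        then show ?thesis by (simp add: field_simps)
      qed
      have b1: "\<bar>v / 2 * (C n - c) * ?Q\<bar> \<le> v * \<bar>C n - c\<bar> * (T\<^sup>2 * ?F)"
        using Q v unfolding abs_mult by (intro mult_mono) auto
      have b2: "\<bar>(C n - c) * ?h1\<bar> \<le> \<bar>C n - c\<bar> * (T * ?F)"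
        using h1 unfolding abs_mult by (intro mult_mono) auto
      have b3: "\<bar>C n * \<nu> n / 2 * ?h2\<bar> \<le> v * \<nu> n / 2 * (T\<^sup>2 * ?F)"
        using h2 C \<nu>(1)[OF n] unfolding abs_mult[of "C n * \<nu> n / 2"]
        by (intro mult_mono) (auto simp: abs_mult intro!: mult_right_mono divide_right_mono)
      have b4: "\<bar>c * (\<theta> \<bullet> \<tau> n) * ?h0\<bar> \<le> \<bar>c\<bar> * (\<nu> n * T\<^sup>2 / 2) * ?F"
        using tt h0 F \<nu>(1)[OF n] unfolding abs_mult by (intro mult_mono) auto
      have b5: "2 * v * 1 * ?N / sqrt (real n) * ?F \<le> 2 * v * 1 * T / sqrt (real n) * ?F"
        using N v F by (intro mult_right_mono divide_right_mono mult_left_mono) auto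
      have "\<bar>?L - (c * (?h1 - (\<theta> \<bullet> \<tau> n) * ?h0) - v * c / 2 * (?N\<^sup>2 - (\<theta> \<bullet> \<tau> n)\<^sup>2))\<bar> \<le>
          2 * v * 1 * T / sqrt (real n) * ?F + v * \<bar>C n - c\<bar> * (T\<^sup>2 * ?F) + \<bar>C n - c\<bar> * (T * ?F)
          + v * \<nu> n / 2 * (T\<^sup>2 * ?F) + \<bar>c\<bar> * (\<nu> n * T\<^sup>2 / 2) * ?F"
      proof -
        have "\<bar>e + p + q + s + t\<bar> \<le> E + P + Q + S + U"
          if "\<bar>e\<bar> \<le> E" "\<bar>p\<bar> \<le> P" "\<bar>q\<bar> \<le> Q" "\<bar>s\<bar> \<le> S" "\<bar>t\<bar> \<le> U" for e p q s t E P Q S U :: real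
          using that by linarith
        from this[OF order_trans[OF elim b5] b1 b2 b3 b4] show ?thesis unfolding D .
      qed
      also have "\<dots> = ?a n * ?F"
        by (simp add: field_simps)
      finally show ?case .
    qed
  qed
qed

text \<open>Here \<open>\<kappa> = 1\<close> and \<open>\<nu> = 1\<close>, so neither the quartic term nor \<open>\<tau> \<bullet> H \<tau>\<close> is negligible; the only
  approximation beyond the common one is \<open>v / (1 + r\<^sub>n v) \<rightarrow> v\<close>.\<close>

lemma moderate_expansion:
  fixes \<theta> :: "real ^ 'p"
  assumes \<theta>: "norm \<theta> = 1" and v: "v > 0" and r: "\<forall>n\<ge>1. r n = 1 / sqrt (real n)"
    and \<tau>: "admissible \<theta> (\<lambda>n. 1) \<tau>"
  shows "is_oP1 (\<lambda>n. sample_law n \<theta> (r n) v)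
    (\<lambda>n x. log_lik_ratio \<theta> r v (\<lambda>n. 1) \<tau> n x - (\<tau> n \<bullet> ((v * sqrt (real n)) *\<^sub>R
         ((sample_cov n x - spiked_cov \<theta> (r n) v) *v (\<theta> + (1 / 2) *\<^sub>R \<tau> n)))
       - v\<^sup>2 / 2 * norm (\<tau> n) ^ 2 + v\<^sup>2 / 8 * norm (\<tau> n) ^ 4))"
proof -
  obtain T where T: "T > 0" "\<And>n. n \<ge> 1 \<Longrightarrow> norm (\<tau> n) \<le> T" "\<And>n. n \<ge> 1 \<Longrightarrow> norm (\<theta> + 1 *\<^sub>R \<tau> n) = 1"
    by (rule admissible_bound[OF \<tau>]) blast
  have r': "\<forall>n\<ge>1. r n > 0" using r by simp
  have rb: "bounded (r ` {1..})"
    using r by (auto simp: bounded_iff intro!: exI[of _ 1])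
  have r0: "r \<longlonglongrightarrow> 0"
    by (rule Lim_transform_eventually[OF inverse_sqrt_tendsto_0]) (use r in \<open>auto simp: eventually_sequentially intro!: exI[of _ 1]\<close>)
  define C where "C n = v / (1 + r n * v)" for n
  have C: "C \<longlonglongrightarrow> v" unfolding C_def[abs_def] by (auto intro!: tendsto_eq_intros r0)
  let ?H = "\<lambda>n. scaled_error \<theta> (r n) v n"
  have eq: "\<tau> n \<bullet> ((v * sqrt (real n)) *\<^sub>R ((sample_cov n x - spiked_cov \<theta> (r n) v) *v (\<theta> + (1 / 2) *\<^sub>R \<tau> n)))
       - v\<^sup>2 / 2 * norm (\<tau> n) ^ 2 + v\<^sup>2 / 8 * norm (\<tau> n) ^ 4 =
     v * (\<tau> n \<bullet> (?H n x *v \<theta>) + \<tau> n \<bullet> (?H n x *v \<tau> n) / 2)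
       + v\<^sup>2 / 2 * (- (norm (\<tau> n))\<^sup>2 + 1\<^sup>2 * norm (\<tau> n) ^ 4 / 4)" for n x
    unfolding scaled_error_mult_vec
    by (simp add: matrix_vector_right_distrib matrix_vector_mult_scaleR inner_add_right field_simps)
  let ?a = "\<lambda>n. (v * T\<^sup>2 + T + T\<^sup>2) * \<bar>C n - v\<bar> + 2 * v * T * (1 / sqrt (real n))"
  show ?thesis
    unfolding eq
  proof (rule sample_law_is_oP1[OF \<theta> v r' rb, where a = ?a])
    show "(\<lambda>x. log_lik_ratio \<theta> r v (\<lambda>n. 1) \<tau> n x - (v * (\<tau> n \<bullet> (?H n x *v \<theta>) + \<tau> n \<bullet> (?H n x *v \<tau> n) / 2)
       + v\<^sup>2 / 2 * (- (norm (\<tau> n))\<^sup>2 + 1\<^sup>2 * norm (\<tau> n) ^ 4 / 4))) \<in> borel_measurable (sample_law n \<theta> (r n) v)" for n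
      by measurable
    have "?a \<longlonglongrightarrow> (v * T\<^sup>2 + T + T\<^sup>2) * \<bar>v - v\<bar> + 2 * v * T * 0"
      using C inverse_sqrt_tendsto_0 by (intro tendsto_intros)
    then show "?a \<longlonglongrightarrow> 0" by simp
    fix n :: nat assume n: "n \<ge> 1"
    let ?N = "norm (\<tau> n)"
    have rn: "r n > 0" using r n by simp
    have \<kappa>: "sqrt (real n) * r n * 1 = 1" using r n by simp
    note up = unit_perturbation[OF \<theta> T(3)[OF n] zero_less_one]
    note e = log_lik_ratio_expansion[where r = r and \<nu> = "\<lambda>_. 1" and \<tau> = \<tau> and n = n, OF \<theta> v rn n zero_less_one T(3)[OF n], folded C_def, unfolded \<kappa>]
    show "AE x in sample_law n \<theta> (r n) v. \<bar>log_lik_ratio \<theta> r v (\<lambda>n. 1) \<tau> n x - (v * (\<tau> n \<bullet> (?H n x *v \<theta>) + \<tau> n \<bullet> (?H n x *v \<tau> n) / 2)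
       + v\<^sup>2 / 2 * (- ?N\<^sup>2 + 1\<^sup>2 * ?N ^ 4 / 4))\<bar> \<le> ?a n * fluct \<theta> (r n) v n x"
      using e
    proof eventually_elim
      case (elim x)
      let ?F = "fluct \<theta> (r n) v n x" and ?L = "log_lik_ratio \<theta> r v (\<lambda>n. 1) \<tau> n x"
      let ?Q = "- ?N\<^sup>2 + 1\<^sup>2 * ?N ^ 4 / 4"
      let ?h1 = "\<tau> n \<bullet> (?H n x *v \<theta>)" and ?h2 = "\<tau> n \<bullet> (?H n x *v \<tau> n)"
      have F: "1 \<le> ?F" by (rule fluct_ge_1)
      have N: "?N \<le> T" using T(2)[OF n] .
      have h1: "\<bar>?h1\<bar> \<le> T * ?F"
        using fluct_bilinear_le[OF N, of \<theta> 1 \<theta> "r n" v n x] \<theta> by simp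
      have h2: "\<bar>?h2\<bar> \<le> T\<^sup>2 * ?F"
        unfolding power2_eq_square by (rule fluct_bilinear_le[OF N N])
      have Q: "\<bar>?Q\<bar> \<le> T\<^sup>2 * ?F"
      proof -
        have "\<bar>?Q\<bar> \<le> T\<^sup>2" using up(2) N by (intro quartic_bound) auto
        also have "\<dots> \<le> T\<^sup>2 * ?F" using mult_left_mono[OF F zero_le_power2[of T]] by simp
        finally show ?thesis .
      qed
      have D: "?L - (v * (?h1 + ?h2 / 2) + v\<^sup>2 / 2 * ?Q) =
          (?L - (1\<^sup>2 * v * C n / 2 * ?Q + 1 * C n / 2 * (2 * ?h1 + 1 * ?h2)))
          + v / 2 * (C n - v) * ?Q + (C n - v) * ?h1 + (C n - v) / 2 * ?h2"
        by (simp add: field_simps power2_eq_square)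
      have b1: "\<bar>v / 2 * (C n - v) * ?Q\<bar> \<le> v * \<bar>C n - v\<bar> * (T\<^sup>2 * ?F)"
        using Q v unfolding abs_mult by (intro mult_mono) auto
      have b2: "\<bar>(C n - v) * ?h1\<bar> \<le> \<bar>C n - v\<bar> * (T * ?F)"
        using h1 unfolding abs_mult by (intro mult_mono) auto
      have b3: "\<bar>(C n - v) / 2 * ?h2\<bar> \<le> \<bar>C n - v\<bar> * (T\<^sup>2 * ?F)"
        using h2 unfolding abs_mult by (intro mult_mono) auto
      have b5: "2 * v * 1 * ?N / sqrt (real n) * ?F \<le> 2 * v * 1 * T / sqrt (real n) * ?F"
        using N v F by (intro mult_right_mono divide_right_mono mult_left_mono) auto
      have "\<bar>?L - (v * (?h1 + ?h2 / 2) + v\<^sup>2 / 2 * ?Q)\<bar> \<le>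
          2 * v * 1 * T / sqrt (real n) * ?F + v * \<bar>C n - v\<bar> * (T\<^sup>2 * ?F) + \<bar>C n - v\<bar> * (T * ?F)
          + \<bar>C n - v\<bar> * (T\<^sup>2 * ?F)"
      proof -
        have "\<bar>e + p + q + s\<bar> \<le> E + P + Q + S"
          if "\<bar>e\<bar> \<le> E" "\<bar>p\<bar> \<le> P" "\<bar>q\<bar> \<le> Q" "\<bar>s\<bar> \<le> S" for e p q s E P Q S :: real
          using that by linarith
        from this[OF order_trans[OF elim b5] b1 b2 b3] show ?thesis unfolding D .
      qed
      also have "\<dots> = ?a n * ?F"
        unfolding distrib_right by (simp add: distrib_right)
      finally show ?case .
    qed
  qed
qed

text \<open>Every term carries a factor \<open>\<kappa> = \<surd>n r\<^sub>n\<close>, which tends to 0.\<close>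

lemma weak_expansion:
  fixes \<theta> :: "real ^ 'p"
  assumes \<theta>: "norm \<theta> = 1" and v: "v > 0" and r: "\<forall>n\<ge>1. r n > 0" "bounded (r ` {1..})"
    and r0: "(\<lambda>n. sqrt (real n) * r n) \<longlonglongrightarrow> 0"
    and \<tau>: "admissible \<theta> (\<lambda>n. 1) \<tau>"
  shows "is_oP1 (\<lambda>n. sample_law n \<theta> (r n) v) (log_lik_ratio \<theta> r v (\<lambda>n. 1) \<tau>)"
proof -
  obtain T where T: "T > 0" "\<And>n. n \<ge> 1 \<Longrightarrow> norm (\<tau> n) \<le> T" "\<And>n. n \<ge> 1 \<Longrightarrow> norm (\<theta> + 1 *\<^sub>R \<tau> n) = 1"
    by (rule admissible_bound[OF \<tau>]) blast
  let ?k = "\<lambda>n. sqrt (real n) * r n"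
  let ?H = "\<lambda>n. scaled_error \<theta> (r n) v n"
  let ?a = "\<lambda>n. (?k n)\<^sup>2 * (v\<^sup>2 * T\<^sup>2) + ?k n * (v * (T + T\<^sup>2)) + 2 * v * T * ?k n * (1 / sqrt (real n))"
  show ?thesis
  proof (rule sample_law_is_oP1[OF \<theta> v r, where a = ?a])
    show "log_lik_ratio \<theta> r v (\<lambda>n. 1) \<tau> n \<in> borel_measurable (sample_law n \<theta> (r n) v)" for n
      by measurable
    have "?a \<longlonglongrightarrow> 0\<^sup>2 * (v\<^sup>2 * T\<^sup>2) + 0 * (v * (T + T\<^sup>2)) + 2 * v * T * 0 * 0"
      using r0 inverse_sqrt_tendsto_0 by (intro tendsto_intros)
    then show "?a \<longlonglongrightarrow> 0" by simp
    fix n :: nat assume n: "n \<ge> 1"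
    let ?N = "norm (\<tau> n)"
    have rn: "r n > 0" using r n by simp
    have k: "0 \<le> ?k n" using rn by simp
    define C where "C = v / (1 + r n * v)"
    have rv: "0 \<le> r n * v" using rn v by simp
    have C: "0 \<le> C" "C \<le> v" using rv v by (auto simp: C_def field_simps)
    note up = unit_perturbation[OF \<theta> T(3)[OF n] zero_less_one]
    note e = log_lik_ratio_expansion[where r = r and \<nu> = "\<lambda>_. 1" and \<tau> = \<tau> and n = n, OF \<theta> v rn n zero_less_one T(3)[OF n], folded C_def]
    show "AE x in sample_law n \<theta> (r n) v. \<bar>log_lik_ratio \<theta> r v (\<lambda>n. 1) \<tau> n x\<bar> \<le> ?a n * fluct \<theta> (r n) v n x"
      using e
    proof eventually_elim
      case (elim x)
      let ?F = "fluct \<theta> (r n) v n x" and ?L = "log_lik_ratio \<theta> r v (\<lambda>n. 1) \<tau> n x"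
      let ?Q = "- ?N\<^sup>2 + 1\<^sup>2 * ?N ^ 4 / 4"
      let ?h1 = "\<tau> n \<bullet> (?H n x *v \<theta>)" and ?h2 = "\<tau> n \<bullet> (?H n x *v \<tau> n)"
      have F: "1 \<le> ?F" by (rule fluct_ge_1)
      have N: "?N \<le> T" using T(2)[OF n] .
      have h1: "\<bar>?h1\<bar> \<le> T * ?F"
        using fluct_bilinear_le[OF N, of \<theta> 1 \<theta> "r n" v n x] \<theta> by simp
      have h2: "\<bar>?h2\<bar> \<le> T\<^sup>2 * ?F"
        unfolding power2_eq_square by (rule fluct_bilinear_le[OF N N])
      have Q: "\<bar>?Q\<bar> \<le> T\<^sup>2 * ?F"
      proof -
        have "\<bar>?Q\<bar> \<le> T\<^sup>2" using up(2) N by (intro quartic_bound) auto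
        also have "\<dots> \<le> T\<^sup>2 * ?F" using mult_left_mono[OF F zero_le_power2[of T]] by simp
        finally show ?thesis .
      qed
      have h: "\<bar>2 * ?h1 + 1 * ?h2\<bar> \<le> 2 * ((T + T\<^sup>2) * ?F)"
      proof -
        have "\<bar>2 * p + 1 * q\<bar> \<le> 2 * (A + B)" if "\<bar>p\<bar> \<le> A" "\<bar>q\<bar> \<le> B" for p q A B :: real
          using that by (auto simp: abs_le_iff)
        from this[OF h1 h2] show ?thesis by (simp only: distrib_right)
      qed
      have b1: "\<bar>(?k n * 1)\<^sup>2 * v * C / 2 * ?Q\<bar> \<le> (?k n)\<^sup>2 * v * v * (T\<^sup>2 * ?F)"
      proof -
        have "\<bar>(?k n * 1)\<^sup>2 * v * C / 2\<bar> \<le> (?k n)\<^sup>2 * v * v"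
        proof -
          have "\<bar>(?k n * 1)\<^sup>2 * v * C / 2\<bar> = (?k n)\<^sup>2 * v * (C / 2)" using v C by (simp add: abs_mult)
          also have "\<dots> \<le> (?k n)\<^sup>2 * v * v" using v C by (intro mult_left_mono) auto
          finally show ?thesis .
        qed
        then show ?thesis using Q v unfolding abs_mult[of _ ?Q] by (intro mult_mono) auto
      qed
      have b2: "\<bar>?k n * 1 * C / 2 * (2 * ?h1 + 1 * ?h2)\<bar> \<le> ?k n * v * ((T + T\<^sup>2) * ?F)"
      proof -
        have "\<bar>?k n * 1 * C / 2 * (2 * ?h1 + 1 * ?h2)\<bar> = ?k n * C / 2 * \<bar>2 * ?h1 + 1 * ?h2\<bar>"
          using k C rn by (simp add: abs_mult)
        also have "\<dots> \<le> ?k n * v / 2 * (2 * ((T + T\<^sup>2) * ?F))"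
          using h k C v by (intro mult_mono divide_right_mono mult_left_mono) auto
        finally show ?thesis by simp
      qed
      have b5: "2 * v * (?k n * 1) * ?N / sqrt (real n) * ?F \<le> 2 * v * ?k n * T / sqrt (real n) * ?F"
        unfolding mult_1_right using N v F k
        by (intro mult_right_mono divide_right_mono mult_left_mono) auto
      have "\<bar>?L\<bar> \<le> 2 * v * ?k n * T / sqrt (real n) * ?F + (?k n)\<^sup>2 * v * v * (T\<^sup>2 * ?F) + ?k n * v * ((T + T\<^sup>2) * ?F)"
      proof -
        have "\<bar>l\<bar> \<le> E + A + B" if "\<bar>l - (p + q)\<bar> \<le> e" "e \<le> E" "\<bar>p\<bar> \<le> A" "\<bar>q\<bar> \<le> B"
          for l p q e E A B :: real using that by linarith
        from this[OF elim b5 b1 b2] show ?thesis .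
      qed
      also have "\<dots> = ?a n * ?F" by (simp add: power2_eq_square field_simps)
      finally show ?case .
    qed
  qed
qed

section \<open>Normal scale mixtures and their limits\<close>

text \<open>Convergence in mean implies convergence in distribution, quantitatively: if \<open>\<phi>\<close> varies by at most
  \<open>e/2\<close> within distance \<open>d\<close> of \<open>a\<close>, then \<open>|\<phi> t - \<phi> a| \<le> e/2 + (2 B / d) |t - a|\<close> everywhere.\<close>

lemma tendsto_integral_of_L1:
  fixes \<phi> :: "real \<Rightarrow> 'c::{banach, second_countable_topology}"
  assumes M: "\<And>n. prob_space (M n)" and A [measurable]: "\<And>n. A n \<in> borel_measurable (M n)"
    and int: "\<And>n. n \<ge> 1 \<Longrightarrow> integrable (M n) (\<lambda>x. \<bar>A n x - a\<bar>)"
    and L1: "(\<lambda>n. \<integral>x. \<bar>A n x - a\<bar> \<partial>M n) \<longlonglongrightarrow> 0"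
    and \<phi>: "isCont \<phi> a" "\<And>t. norm (\<phi> t) \<le> B" and [measurable]: "\<phi> \<in> borel_measurable borel"
  shows "(\<lambda>n. \<integral>x. \<phi> (A n x) \<partial>M n) \<longlonglongrightarrow> \<phi> a"
proof (rule LIMSEQ_I)
  fix e :: real assume e: "e > 0"
  have B: "0 \<le> B" using \<phi>(2) norm_ge_zero order_trans by blast
  obtain d where d: "d > 0" "\<And>t. \<bar>t - a\<bar> < d \<Longrightarrow> norm (\<phi> t - \<phi> a) < e / 2"
    using \<phi>(1) e unfolding isCont_def LIM_eq
    by (metis abs_zero diff_self half_gt_zero norm_zero real_norm_def)
  let ?K = "2 * B / d"
  have K: "0 \<le> ?K" using B d by simp
  have pt: "norm (\<phi> t - \<phi> a) \<le> e / 2 + ?K * \<bar>t - a\<bar>" for t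
  proof (cases "\<bar>t - a\<bar> < d")
    case True
    have "0 \<le> ?K * \<bar>t - a\<bar>" by (rule mult_nonneg_nonneg[OF K abs_ge_zero])
    then show ?thesis using d(2)[OF True] by linarith
  next
    case False
    have "norm (\<phi> t - \<phi> a) \<le> B + B" using \<phi>(2) by (intro order_trans[OF norm_triangle_ineq4] add_mono)
    also have "\<dots> = ?K * d" using d by simp
    also have "\<dots> \<le> ?K * \<bar>t - a\<bar>" using False K by (intro mult_left_mono) auto
    finally show ?thesis using e by linarith
  qed
  have bound: "norm ((\<integral>x. \<phi> (A n x) \<partial>M n) - \<phi> a) \<le> e / 2 + ?K * (\<integral>x. \<bar>A n x - a\<bar> \<partial>M n)" if n: "n \<ge> 1" for n
  proof -
    interpret prob_space "M n" by (rule M)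
    have i: "integrable (M n) (\<lambda>x. \<phi> (A n x))"
      using \<phi>(2) by (intro integrable_const_bound[of _ B]) auto
    have "(\<integral>x. \<phi> (A n x) \<partial>M n) - \<phi> a = (\<integral>x. \<phi> (A n x) - \<phi> a \<partial>M n)"
      using i by (simp add: prob_space)
    also have "norm \<dots> \<le> (\<integral>x. norm (\<phi> (A n x) - \<phi> a) \<partial>M n)"
      by (rule integral_norm_bound)
    also have "\<dots> \<le> (\<integral>x. e / 2 + ?K * \<bar>A n x - a\<bar> \<partial>M n)"
      by (intro integral_mono pt integrable_norm Bochner_Integration.integrable_diff
          Bochner_Integration.integrable_add integrable_mult_right integrable_const i int[OF n])
    also have "\<dots> = e / 2 + ?K * (\<integral>x. \<bar>A n x - a\<bar> \<partial>M n)"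
      using int[OF n] by (simp add: prob_space)
    finally show ?thesis .
  qed
  have "(\<lambda>n. ?K * (\<integral>x. \<bar>A n x - a\<bar> \<partial>M n)) \<longlonglongrightarrow> ?K * 0" by (intro tendsto_intros L1)
  then have "\<forall>\<^sub>F n in sequentially. ?K * (\<integral>x. \<bar>A n x - a\<bar> \<partial>M n) < e / 2"
    using e by (intro order_tendstoD(2)) auto
  then obtain N where N: "\<And>n. n \<ge> N \<Longrightarrow> ?K * (\<integral>x. \<bar>A n x - a\<bar> \<partial>M n) < e / 2"
    by (auto simp: eventually_sequentially)
  show "\<exists>no. \<forall>n\<ge>no. norm ((\<integral>x. \<phi> (A n x) \<partial>M n) - \<phi> a) < e"
  proof (intro exI[of _ "max N 1"] allI impI)
    fix n assume "n \<ge> max N 1"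
    then show "norm ((\<integral>x. \<phi> (A n x) \<partial>M n) - \<phi> a) < e"
      using bound[of n] N[of n] by simp
  qed
qed

text \<open>For each fixed \<open>y\<close> the scale is the only random quantity, so \<open>tendsto_integral_of_L1\<close> applies pointwise
  in \<open>y\<close>; dominated convergence then integrates over \<open>y\<close>.\<close>

lemma scale_mixture_limit:
  fixes f :: "'b::euclidean_space \<Rightarrow> 'c::{banach, second_countable_topology}"
  assumes M: "\<And>n. prob_space (M n)" and A [measurable]: "\<And>n. A n \<in> borel_measurable (M n)"
    and int: "\<And>n. n \<ge> 1 \<Longrightarrow> integrable (M n) (\<lambda>x. \<bar>A n x - a\<bar>)"
    and L1: "(\<lambda>n. \<integral>x. \<bar>A n x - a\<bar> \<partial>M n) \<longlonglongrightarrow> 0"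
    and f: "continuous_on UNIV f" "\<And>y. norm (f y) \<le> B"
  shows "(\<lambda>n. \<integral>p. f (A n (fst p) *\<^sub>R snd p) \<partial>(M n \<Otimes>\<^sub>M gauss)) \<longlonglongrightarrow> (\<integral>y. f (a *\<^sub>R y) \<partial>gauss)"
proof -
  have [measurable]: "f \<in> borel_measurable borel" by (rule borel_measurable_continuous_onI[OF f(1)])
  have fub: "(\<integral>p. f (A n (fst p) *\<^sub>R snd p) \<partial>(M n \<Otimes>\<^sub>M gauss)) =
      (\<integral>y. (\<integral>x. f (A n x *\<^sub>R y) \<partial>M n) \<partial>gauss)" for n
  proof -
    interpret Mn: prob_space "M n" by (rule M)
    interpret P: pair_prob_space "M n" "gauss :: 'b measure" ..
    have "integrable (M n \<Otimes>\<^sub>M gauss) (\<lambda>p. f (A n (fst p) *\<^sub>R snd p))"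
      using f(2) by (intro P.integrable_const_bound[of _ B]) auto
    then have "integrable (M n \<Otimes>\<^sub>M gauss) (\<lambda>(x, y). f (A n x *\<^sub>R y))" by (simp add: split_beta')
    from P.integral_snd[OF this] show ?thesis by (simp add: split_beta')
  qed
  show ?thesis
    unfolding fub
  proof (rule integral_dominated_convergence[where w = "\<lambda>_. B"])
    have ptw: "norm (\<integral>x. f (A n x *\<^sub>R y) \<partial>M n) \<le> B" for n y
    proof -
      interpret prob_space "M n" by (rule M)
      have i: "integrable (M n) (\<lambda>x. f (A n x *\<^sub>R y))"
        using f(2) by (intro integrable_const_bound[of _ B]) auto
      have "norm (\<integral>x. f (A n x *\<^sub>R y) \<partial>M n) \<le> (\<integral>x. norm (f (A n x *\<^sub>R y)) \<partial>M n)"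
        by (rule integral_norm_bound)
      also have "\<dots> \<le> (\<integral>x. B \<partial>M n)"
        by (intro integral_mono f(2) integrable_norm integrable_const i)
      finally show ?thesis by (simp add: prob_space)
    qed
    show "AE y in gauss. norm (\<integral>x. f (A n x *\<^sub>R y) \<partial>M n) \<le> B" for n using ptw by simp
    show "AE y in gauss. (\<lambda>n. \<integral>x. f (A n x *\<^sub>R y) \<partial>M n) \<longlonglongrightarrow> f (a *\<^sub>R y)"
    proof (rule AE_I2)
      fix y :: 'b
      have "continuous_on UNIV (\<lambda>t. f (t *\<^sub>R y))"
        by (intro continuous_on_compose2[OF f(1)] continuous_intros) auto
      then have "isCont (\<lambda>t. f (t *\<^sub>R y)) a"
        by (simp add: continuous_on_eq_continuous_at)
      from tendsto_integral_of_L1[where \<phi> = "\<lambda>t. f (t *\<^sub>R y)" and M = M and A = A and B = B, OF M A int L1 this]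
      show "(\<lambda>n. \<integral>x. f (A n x *\<^sub>R y) \<partial>M n) \<longlonglongrightarrow> f (a *\<^sub>R y)"
        using f(2) by auto
    qed
    show "(\<lambda>y. \<integral>x. f (A n x *\<^sub>R y) \<partial>M n) \<in> borel_measurable gauss" for n
    proof -
      interpret prob_space "M n" by (rule M)
      show ?thesis by measurable
    qed
  qed auto
qed

text \<open>The deviations from the mean are scaled by \<open>1/\<surd>n\<close> so that the sum of their squares is the sample
  variance.\<close>

definition weight :: "nat \<Rightarrow> (nat \<Rightarrow> real) \<Rightarrow> nat \<Rightarrow> real" where
  "weight n \<zeta> i = (\<zeta> i - (\<Sum>j\<in>{1..n}. \<zeta> j) / real n) / sqrt (real n)"

definition sample_var :: "nat \<Rightarrow> (nat \<Rightarrow> real) \<Rightarrow> real" where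
  "sample_var n \<zeta> = (\<Sum>i\<in>{1..n}. (weight n \<zeta> i)\<^sup>2)"

lemma weight_measurable [measurable]:
  "i \<in> {1..n} \<Longrightarrow> (\<lambda>\<zeta>. weight n \<zeta> i) \<in> borel_measurable (\<Pi>\<^sub>M i\<in>{1..n}. gauss)"
  unfolding weight_def by measurable

lemma sample_var_measurable [measurable]:
  "sample_var n \<in> borel_measurable (\<Pi>\<^sub>M i\<in>{1..n}. gauss)"
  unfolding sample_var_def[abs_def] by measurable

lemma sample_var_nonneg: "0 \<le> sample_var n \<zeta>"
  by (simp add: sample_var_def sum_nonneg)

text \<open>Writing \<open>F = \<Sum>\<^sub>i \<zeta>\<^sub>i / \<surd>n\<close> and \<open>G = \<Sum>\<^sub>i (\<zeta>\<^sub>i\<^sup>2 - 1) / \<surd>n\<close>, the error of the sample variance is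
  \<open>G / \<surd>n - F\<^sup>2 / n\<close>. Since \<open>|G| \<le> 1 + G\<^sup>2\<close>, the constant 10 is \<open>1 + 8 + 1\<close>, where 8 bounds the second
  moment of \<open>G\<close> and 1 is that of \<open>F\<close>.\<close>

lemma sample_var_L1:
  assumes n: "n \<ge> 1"
  shows "integrable (\<Pi>\<^sub>M i\<in>{1..n}. gauss) (\<lambda>\<zeta>. \<bar>sample_var n \<zeta> - 1\<bar>)"
    and "(\<integral>\<zeta>. \<bar>sample_var n \<zeta> - 1\<bar> \<partial>(\<Pi>\<^sub>M i\<in>{1..n}. gauss)) \<le> 10 / sqrt (real n)"
proof -
  let ?P = "\<Pi>\<^sub>M i\<in>{1..n}. (gauss :: real measure)"
  interpret P: prob_space ?P by (intro prob_space_PiM prob_space_gauss)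
  let ?G = "\<lambda>\<zeta>. (1 / sqrt n) * (\<Sum>i\<in>{1..n}. (\<zeta> i)\<^sup>2 - 1)"
  let ?F = "\<lambda>\<zeta>. (1 / sqrt n) * (\<Sum>i\<in>{1..n}. \<zeta> i)"
  have sn: "sqrt n > 0" "(sqrt n)\<^sup>2 = n" "1 \<le> sqrt n" using n by auto
  have m1: "integrable gauss (\<lambda>t::real. t)" "(\<integral>t. t \<partial>(gauss :: real measure)) = 0"
    using gauss_inner_mean[of "1::real"] by simp_all
  have m2: "integrable gauss (\<lambda>t::real. t\<^sup>2)" "(\<integral>t. t\<^sup>2 \<partial>(gauss :: real measure)) = 1"
    using gauss_inner_square[of "1::real"] by simp_all
  have m4: "integrable gauss (\<lambda>t::real. (t\<^sup>2 - 1)\<^sup>2)" "(\<integral>t. (t\<^sup>2 - 1)\<^sup>2 \<partial>(gauss :: real measure)) \<le> 8"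
    using gauss_inner_product_variance[of "1::real" "1::real"] by (simp_all add: power2_eq_square)
  have m2': "integrable gauss (\<lambda>t::real. t\<^sup>2 - 1)" "(\<integral>t. t\<^sup>2 - 1 \<partial>(gauss :: real measure)) = 0"
    using m2 by (simp_all add: gauss.prob_space[simplified])
  note SG = PiM_sum_square[OF _ prob_space_gauss m2'(1) m4(1) m2'(2), of "{1..n}"]
  note SF = PiM_sum_square[OF _ prob_space_gauss m1(1) m2(1) m1(2), of "{1..n}"]
  have G: "integrable ?P (\<lambda>\<zeta>. (?G \<zeta>)\<^sup>2)" "(\<integral>\<zeta>. (?G \<zeta>)\<^sup>2 \<partial>?P) \<le> 8"
    unfolding power_mult_distrib using SG m4 n by (simp_all add: power_divide)
  have F: "integrable ?P (\<lambda>\<zeta>. (?F \<zeta>)\<^sup>2)" "(\<integral>\<zeta>. (?F \<zeta>)\<^sup>2 \<partial>?P) = 1"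
    unfolding power_mult_distrib using SF m2 n by (simp_all add: power_divide)
  let ?U = "\<lambda>\<zeta>. (1 / sqrt n) * (1 + (?G \<zeta>)\<^sup>2 + (?F \<zeta>)\<^sup>2)"
  have U: "integrable ?P ?U"
    by (intro integrable_mult_right Bochner_Integration.integrable_add G F P.integrable_const)
  have le: "\<bar>sample_var n \<zeta> - 1\<bar> \<le> ?U \<zeta>" for \<zeta>
  proof -
    let ?m = "(\<Sum>j\<in>{1..n}. \<zeta> j) / real n"
    have "sample_var n \<zeta> = (1 / real n) * (\<Sum>i\<in>{1..n}. (\<zeta> i - ?m)\<^sup>2)"
      unfolding sample_var_def weight_def using n by (simp add: power_divide sum_divide_distrib)
    also have "(\<Sum>i\<in>{1..n}. (\<zeta> i - ?m)\<^sup>2) = (\<Sum>i\<in>{1..n}. (\<zeta> i)\<^sup>2) - 2 * ?m * (\<Sum>i\<in>{1..n}. \<zeta> i) + n * ?m\<^sup>2"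
    proof -
      have "(\<Sum>i\<in>{1..n}. (\<zeta> i - m)\<^sup>2) = (\<Sum>i\<in>{1..n}. (\<zeta> i)\<^sup>2) - 2 * m * (\<Sum>i\<in>{1..n}. \<zeta> i) + n * m\<^sup>2" for m :: real
        by (simp add: power2_diff sum.distrib sum_subtractf sum_distrib_left ac_simps)
      then show ?thesis .
    qed
    also have "\<dots> = (\<Sum>i\<in>{1..n}. (\<zeta> i)\<^sup>2) - n * ?m\<^sup>2"
      using n by (simp add: power2_eq_square)
    also have "(\<Sum>i\<in>{1..n}. (\<zeta> i)\<^sup>2) = (\<Sum>i\<in>{1..n}. (\<zeta> i)\<^sup>2 - 1) + n" using n by (simp add: sum_subtractf)
    finally have "sample_var n \<zeta> - 1 = (1 / real n) * (\<Sum>i\<in>{1..n}. (\<zeta> i)\<^sup>2 - 1) - ?m\<^sup>2"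
      using n by (simp add: right_diff_distrib distrib_left)
    also have "\<dots> = (1 / sqrt n) * ?G \<zeta> - (1 / real n) * (?F \<zeta>)\<^sup>2"
    proof -
      have "(1 / sqrt n) * (1 / sqrt n) = 1 / real n" by simp
      moreover have "?m\<^sup>2 = (1 / real n) * (?F \<zeta>)\<^sup>2"
        using n by (simp add: power_mult_distrib power_divide power2_eq_square)
      ultimately show ?thesis by (simp add: mult.assoc[symmetric])
    qed
    also have "\<bar>\<dots>\<bar> \<le> (1 / sqrt n) * \<bar>?G \<zeta>\<bar> + (1 / real n) * (?F \<zeta>)\<^sup>2"
      by (intro order_trans[OF abs_triangle_ineq4]) (simp add: abs_mult)
    also have "\<dots> \<le> (1 / sqrt n) * (1 + (?G \<zeta>)\<^sup>2) + (1 / sqrt n) * (?F \<zeta>)\<^sup>2"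
    proof (intro add_mono mult_left_mono mult_right_mono)
      show "\<bar>?G \<zeta>\<bar> \<le> 1 + (?G \<zeta>)\<^sup>2" by (rule abs_le_one_plus_square)
      have "sqrt n \<le> real n" using n by (intro real_le_lsqrt) (auto simp: power2_eq_square)
      then show "1 / real n \<le> 1 / sqrt n" using sn by (intro divide_left_mono) auto
    qed auto
    finally show ?thesis by (simp add: distrib_left)
  qed
  have "norm \<bar>sample_var n \<zeta> - 1\<bar> \<le> norm (?U \<zeta>)" for \<zeta>
    using le[of \<zeta>] by simp
  then show i: "integrable ?P (\<lambda>\<zeta>. \<bar>sample_var n \<zeta> - 1\<bar>)"
    by (intro Bochner_Integration.integrable_bound[OF U] AE_I2) measurable
  have "(\<integral>\<zeta>. \<bar>sample_var n \<zeta> - 1\<bar> \<partial>?P) \<le> (\<integral>\<zeta>. ?U \<zeta> \<partial>?P)"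
    by (rule integral_mono[OF i U]) (rule le)
  also have "\<dots> = (1 / sqrt n) * (\<integral>\<zeta>. 1 + (?G \<zeta>)\<^sup>2 + (?F \<zeta>)\<^sup>2 \<partial>?P)"
    by (rule Bochner_Integration.integral_mult_right) (intro Bochner_Integration.integrable_add G F P.integrable_const)
  also have "(\<integral>\<zeta>. 1 + (?G \<zeta>)\<^sup>2 + (?F \<zeta>)\<^sup>2 \<partial>?P) = (\<integral>\<zeta>. 1 \<partial>?P) + (\<integral>\<zeta>. (?G \<zeta>)\<^sup>2 \<partial>?P) + (\<integral>\<zeta>. (?F \<zeta>)\<^sup>2 \<partial>?P)"
  proof -
    have "(\<integral>\<zeta>. 1 + (?G \<zeta>)\<^sup>2 + (?F \<zeta>)\<^sup>2 \<partial>?P) = (\<integral>\<zeta>. 1 + (?G \<zeta>)\<^sup>2 \<partial>?P) + (\<integral>\<zeta>. (?F \<zeta>)\<^sup>2 \<partial>?P)"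
      by (rule Bochner_Integration.integral_add)
        (intro Bochner_Integration.integrable_add G F P.integrable_const)+
    also have "(\<integral>\<zeta>. 1 + (?G \<zeta>)\<^sup>2 \<partial>?P) = (\<integral>\<zeta>. 1 \<partial>?P) + (\<integral>\<zeta>. (?G \<zeta>)\<^sup>2 \<partial>?P)"
      by (rule Bochner_Integration.integral_add) (intro G P.integrable_const)+
    finally show ?thesis .
  qed
  also have "(1 / sqrt n) * \<dots> \<le> (1 / sqrt n) * 10"
  proof (rule mult_left_mono)
    have "(\<integral>\<zeta>. (1::real) \<partial>?P) = 1" using P.prob_space by simp
    then show "(\<integral>\<zeta>. 1 \<partial>?P) + (\<integral>\<zeta>. (?G \<zeta>)\<^sup>2 \<partial>?P) + (\<integral>\<zeta>. (?F \<zeta>)\<^sup>2 \<partial>?P) \<le> 10"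
      using G(2) F(2) by linarith
  qed simp
  finally show "(\<integral>\<zeta>. \<bar>sample_var n \<zeta> - 1\<bar> \<partial>?P) \<le> 10 / sqrt (real n)" by simp
qed

lemma sqrt_sample_var_L1:
  assumes a: "a \<longlonglongrightarrow> a0"
  defines "P \<equiv> \<lambda>n. \<Pi>\<^sub>M i\<in>{1..n::nat}. (gauss :: real measure)"
  shows "\<And>n. n \<ge> 1 \<Longrightarrow> integrable (P n) (\<lambda>\<zeta>. \<bar>a n * sqrt (sample_var n \<zeta>) - a0\<bar>)"
    and "(\<lambda>n. \<integral>\<zeta>. \<bar>a n * sqrt (sample_var n \<zeta>) - a0\<bar> \<partial>P n) \<longlonglongrightarrow> 0"
proof -
  have P: "prob_space (P n)" for n unfolding P_def by (intro prob_space_PiM prob_space_gauss)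
  have [measurable]: "sample_var n \<in> borel_measurable (P n)" for n
    unfolding P_def by (rule sample_var_measurable)
  have le: "\<bar>a n * sqrt (sample_var n \<zeta>) - a0\<bar> \<le> \<bar>a n\<bar> * \<bar>sample_var n \<zeta> - 1\<bar> + \<bar>a n - a0\<bar>" for n \<zeta>
  proof -
    let ?v = "sample_var n \<zeta>"
    have v: "0 \<le> ?v" by (rule sample_var_nonneg)
    have "?v - 1 = (sqrt ?v - 1) * (sqrt ?v + 1)" using v by (simp add: algebra_simps)
    then have "\<bar>?v - 1\<bar> = \<bar>sqrt ?v - 1\<bar> * (sqrt ?v + 1)" using v by (simp add: abs_mult)
    moreover have "\<bar>sqrt ?v - 1\<bar> * 1 \<le> \<bar>sqrt ?v - 1\<bar> * (sqrt ?v + 1)" using v by (intro mult_left_mono) auto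
    ultimately have "\<bar>sqrt ?v - 1\<bar> \<le> \<bar>?v - 1\<bar>" by simp
    then have "\<bar>a n * (sqrt ?v - 1)\<bar> \<le> \<bar>a n\<bar> * \<bar>?v - 1\<bar>" unfolding abs_mult by (intro mult_left_mono) auto
    moreover have "a n * sqrt ?v - a0 = a n * (sqrt ?v - 1) + (a n - a0)" by (simp add: algebra_simps)
    ultimately show ?thesis by linarith
  qed
  have U: "integrable (P n) (\<lambda>\<zeta>. \<bar>a n\<bar> * \<bar>sample_var n \<zeta> - 1\<bar> + \<bar>a n - a0\<bar>)" if "n \<ge> 1" for n
  proof -
    interpret prob_space "P n" by (rule P)
    have S: "integrable (P n) (\<lambda>\<zeta>. \<bar>sample_var n \<zeta> - 1\<bar>)"
      unfolding P_def by (rule sample_var_L1(1)[OF that])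
    show ?thesis by (intro Bochner_Integration.integrable_add integrable_mult_right S integrable_const)
  qed
  have nle: "norm \<bar>a n * sqrt (sample_var n \<zeta>) - a0\<bar> \<le> norm (\<bar>a n\<bar> * \<bar>sample_var n \<zeta> - 1\<bar> + \<bar>a n - a0\<bar>)" for n \<zeta>
    using le[of n \<zeta>] by simp
  show i: "integrable (P n) (\<lambda>\<zeta>. \<bar>a n * sqrt (sample_var n \<zeta>) - a0\<bar>)" if "n \<ge> 1" for n
    using nle by (intro Bochner_Integration.integrable_bound[OF U[OF that]] AE_I2) simp_all
  have b: "(\<integral>\<zeta>. \<bar>a n * sqrt (sample_var n \<zeta>) - a0\<bar> \<partial>P n) \<le> \<bar>a n\<bar> * (10 * (1 / sqrt (real n))) + \<bar>a n - a0\<bar>" if n: "n \<ge> 1" for n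
  proof -
    interpret prob_space "P n" by (rule P)
    have S: "integrable (P n) (\<lambda>\<zeta>. \<bar>sample_var n \<zeta> - 1\<bar>)"
      "(\<integral>\<zeta>. \<bar>sample_var n \<zeta> - 1\<bar> \<partial>P n) \<le> 10 / sqrt (real n)"
      unfolding P_def by (rule sample_var_L1[OF n])+
    have "(\<integral>\<zeta>. \<bar>a n * sqrt (sample_var n \<zeta>) - a0\<bar> \<partial>P n) \<le> (\<integral>\<zeta>. \<bar>a n\<bar> * \<bar>sample_var n \<zeta> - 1\<bar> + \<bar>a n - a0\<bar> \<partial>P n)"
      by (rule integral_mono[OF i[OF n] U[OF n]]) (rule le)
    also have "\<dots> = \<bar>a n\<bar> * (\<integral>\<zeta>. \<bar>sample_var n \<zeta> - 1\<bar> \<partial>P n) + \<bar>a n - a0\<bar>"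
      using S(1) by (simp add: prob_space)
    also have "\<dots> \<le> \<bar>a n\<bar> * (10 * (1 / sqrt (real n))) + \<bar>a n - a0\<bar>"
      using S(2) by (intro add_right_mono mult_left_mono) auto
    finally show ?thesis .
  qed
  have "(\<lambda>n. \<bar>a n\<bar> * (10 * (1 / sqrt (real n))) + \<bar>a n - a0\<bar>) \<longlonglongrightarrow> \<bar>a0\<bar> * (10 * 0) + \<bar>a0 - a0\<bar>"
    using inverse_sqrt_tendsto_0 by (intro tendsto_intros a)
  then have lim: "(\<lambda>n. \<bar>a n\<bar> * (10 * (1 / sqrt (real n))) + \<bar>a n - a0\<bar>) \<longlonglongrightarrow> 0" by simp
  show "(\<lambda>n. \<integral>\<zeta>. \<bar>a n * sqrt (sample_var n \<zeta>) - a0\<bar> \<partial>P n) \<longlonglongrightarrow> 0"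
    by (rule tendsto_sandwich[OF _ _ tendsto_const lim])
      (use b in \<open>auto simp: eventually_sequentially intro!: exI[of _ 1]\<close>)
qed

lemma weighted_sum_measurable:
  "(\<lambda>p. \<Sum>i\<in>{1..n}. weight n (fst p) i *\<^sub>R (snd p i :: 'a::euclidean_space)) \<in>
    borel_measurable ((\<Pi>\<^sub>M i\<in>{1..n}. gauss) \<Otimes>\<^sub>M (\<Pi>\<^sub>M i\<in>{1..n}. gauss))"
proof (intro borel_measurable_sum borel_measurable_scaleR)
  fix i assume i: "i \<in> {1..n}"
  show "(\<lambda>p. weight n (fst p) i) \<in> borel_measurable ((\<Pi>\<^sub>M i\<in>{1..n}. gauss) \<Otimes>\<^sub>M (\<Pi>\<^sub>M i\<in>{1..n}. (gauss :: 'a measure)))"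
    by (rule measurable_compose[OF measurable_fst weight_measurable[OF i]])
  show "(\<lambda>p. snd p i) \<in> borel_measurable ((\<Pi>\<^sub>M i\<in>{1..n}. (gauss :: real measure)) \<Otimes>\<^sub>M (\<Pi>\<^sub>M i\<in>{1..n}. (gauss :: 'a measure)))"
    using i by measurable
qed

text \<open>Conditionally on \<open>\<zeta>\<close> the weights are constants, so \<open>gauss_weighted_sum\<close> applies for each \<open>\<zeta>\<close>
  and Fubini's theorem combines the conditional laws.\<close>

lemma weighted_gauss_mixture:
  "distr ((\<Pi>\<^sub>M i\<in>{1..n}. gauss) \<Otimes>\<^sub>M (\<Pi>\<^sub>M i\<in>{1..n}. gauss)) borel
     (\<lambda>p. \<Sum>i\<in>{1..n}. weight n (fst p) i *\<^sub>R (snd p i :: 'a::euclidean_space)) =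
   distr ((\<Pi>\<^sub>M i\<in>{1..n}. gauss) \<Otimes>\<^sub>M gauss) borel (\<lambda>p. sqrt (sample_var n (fst p)) *\<^sub>R snd p)"
  (is "?L = ?R")
proof (rule measure_eqI)
  let ?P = "\<Pi>\<^sub>M i\<in>{1..n}. (gauss :: real measure)" and ?Q = "\<Pi>\<^sub>M i\<in>{1..n}. (gauss :: 'a measure)"
  interpret Q: prob_space ?Q by (intro prob_space_PiM prob_space_gauss)
  note W = weighted_sum_measurable[of n, where 'a = 'a]
  have V: "(\<lambda>p. sqrt (sample_var n (fst p)) *\<^sub>R (snd p :: 'a)) \<in> borel_measurable (?P \<Otimes>\<^sub>M gauss)"
    by measurable
  fix A assume "A \<in> sets ?L"
  then have A [measurable]: "A \<in> sets borel" by simp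
  have "emeasure ?L A = (\<integral>\<^sup>+\<zeta>. \<integral>\<^sup>+y. indicator A (\<Sum>i\<in>{1..n}. weight n \<zeta> i *\<^sub>R y i) \<partial>?Q \<partial>?P)"
    unfolding emeasure_eq_nn_integral_indicator_distr[OF W A]
    by (subst Q.nn_integral_fst[symmetric], rule measurable_compose[OF W], simp, simp)
  also have "\<dots> = (\<integral>\<^sup>+\<zeta>. \<integral>\<^sup>+y. indicator A (sqrt (sample_var n \<zeta>) *\<^sub>R y) \<partial>gauss \<partial>?P)"
  proof (rule nn_integral_cong)
    fix \<zeta>
    have "(\<integral>\<^sup>+y. indicator A (\<Sum>i\<in>{1..n}. weight n \<zeta> i *\<^sub>R y i) \<partial>?Q) =
        emeasure (distr ?Q borel (\<lambda>y. \<Sum>i\<in>{1..n}. weight n \<zeta> i *\<^sub>R y i)) A"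
      by (rule emeasure_eq_nn_integral_indicator_distr[symmetric]) measurable
    also have "\<dots> = emeasure (distr gauss borel (\<lambda>y. sqrt (sample_var n \<zeta>) *\<^sub>R y)) A"
      unfolding sample_var_def by (subst gauss_weighted_sum) auto
    also have "\<dots> = (\<integral>\<^sup>+y. indicator A (sqrt (sample_var n \<zeta>) *\<^sub>R y) \<partial>gauss)"
      by (rule emeasure_eq_nn_integral_indicator_distr) measurable
    finally show "(\<integral>\<^sup>+y. indicator A (\<Sum>i\<in>{1..n}. weight n \<zeta> i *\<^sub>R y i) \<partial>?Q) =
      (\<integral>\<^sup>+y. indicator A (sqrt (sample_var n \<zeta>) *\<^sub>R y) \<partial>gauss)" .
  qed
  also have "\<dots> = emeasure ?R A"
    unfolding emeasure_eq_nn_integral_indicator_distr[OF V A]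
    by (subst gauss.nn_integral_fst[symmetric], rule measurable_compose[OF V], simp, simp)
  finally show "emeasure ?L A = emeasure ?R A" .
qed simp

text \<open>A spiked sample built from its coordinates \<open>\<zeta>\<close> along \<open>\<theta>\<close> and from vectors \<open>y\<close> of which only the part
  orthogonal to \<open>\<theta>\<close> is kept. The restriction to \<open>{1..n}\<close> makes it an element of the product space.\<close>

definition spiked_data :: "nat \<Rightarrow> 'a::euclidean_space \<Rightarrow> real \<Rightarrow> (nat \<Rightarrow> real) \<times> (nat \<Rightarrow> 'a) \<Rightarrow> nat \<Rightarrow> 'a" where
  "spiked_data n \<theta> s = (\<lambda>(\<zeta>, y). \<lambda>i\<in>{1..n}. (s * \<zeta> i) *\<^sub>R \<theta> + (y i - (\<theta> \<bullet> y i) *\<^sub>R \<theta>))"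

lemma spiked_data_measurable [measurable]:
  "spiked_data n \<theta> s \<in> measurable ((\<Pi>\<^sub>M i\<in>{1..n}. gauss) \<Otimes>\<^sub>M (\<Pi>\<^sub>M i\<in>{1..n}. gauss)) (\<Pi>\<^sub>M i\<in>{1..n}. borel)"
  unfolding spiked_data_def by measurable

lemma sample_law_eq_distr:
  fixes \<theta> :: "real ^ 'p"
  assumes \<theta>: "norm \<theta> = 1" and c: "0 \<le> \<rho> * v"
  shows "sample_law n \<theta> \<rho> v = distr ((\<Pi>\<^sub>M i\<in>{1..n}. gauss) \<Otimes>\<^sub>M (\<Pi>\<^sub>M i\<in>{1..n}. gauss)) (\<Pi>\<^sub>M i\<in>{1..n}. borel)
    (spiked_data n \<theta> (sqrt (1 + \<rho> * v)))"
proof -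
  let ?s = "sqrt (1 + \<rho> * v)"
  let ?h = "\<lambda>p. (?s * fst p) *\<^sub>R \<theta> + (snd p - (\<theta> \<bullet> snd p) *\<^sub>R \<theta>)"
  have tt: "\<theta> \<bullet> \<theta> = 1" using \<theta> by (simp add: dot_square_norm)
  have "mv_normal 0 (spiked_cov \<theta> \<rho> v) = distr gauss borel (stretch \<theta> ?s)"
    by (rule mv_normal_spiked[OF \<theta> c])
  also have "\<dots> = distr (distr (gauss \<Otimes>\<^sub>M gauss) borel (\<lambda>(s::real, y). s *\<^sub>R \<theta> + (y - (\<theta> \<bullet> y) *\<^sub>R \<theta>))) borel (stretch \<theta> ?s)"
    by (simp add: gauss_split[OF \<theta>])
  also have "\<dots> = distr (gauss \<Otimes>\<^sub>M gauss) borel ?h"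
    by (subst distr_distr)
      (auto simp: comp_def split_beta' stretch_def inner_add_right inner_diff_right tt algebra_simps
        intro!: distr_cong)
  finally have mv: "mv_normal 0 (spiked_cov \<theta> \<rho> v) = distr (gauss \<Otimes>\<^sub>M gauss) borel ?h" .
  show ?thesis
    unfolding sample_law_def mv
    by (subst distr_PiM_pair[symmetric]) (auto simp: spiked_data_def prob_space_gauss)
qed

lemma sample_cov_mult_vec_centered:
  assumes n: "n \<ge> 1"
  shows "sample_cov n x *v w = (1 / real n) *\<^sub>R (\<Sum>i\<in>{1..n}. ((x i - sample_mean n x) \<bullet> w) *\<^sub>R x i)"
proof -
  have "real n * (sample_mean n x \<bullet> w) = (\<Sum>i\<in>{1..n}. x i \<bullet> w)"
    using n by (simp add: sample_mean_def inner_sum_left)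
  then have 0: "(\<Sum>i\<in>{1..n}. (x i - sample_mean n x) \<bullet> w) = 0"
    by (simp add: inner_diff_left sum_subtractf)
  have "(\<Sum>i\<in>{1..n}. ((x i - sample_mean n x) \<bullet> w) *\<^sub>R (x i - sample_mean n x)) =
      (\<Sum>i\<in>{1..n}. ((x i - sample_mean n x) \<bullet> w) *\<^sub>R x i)
      - (\<Sum>i\<in>{1..n}. (x i - sample_mean n x) \<bullet> w) *\<^sub>R sample_mean n x"
    by (simp only: scaleR_diff_right sum_subtractf scaleR_left.sum)
  then show ?thesis unfolding sample_cov_mult_vec 0 by simp
qed

text \<open>The deviations from the mean sum to 0, so only one factor of the sample covariance has to be centred; projecting
  orthogonally to \<open>\<theta>\<close> then removes \<open>\<zeta>\<close> from the other factor.\<close>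

lemma cross_cov_spiked_data:
  fixes \<theta> :: "real ^ 'p"
  assumes \<theta>: "norm \<theta> = 1" and n: "n \<ge> 1"
  defines "W \<equiv> \<lambda>p. \<Sum>i\<in>{1..n}. weight n (fst p) i *\<^sub>R (snd p i :: real ^ 'p)"
  shows "sqrt (real n) *\<^sub>R ((mat 1 - outer \<theta> \<theta>) *v (sample_cov n (spiked_data n \<theta> s p) *v \<theta>)) =
    s *\<^sub>R ((mat 1 - outer \<theta> \<theta>) *v W p)"
proof -
  obtain \<zeta> y where p: "p = (\<zeta>, y)" by (cases p)
  let ?x = "spiked_data n \<theta> s p"
  have tt: "\<theta> \<bullet> \<theta> = 1" using \<theta> by (simp add: dot_square_norm)
  have x\<theta>: "?x i \<bullet> \<theta> = s * \<zeta> i" if "i \<in> {1..n}" for i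
    using that by (subst inner_commute) (simp add: p spiked_data_def inner_add_right inner_diff_right tt)
  have mean: "sample_mean n ?x \<bullet> \<theta> = s * ((\<Sum>j\<in>{1..n}. \<zeta> j) / real n)"
    by (simp add: sample_mean_def inner_sum_left x\<theta> sum_distrib_left[symmetric])
  have dev: "(?x i - sample_mean n ?x) \<bullet> \<theta> = s * (sqrt (real n) * weight n \<zeta> i)" if "i \<in> {1..n}" for i
  proof -
    have "sqrt (real n) * weight n \<zeta> i = \<zeta> i - (\<Sum>j\<in>{1..n}. \<zeta> j) / real n"
      using n by (simp add: weight_def)
    then show ?thesis unfolding inner_diff_left x\<theta>[OF that] mean by (simp only: right_diff_distrib)
  qed
  let ?P = "\<lambda>u. (mat 1 - outer \<theta> \<theta>) *v u :: real ^ 'p"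
  have Plin: "linear ?P" by (rule matrix_vector_mul_linear)
  have Px: "?P (?x i) = ?P (y i)" if "i \<in> {1..n}" for i
    unfolding perp_mult_vec using that by (simp add: p spiked_data_def inner_add_right inner_diff_right tt algebra_simps)
  have "?P (sample_cov n ?x *v \<theta>) =
      (1 / real n) *\<^sub>R (\<Sum>i\<in>{1..n}. (s * (sqrt (real n) * weight n \<zeta> i)) *\<^sub>R ?P (y i))"
    unfolding sample_cov_mult_vec_centered[OF n]
    by (simp add: linear_scale[OF Plin] linear_sum[OF Plin] dev Px)
  also have "\<dots> = (1 / real n * s * sqrt (real n)) *\<^sub>R ?P (W p)"
    unfolding W_def p by (simp add: linear_sum[OF Plin] linear_scale[OF Plin] scaleR_sum_right ac_simps)
  finally have "sqrt (real n) *\<^sub>R ?P (sample_cov n ?x *v \<theta>) =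
      (sqrt (real n) * (1 / real n * s * sqrt (real n))) *\<^sub>R ?P (W p)" by simp
  also have "sqrt (real n) * (1 / real n * s * sqrt (real n)) = s"
  proof -
    have alg: "q * (1 / (q * q) * s * q) = s" if "q > 0" for q using that by simp
    show ?thesis using alg[of "sqrt (real n)"] n by simp
  qed
  finally show ?thesis .
qed

section \<open>Limit laws of the central sequences\<close>

lemma perp_spiked_cov:
  assumes "norm \<theta> = 1"
  shows "(mat 1 - outer \<theta> \<theta>) *v (spiked_cov \<theta> \<rho> v *v \<theta>) = 0"
proof -
  have "\<theta> \<bullet> \<theta> = 1" using assms by (simp add: dot_square_norm)
  then show ?thesis
    unfolding perp_mult_vec spiked_cov_mult_vec by (simp add: inner_add_right algebra_simps)
qed

lemma integral_weighted_mixture: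
  fixes g :: "'a::euclidean_space \<Rightarrow> 'c::{banach, second_countable_topology}"
  assumes [measurable]: "g \<in> borel_measurable borel"
  shows "(\<integral>p. g (\<Sum>i\<in>{1..n}. weight n (fst p) i *\<^sub>R snd p i)
       \<partial>((\<Pi>\<^sub>M i\<in>{1..n}. gauss) \<Otimes>\<^sub>M (\<Pi>\<^sub>M i\<in>{1..n}. gauss))) =
    (\<integral>p. g (sqrt (sample_var n (fst p)) *\<^sub>R snd p) \<partial>((\<Pi>\<^sub>M i\<in>{1..n}. gauss) \<Otimes>\<^sub>M gauss))"
proof -
  let ?P = "\<Pi>\<^sub>M i\<in>{1..n}. (gauss :: real measure)" and ?Q = "\<Pi>\<^sub>M i\<in>{1..n}. (gauss :: 'a measure)"
  let ?W = "\<lambda>p. \<Sum>i\<in>{1..n}. weight n (fst p) i *\<^sub>R (snd p i :: 'a)"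
  note W = weighted_sum_measurable[of n, where 'a = 'a]
  have V: "(\<lambda>p. sqrt (sample_var n (fst p)) *\<^sub>R (snd p :: 'a)) \<in> borel_measurable (?P \<Otimes>\<^sub>M gauss)"
    by measurable
  have "(\<integral>p. g (?W p) \<partial>(?P \<Otimes>\<^sub>M ?Q)) = (\<integral>u. g u \<partial>distr (?P \<Otimes>\<^sub>M ?Q) borel ?W)"
    by (rule integral_distr[OF W, symmetric]) measurable
  also have "\<dots> = (\<integral>p. g (sqrt (sample_var n (fst p)) *\<^sub>R snd p) \<partial>(?P \<Otimes>\<^sub>M gauss))"
    unfolding weighted_gauss_mixture by (rule integral_distr[OF V]) measurable
  finally show ?thesis .
qed

text \<open>The projected statistic is exactly \<open>c s\<^sub>n\<close> times a normal scale mixture. Its total scale converges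
  to \<open>c \<surd>(v / c) = \<surd>(v c)\<close> because \<open>s\<^sub>n\<^sup>2 = 1 + r\<^sub>n v = v / (v / (1 + r\<^sub>n v))\<close>.\<close>

lemma lan_central_sequence_limit:
  fixes \<theta> :: "real ^ 'p"
  assumes \<theta>: "norm \<theta> = 1" and v: "v > 0" and r: "\<forall>n\<ge>1. r n > 0"
    and c: "(\<lambda>n. v / (1 + r n * v)) \<longlonglongrightarrow> c" "c > 0"
  shows "conv_in_distr (\<lambda>n. sample_law n \<theta> (r n) v)
    (\<lambda>n x. (c * sqrt (real n)) *\<^sub>R ((mat 1 - outer \<theta> \<theta>) *v ((sample_cov n x - spiked_cov \<theta> (r n) v) *v \<theta>)))
    (mv_normal 0 ((v * c) *\<^sub>R (mat 1 - outer \<theta> \<theta>)))"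
  (is "conv_in_distr ?M ?\<Delta> ?L")
  unfolding conv_in_distr_def
proof (intro conjI allI impI)
  let ?P = "\<lambda>u. (mat 1 - outer \<theta> \<theta>) *v u :: real ^ 'p"
  have [measurable]: "?P \<in> borel_measurable borel" by (rule linear_borel_measurable[OF perp_linear])
  have \<Delta>m: "?\<Delta> n \<in> borel_measurable (?M n)" for n
    unfolding perp_mult_vec matrix_vector_mult_diff_rdistrib[of "sample_cov n _"] by measurable
  then show "?\<Delta> n \<in> borel_measurable (?M n)" for n .
  fix f :: "real ^ 'p \<Rightarrow> real"
  assume f: "continuous_on UNIV f" "bounded (range f)"
  obtain B where B: "\<And>x. norm (f x) \<le> B" using f(2) by (auto simp: bounded_iff)
  have [measurable]: "f \<in> borel_measurable borel" by (rule borel_measurable_continuous_onI[OF f(1)])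
  let ?R = "\<lambda>n. \<Pi>\<^sub>M i\<in>{1..n}. (gauss :: real measure)" and ?Q = "\<lambda>n. \<Pi>\<^sub>M i\<in>{1..n}. (gauss :: (real ^ 'p) measure)"
  let ?s = "\<lambda>n. sqrt (1 + r n * v)"
  let ?a = "\<lambda>n. c * ?s n"
  have fP: "continuous_on UNIV (\<lambda>u. f (?P u))"
    by (intro continuous_on_compose2[OF f(1)] linear_continuous_on)
      (auto simp: linear_conv_bounded_linear[symmetric] perp_linear)
  have eq: "(\<integral>x. f (?\<Delta> n x) \<partial>?M n) =
      (\<integral>p. f (?P ((?a n * sqrt (sample_var n (fst p))) *\<^sub>R snd p)) \<partial>(?R n \<Otimes>\<^sub>M gauss))" if n: "n \<ge> 1" for n
  proof -
    have rv: "0 \<le> r n * v" using r v n by (simp add: less_imp_le)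
    let ?W = "\<lambda>p. \<Sum>i\<in>{1..n}. weight n (fst p) i *\<^sub>R (snd p i :: real ^ 'p)"
    have \<Delta>x: "?\<Delta> n (spiked_data n \<theta> (?s n) p) = ?a n *\<^sub>R ?P (?W p)" for p
      using cross_cov_spiked_data[OF \<theta> n, of "?s n" p]
      by (simp add: matrix_vector_mult_diff_rdistrib[of "sample_cov n _"] matrix_vector_mult_diff_distrib
          perp_spiked_cov[OF \<theta>] scaleR_scaleR[symmetric] del: scaleR_scaleR)
    have "(\<integral>x. f (?\<Delta> n x) \<partial>?M n) = (\<integral>p. f (?\<Delta> n (spiked_data n \<theta> (?s n) p)) \<partial>(?R n \<Otimes>\<^sub>M ?Q n))"
      unfolding sample_law_eq_distr[OF \<theta> rv]
      by (rule integral_distr[OF spiked_data_measurable])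
        (use \<Delta>m[of n] in \<open>simp add: measurable_cong_sets[OF sets_sample_law refl]\<close>)
    also have "\<dots> = (\<integral>p. f (?a n *\<^sub>R ?P (?W p)) \<partial>(?R n \<Otimes>\<^sub>M ?Q n))"
      unfolding \<Delta>x ..
    also have "\<dots> = (\<integral>p. f (?a n *\<^sub>R ?P (sqrt (sample_var n (fst p)) *\<^sub>R snd p)) \<partial>(?R n \<Otimes>\<^sub>M gauss))"
      by (rule integral_weighted_mixture) measurable
    finally show ?thesis by (simp add: matrix_vector_mult_scaleR)
  qed
  have a: "?a \<longlonglongrightarrow> sqrt (v * c)"
  proof -
    have l: "(\<lambda>n. c * sqrt (v / (v / (1 + r n * v)))) \<longlonglongrightarrow> c * sqrt (v / c)"
      using c by (intro tendsto_intros) auto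
    have a: "(\<lambda>n. c * sqrt (v / (v / (1 + r n * v)))) = ?a" using v by (simp add: fun_eq_iff)
    have a0: "c * sqrt (v / c) = sqrt (v * c)"
    proof -
      have "sqrt (v * c) = sqrt (c\<^sup>2 * (v / c))" using c(2) by (simp add: power2_eq_square)
      also have "\<dots> = c * sqrt (v / c)" using c(2) by (subst real_sqrt_mult) simp
      finally show ?thesis ..
    qed
    show ?thesis using l unfolding a a0 .
  qed
  have lim: "(\<lambda>n. \<integral>p. f (?P ((?a n * sqrt (sample_var n (fst p))) *\<^sub>R snd p)) \<partial>(?R n \<Otimes>\<^sub>M gauss))
      \<longlonglongrightarrow> (\<integral>y. f (?P (sqrt (v * c) *\<^sub>R y)) \<partial>gauss)"
  proof (rule scale_mixture_limit[where f = "\<lambda>u. f (?P u)" and A = "\<lambda>n \<zeta>. ?a n * sqrt (sample_var n \<zeta>)" and B = B])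
    show "prob_space (?R n)" for n by (intro prob_space_PiM prob_space_gauss)
    show "(\<lambda>\<zeta>. ?a n * sqrt (sample_var n \<zeta>)) \<in> borel_measurable (?R n)" for n by measurable
    show "norm (f (?P y)) \<le> B" for y by (rule B)
  qed (rule sqrt_sample_var_L1[OF a] fP | assumption)+
  have "psd_sqrt ((v * c) *\<^sub>R (mat 1 - outer \<theta> \<theta>)) = sqrt (v * c) *\<^sub>R (mat 1 - outer \<theta> \<theta>)"
    using psd_sqrt_spiked(1)[OF \<theta>, of "v * c" 0] v c(2) by simp
  then have "?L = distr gauss borel (\<lambda>z. sqrt (v * c) *\<^sub>R ?P z)"
    by (simp add: mv_normal_def std_normal_vec_eq_gauss scaleR_matrix_mult_vec)
  then have "(\<integral>x. f x \<partial>?L) = (\<integral>y. f (?P (sqrt (v * c) *\<^sub>R y)) \<partial>gauss)"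
    by (simp add: integral_distr matrix_vector_mult_scaleR)
  with lim have "(\<lambda>n. \<integral>p. f (?P ((?a n * sqrt (sample_var n (fst p))) *\<^sub>R snd p)) \<partial>(?R n \<Otimes>\<^sub>M gauss))
      \<longlonglongrightarrow> (\<integral>x. f x \<partial>?L)" by simp
  then show "(\<lambda>n. \<integral>x. f (?\<Delta> n x) \<partial>?M n) \<longlonglongrightarrow> (\<integral>x. f x \<partial>?L)"
    by (rule Lim_transform_eventually) (use eq in \<open>auto simp: eventually_sequentially intro!: exI[of _ 1]\<close>)
qed

text \<open>The exact law of a sample covariance between two orthogonal directions of unspiked data. At spike
  strength 0 the law does not depend on \<open>\<theta>\<close>, so the decomposition can be made along \<open>w\<close> instead.\<close>

lemma integral_cross_cov_orthogonal:
  fixes \<theta> \<tau> w :: "real ^ 'p" and g :: "real \<Rightarrow> complex"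
  assumes n: "n \<ge> 1" and orth: "\<tau> \<bullet> w = 0" and g [measurable]: "g \<in> borel_measurable borel"
  shows "(\<integral>x. g (\<tau> \<bullet> (sqrt (real n) *\<^sub>R (sample_cov n x *v w))) \<partial>sample_law n \<theta> 0 v) =
    (\<integral>p. g ((norm \<tau> * norm w * sqrt (sample_var n (fst p))) *\<^sub>R snd p)
      \<partial>((\<Pi>\<^sub>M i\<in>{1..n}. gauss) \<Otimes>\<^sub>M gauss))"
proof -
  let ?R = "\<Pi>\<^sub>M i\<in>{1..n}. (gauss :: real measure)" and ?Q = "\<Pi>\<^sub>M i\<in>{1..n}. (gauss :: (real ^ 'p) measure)"
  interpret R: prob_space ?R by (intro prob_space_PiM prob_space_gauss)
  obtain b where b: "norm b = 1" "w = norm w *\<^sub>R b" by (rule unit_direction)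
  let ?P = "\<lambda>u. (mat 1 - outer b b) *v u :: real ^ 'p"
  let ?W = "\<lambda>p. \<Sum>i\<in>{1..n}. weight n (fst p) i *\<^sub>R (snd p i :: real ^ 'p)"
  have law: "sample_law n \<theta> 0 v = sample_law n b 0 v"
    by (simp add: sample_law_def spiked_cov_def)
  have U: "\<tau> \<bullet> (sqrt (real n) *\<^sub>R (sample_cov n (spiked_data n b 1 p) *v w)) = norm w * (\<tau> \<bullet> ?W p)" for p
  proof (cases "w = 0")
    case True
    then show ?thesis by simp
  next
    case False
    then have \<tau>b: "\<tau> \<bullet> b = 0" using orth by (subst (asm) b(2)) simp
    then have \<tau>P: "\<tau> \<bullet> ?P u = \<tau> \<bullet> u" for u unfolding perp_mult_vec by (simp add: inner_diff_right)
    let ?x = "spiked_data n b 1 p"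
    have "\<tau> \<bullet> (sqrt (real n) *\<^sub>R (sample_cov n ?x *v w)) =
        norm w * (\<tau> \<bullet> (sqrt (real n) *\<^sub>R ?P (sample_cov n ?x *v b)))"
      by (subst b(2)) (simp add: matrix_vector_mult_scaleR \<tau>P)
    also have "\<dots> = norm w * (\<tau> \<bullet> ?W p)"
      unfolding cross_cov_spiked_data[OF b(1) n] by (simp add: \<tau>P)
    finally show ?thesis .
  qed
  have m: "(\<lambda>x. g (\<tau> \<bullet> (sqrt (real n) *\<^sub>R (sample_cov n x *v w)))) \<in> borel_measurable (sample_law n b 0 v)"
    by measurable
  have "(\<integral>x. g (\<tau> \<bullet> (sqrt (real n) *\<^sub>R (sample_cov n x *v w))) \<partial>sample_law n \<theta> 0 v) =
      (\<integral>p. g (norm w * (\<tau> \<bullet> ?W p)) \<partial>(?R \<Otimes>\<^sub>M ?Q))"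
  proof -
    have law1: "sample_law n b 0 v = distr (?R \<Otimes>\<^sub>M ?Q) (\<Pi>\<^sub>M i\<in>{1..n}. borel) (spiked_data n b 1)"
      using sample_law_eq_distr[OF b(1), of 0 v n] by (simp del: One_nat_def)
    show ?thesis
      unfolding law law1 U[symmetric]
      by (rule integral_distr[OF spiked_data_measurable])
        (use m in \<open>simp only: measurable_cong_sets[OF sets_sample_law refl]\<close>)
  qed
  also have "\<dots> = (\<integral>p. g (norm w * (\<tau> \<bullet> (sqrt (sample_var n (fst p)) *\<^sub>R snd p))) \<partial>(?R \<Otimes>\<^sub>M gauss))"
    by (rule integral_weighted_mixture) measurable
  also have "\<dots> = (\<integral>p. g (norm w * (sqrt (sample_var n (fst p)) * snd p)) \<partial>(?R \<Otimes>\<^sub>M distr gauss borel ((\<bullet>) \<tau>)))"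
  proof -
    have "?R \<Otimes>\<^sub>M distr gauss borel ((\<bullet>) \<tau>) = distr ?R ?R (\<lambda>x. x) \<Otimes>\<^sub>M distr gauss borel ((\<bullet>) \<tau>)"
      by (simp add: distr_id2)
    also have "\<dots> = distr (?R \<Otimes>\<^sub>M gauss) (?R \<Otimes>\<^sub>M borel) (\<lambda>(x, y). (x, \<tau> \<bullet> y))"
      by (rule pair_measure_distr) (auto intro!: prob_space_imp_sigma_finite gauss.prob_space_distr)
    finally show ?thesis
      by (simp only:) (subst integral_distr, measurable, measurable, simp add: split_beta')
  qed
  also have "\<dots> = (\<integral>p. g (norm w * (sqrt (sample_var n (fst p)) * (norm \<tau> * snd p))) \<partial>(?R \<Otimes>\<^sub>M gauss))"
  proof -
    have "?R \<Otimes>\<^sub>M distr gauss borel (\<lambda>t::real. norm \<tau> * t) = distr ?R ?R (\<lambda>x. x) \<Otimes>\<^sub>M distr gauss borel (\<lambda>t. norm \<tau> * t)"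
      by (simp add: distr_id2)
    also have "\<dots> = distr (?R \<Otimes>\<^sub>M gauss) (?R \<Otimes>\<^sub>M borel) (\<lambda>(x, y). (x, norm \<tau> * y))"
      by (rule pair_measure_distr) (auto intro!: prob_space_imp_sigma_finite gauss.prob_space_distr)
    finally show ?thesis unfolding gauss_inner_scaled
      by (simp only:) (subst integral_distr, measurable, measurable, simp add: split_beta')
  qed
  finally show ?thesis by (simp add: ac_simps)
qed

lemma linear_stretch: "linear (stretch \<theta> s)"
  by (rule linearI) (auto simp: stretch_def inner_add_right algebra_simps)

lemma stretch_minus_id_le:
  assumes "norm \<theta> = 1"
  shows "norm (stretch \<theta> s a - a) \<le> \<bar>s - 1\<bar> * norm a"
proof -
  have "norm (stretch \<theta> s a - a) = \<bar>s - 1\<bar> * \<bar>\<theta> \<bullet> a\<bar>"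
    using assms by (simp add: stretch_def abs_mult)
  also have "\<dots> \<le> \<bar>s - 1\<bar> * norm a"
    using Cauchy_Schwarz_ineq2[of \<theta> a] assms by (intro mult_left_mono) auto
  finally show ?thesis .
qed

lemma sample_cov_stretch:
  fixes \<theta> w :: "real ^ 'p"
  shows "sample_cov n (\<lambda>i\<in>{1..n}. stretch \<theta> s (z i)) *v w = stretch \<theta> s (sample_cov n z *v stretch \<theta> s w)"
proof -
  let ?A = "stretch \<theta> s"
  have mean: "sample_mean n (\<lambda>i\<in>{1..n}. ?A (z i)) = ?A (sample_mean n z)"
    by (simp add: sample_mean_def linear_scale[OF linear_stretch] linear_sum[OF linear_stretch])
  show ?thesis
    unfolding sample_cov_mult_vec mean
    by (simp add: linear_scale[OF linear_stretch] linear_sum[OF linear_stretch]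
        linear_diff[OF linear_stretch, symmetric] inner_stretch[symmetric] inner_commute[of _ w]
        inner_commute[of _ "?A w"])
qed

text \<open>Couples the spiked sample with an unspiked one, which has a law that is fixed apart from \<open>n\<close>.\<close>

lemma sample_law_stretch:
  fixes \<theta> :: "real ^ 'p"
  assumes \<theta>: "norm \<theta> = 1" and c: "0 \<le> \<rho> * v"
  shows "sample_law n \<theta> \<rho> v = distr (sample_law n \<theta> 0 v) (\<Pi>\<^sub>M i\<in>{1..n}. borel)
    (\<lambda>z. \<lambda>i\<in>{1..n}. stretch \<theta> (sqrt (1 + \<rho> * v)) (z i))"
proof -
  let ?s = "sqrt (1 + \<rho> * v)"
  have tt: "\<theta> \<bullet> \<theta> = 1" using \<theta> by (simp add: dot_square_norm)
  have m: "(\<lambda>z. \<lambda>i\<in>{1..n}. stretch \<theta> ?s (z i)) \<in> measurable (\<Pi>\<^sub>M i\<in>{1..n}. borel) (\<Pi>\<^sub>M i\<in>{1..n}. borel)"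
    by measurable
  have eq: "(\<lambda>z. \<lambda>i\<in>{1..n}. stretch \<theta> ?s (z i)) \<circ> spiked_data n \<theta> 1 = spiked_data n \<theta> ?s"
    by (auto simp: spiked_data_def stretch_def split_beta' inner_add_right inner_diff_right tt algebra_simps
        intro!: restrict_ext ext)
  have std: "sample_law n \<theta> 0 v = distr ((\<Pi>\<^sub>M i\<in>{1..n}. gauss) \<Otimes>\<^sub>M (\<Pi>\<^sub>M i\<in>{1..n}. gauss))
      (\<Pi>\<^sub>M i\<in>{1..n}. borel) (spiked_data n \<theta> 1)"
    using sample_law_eq_distr[OF \<theta>, of 0 v n] by (simp del: One_nat_def)
  show ?thesis
    unfolding std distr_distr[OF m spiked_data_measurable] eq by (rule sample_law_eq_distr[OF \<theta> c])
qed

lemma cmod_iexp_diff_le: "cmod (iexp a - iexp b) \<le> \<bar>a - b\<bar>"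
proof -
  have "iexp a - iexp b = iexp b * (iexp (a - b) - 1)"
    by (simp add: algebra_simps exp_add[symmetric])
  then have "cmod (iexp a - iexp b) = cmod (iexp (a - b) - 1)"
    by (simp add: norm_mult)
  also have "\<dots> \<le> \<bar>a - b\<bar>" using iexp_approx1[of "a - b" 0] by simp
  finally show ?thesis .
qed

text \<open>Under the coupling the spiked data are stretched standard normal data, so the statistic is a bilinear
  form of the unspiked error matrix in the stretched vectors. As \<open>r\<^sub>n \<rightarrow> 0\<close> these approach \<open>\<tau>\<^sub>n\<close>
  and \<open>w\<^sub>n = \<theta> + \<tau>\<^sub>n / 2\<close>, which are orthogonal, and the exact law for orthogonal directions takes over.
  The limiting standard deviation is \<open>|\<tau>'| |w'|\<close> with \<open>|w'|\<^sup>2 = 1 - |\<tau>'|\<^sup>2 / 4\<close>.\<close>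

lemma moderate_central_sequence_limit:
  fixes \<theta> :: "real ^ 'p"
  assumes \<theta>: "norm \<theta> = 1" and v: "v > 0" and r: "\<forall>n\<ge>1. r n > 0" and r0: "r \<longlonglongrightarrow> 0"
    and \<tau>: "admissible \<theta> (\<lambda>n. 1) \<tau>" and lim: "\<tau> \<longlonglongrightarrow> \<tau>'"
  shows "conv_in_distr (\<lambda>n. sample_law n \<theta> (r n) v)
    (\<lambda>n x. \<tau> n \<bullet> (sqrt (real n) *\<^sub>R ((sample_cov n x - spiked_cov \<theta> (r n) v) *v (\<theta> + (1 / 2) *\<^sub>R \<tau> n))))
    (normal_law 0 (norm \<tau>' ^ 2 - 1 / 4 * norm \<tau>' ^ 4))"
  (is "conv_in_distr ?M ?U ?L")
proof -
  obtain T where T: "T > 0" "\<And>n. n \<ge> 1 \<Longrightarrow> norm (\<tau> n) \<le> T" "\<And>n. n \<ge> 1 \<Longrightarrow> norm (\<theta> + 1 *\<^sub>R \<tau> n) = 1"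
    by (rule admissible_bound[OF \<tau>]) blast
  have \<theta>\<theta>: "\<theta> \<bullet> \<theta> = 1" using \<theta> by (simp add: dot_square_norm)
  define w where "w n = \<theta> + (1 / 2) *\<^sub>R \<tau> n" for n
  define w' where "w' = \<theta> + (1 / 2) *\<^sub>R \<tau>'"
  define \<sigma> where "\<sigma> = norm \<tau>' * norm w'"
  let ?s = "\<lambda>n. sqrt (1 + r n * v)" and ?A = "\<lambda>n. stretch \<theta> (sqrt (1 + r n * v))"
  let ?N = "\<lambda>n. sample_law n \<theta> 0 v" and ?E = "\<lambda>n z. scaled_error \<theta> 0 v n z"
  let ?R = "\<lambda>n. \<Pi>\<^sub>M i\<in>{1..n}. (gauss :: real measure)"
  have U: "?U n x = \<tau> n \<bullet> (scaled_error \<theta> (r n) v n x *v w n)" for n x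
    by (simp add: scaled_error_mult_vec w_def)
  have Um [measurable]: "?U n \<in> borel_measurable (?M n)" for n
    unfolding U by measurable
  have orth: "\<tau> n \<bullet> w n = 0" if "n \<ge> 1" for n
    using unit_perturbation(1)[OF \<theta> T(3)[OF that]]
    by (simp add: w_def inner_add_right inner_commute power2_norm_eq_inner)
  have w_lim: "(\<lambda>n. norm (\<tau> n) * norm (w n)) \<longlonglongrightarrow> \<sigma>"
    unfolding w_def \<sigma>_def w'_def by (intro tendsto_intros lim)
  have \<sigma>: "sqrt (norm \<tau>' ^ 2 - 1 / 4 * norm \<tau>' ^ 4) = \<sigma>"
  proof -
    have "(\<lambda>n. norm (\<theta> + 1 *\<^sub>R \<tau> n)) \<longlonglongrightarrow> norm (\<theta> + 1 *\<^sub>R \<tau>')" by (intro tendsto_intros lim)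
    moreover have "(\<lambda>n. norm (\<theta> + 1 *\<^sub>R \<tau> n)) \<longlonglongrightarrow> 1"
      by (rule tendsto_eventually) (use T(3) in \<open>auto simp: eventually_sequentially intro!: exI[of _ 1]\<close>)
    ultimately have "norm (\<theta> + 1 *\<^sub>R \<tau>') = 1" by (rule LIMSEQ_unique)
    from unit_perturbation(1)[OF \<theta> this] have "\<theta> \<bullet> \<tau>' = - (norm \<tau>')\<^sup>2 / 2" by simp
    then have w2: "(norm w')\<^sup>2 = 1 - (norm \<tau>')\<^sup>2 / 4"
      unfolding power2_norm_eq_inner[of w']
      by (simp add: w'_def inner_add_left inner_add_right \<theta>\<theta> inner_commute[of \<tau>' \<theta>] power2_norm_eq_inner)
    have "\<sigma>\<^sup>2 = norm \<tau>' ^ 2 - 1 / 4 * norm \<tau>' ^ 4"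
      unfolding \<sigma>_def power_mult_distrib w2
      by (simp add: power2_eq_square power4_eq_xxxx algebra_simps)
    moreover have "0 \<le> \<sigma>" by (simp add: \<sigma>_def)
    ultimately show ?thesis by (metis real_sqrt_unique)
  qed
  have L: "?L = distr gauss borel (\<lambda>y. \<sigma> * y)"
    unfolding normal_law_def \<sigma> gauss_real by simp
  have L_real: "real_distribution ?L"
    unfolding L by (rule gauss.real_distribution_distr) simp
  have "weak_conv_m (\<lambda>n. distr (?M n) borel (?U n)) ?L"
  proof (rule levy_continuity)
    show "real_distribution (distr (?M n) borel (?U n))" for n
      by (rule prob_space.real_distribution_distr[OF prob_space_sample_law Um])
    show "real_distribution ?L" by (rule L_real)
    fix t :: real
    let ?g = "\<lambda>u::real. iexp (t * u)"
    have gc: "continuous_on UNIV ?g" by (intro continuous_intros)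
    have [measurable]: "?g \<in> borel_measurable borel" by (rule borel_measurable_continuous_onI[OF gc])
    \<comment> \<open>The statistic with unstretched vectors has an exact scale mixture law.\<close>
    have "(\<lambda>n. \<integral>p. ?g ((norm (\<tau> n) * norm (w n) * sqrt (sample_var n (fst p))) *\<^sub>R snd p) \<partial>(?R n \<Otimes>\<^sub>M gauss))
        \<longlonglongrightarrow> (\<integral>y. ?g (\<sigma> *\<^sub>R y) \<partial>gauss)"
    proof (rule scale_mixture_limit[where f = ?g and B = 1
          and A = "\<lambda>n \<zeta>. norm (\<tau> n) * norm (w n) * sqrt (sample_var n \<zeta>)"])
      show "prob_space (?R n)" for n by (intro prob_space_PiM prob_space_gauss)
      show "(\<lambda>\<zeta>. norm (\<tau> n) * norm (w n) * sqrt (sample_var n \<zeta>)) \<in> borel_measurable (?R n)" for n by measurable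
      show "cmod (?g y) \<le> 1" for y by simp
    qed (rule sqrt_sample_var_L1[OF w_lim] gc | assumption)+
    then have main: "(\<lambda>n. \<integral>z. ?g (\<tau> n \<bullet> (?E n z *v w n)) \<partial>?N n) \<longlonglongrightarrow> (\<integral>y. ?g (\<sigma> *\<^sub>R y) \<partial>gauss)"
    proof (rule Lim_transform_eventually)
      have "(\<integral>z. ?g (\<tau> n \<bullet> (?E n z *v w n)) \<partial>?N n) =
          (\<integral>p. ?g ((norm (\<tau> n) * norm (w n) * sqrt (sample_var n (fst p))) *\<^sub>R snd p) \<partial>(?R n \<Otimes>\<^sub>M gauss))"
        if n: "n \<ge> 1" for n
      proof -
        have "\<tau> n \<bullet> (?E n z *v w n) = \<tau> n \<bullet> (sqrt (real n) *\<^sub>R (sample_cov n z *v w n))" for z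
          unfolding scaled_error_mult_vec matrix_vector_mult_diff_rdistrib spiked_cov_mult_vec
          using orth[OF n] by (simp add: inner_diff_right)
        then show ?thesis
          by (simp only:) (rule integral_cross_cov_orthogonal[OF n orth[OF n]], measurable)
      qed
      then show "\<forall>\<^sub>F n in sequentially.
          (\<integral>p. ?g ((norm (\<tau> n) * norm (w n) * sqrt (sample_var n (fst p))) *\<^sub>R snd p) \<partial>(?R n \<Otimes>\<^sub>M gauss)) =
          (\<integral>z. ?g (\<tau> n \<bullet> (?E n z *v w n)) \<partial>?N n)"
        by (auto simp: eventually_sequentially intro!: exI[of _ 1])
    qed
    \<comment> \<open>Stretching the two vectors changes the characteristic function by at most \<open>|t| d\<^sub>n K\<close>, and \<open>d\<^sub>n \<rightarrow> 0\<close>.\<close>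
    define K where "K = 1 + (real CARD('p))\<^sup>2 * (1 + 8 * (1 + 0)\<^sup>2) + (1 + (real CARD('p))\<^sup>2) * (real CARD('p) * (1 + 0))"
    let ?d = "\<lambda>n. \<bar>?s n - 1\<bar> * (T * (1 + T) * (?s n + 1))"
    have diff: "cmod ((\<integral>x. ?g (?U n x) \<partial>?M n) - (\<integral>z. ?g (\<tau> n \<bullet> (?E n z *v w n)) \<partial>?N n)) \<le> \<bar>t\<bar> * (?d n * K)"
      if n: "n \<ge> 1" for n
    proof -
      interpret N: prob_space "?N n" by (rule prob_space_sample_law)
      have rv: "0 \<le> r n * v" using r v n by (simp add: less_imp_le)
      have s: "1 \<le> ?s n" "(?s n)\<^sup>2 = 1 + r n * v" using rv by auto
      let ?X = "\<lambda>z. \<lambda>i\<in>{1..n}. ?A n (z i)"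
      have Xm: "?X \<in> measurable (?N n) (\<Pi>\<^sub>M i\<in>{1..n}. borel)"
        by measurable
      have UX: "?U n (?X z) = ?A n (\<tau> n) \<bullet> (?E n z *v ?A n (w n))" for z
      proof -
        have "\<tau> n \<bullet> (sample_cov n (?X z) *v w n) = ?A n (\<tau> n) \<bullet> (sample_cov n z *v ?A n (w n))"
          unfolding sample_cov_stretch by (rule inner_stretch)
        moreover have "\<tau> n \<bullet> (spiked_cov \<theta> (r n) v *v w n) = ?A n (\<tau> n) \<bullet> ?A n (w n)"
          unfolding stretch_inner_stretch[OF \<theta>] s(2) spiked_cov_mult_vec
          by (simp add: inner_add_right inner_commute)
        moreover have "spiked_cov \<theta> 0 v *v u = u" for u by (simp add: spiked_cov_mult_vec)
        ultimately show ?thesis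
          unfolding w_def[symmetric] scaled_error_mult_vec matrix_vector_mult_diff_rdistrib
          by (simp only: inner_scaleR_right inner_diff_right)
      qed
      have UXm: "(\<lambda>z. ?U n (?X z)) \<in> borel_measurable (?N n)" unfolding UX by measurable
      have push: "(\<integral>x. ?g (?U n x) \<partial>?M n) = (\<integral>z. ?g (?U n (?X z)) \<partial>?N n)"
        unfolding sample_law_stretch[OF \<theta> rv]
        by (rule integral_distr[OF Xm]) (use Um[of n] in \<open>simp only: measurable_cong_sets[OF sets_sample_law refl], measurable\<close>)
      have N: "norm (\<tau> n) \<le> T" using T(2)[OF n] .
      have W: "norm (w n) \<le> 1 + T"
      proof -
        have "norm (w n) \<le> norm \<theta> + norm ((1 / 2) *\<^sub>R \<tau> n)" unfolding w_def by (rule norm_triangle_ineq)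
        also have "\<dots> \<le> 1 + T" using \<theta> N T(1) by simp
        finally show ?thesis .
      qed
      have close: "\<bar>?U n (?X z) - \<tau> n \<bullet> (?E n z *v w n)\<bar> \<le> ?d n * fluct \<theta> 0 v n z" for z
      proof -
        let ?F = "fluct \<theta> 0 v n z"
        have a: "norm (?A n (\<tau> n) - \<tau> n) \<le> \<bar>?s n - 1\<bar> * T"
          by (rule order_trans[OF stretch_minus_id_le[OF \<theta>]]) (intro mult_left_mono N, simp)
        have b: "norm (?A n (w n) - w n) \<le> \<bar>?s n - 1\<bar> * (1 + T)"
          by (rule order_trans[OF stretch_minus_id_le[OF \<theta>]]) (intro mult_left_mono W, simp)
        have c: "norm (?A n (w n)) \<le> ?s n * (1 + T)"
          by (rule order_trans[OF norm_stretch_le[OF \<theta> s(1)]]) (use s(1) in \<open>intro mult_left_mono W, simp\<close>)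
        have "?U n (?X z) - \<tau> n \<bullet> (?E n z *v w n) =
            (?A n (\<tau> n) - \<tau> n) \<bullet> (?E n z *v ?A n (w n)) + \<tau> n \<bullet> (?E n z *v (?A n (w n) - w n))"
          unfolding UX by (simp add: inner_diff_left inner_diff_right matrix_vector_mult_diff_distrib)
        also have "\<bar>\<dots>\<bar> \<le> (\<bar>?s n - 1\<bar> * T) * (?s n * (1 + T)) * ?F + T * (\<bar>?s n - 1\<bar> * (1 + T)) * ?F"
          by (rule order_trans[OF abs_triangle_ineq add_mono[OF fluct_bilinear_le[OF a c] fluct_bilinear_le[OF N b]]])
        also have "\<dots> = ?d n * ?F" by (simp add: algebra_simps)
        finally show ?thesis .
      qed
      have E: "integrable (?N n) (fluct \<theta> 0 v n)" "(\<integral>z. fluct \<theta> 0 v n z \<partial>?N n) \<le> K"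
        using fluct_bounded_expectation[OF \<theta>, of 0 v 0 n] n by (simp_all add: K_def)
      have i1: "integrable (?N n) (\<lambda>z. ?g (?U n (?X z)))"
        by (rule N.integrable_const_bound[of _ 1]) (simp, use UXm in measurable)
      have i2: "integrable (?N n) (\<lambda>z. ?g (\<tau> n \<bullet> (?E n z *v w n)))"
        by (rule N.integrable_const_bound[of _ 1]) (simp, measurable)
      have D: "(\<integral>x. ?g (?U n x) \<partial>?M n) - (\<integral>z. ?g (\<tau> n \<bullet> (?E n z *v w n)) \<partial>?N n) =
          (\<integral>z. ?g (?U n (?X z)) - ?g (\<tau> n \<bullet> (?E n z *v w n)) \<partial>?N n)"
        unfolding push by (rule Bochner_Integration.integral_diff[OF i1 i2, symmetric])
      have "cmod ((\<integral>x. ?g (?U n x) \<partial>?M n) - (\<integral>z. ?g (\<tau> n \<bullet> (?E n z *v w n)) \<partial>?N n)) \<le>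
          (\<integral>z. cmod (?g (?U n (?X z)) - ?g (\<tau> n \<bullet> (?E n z *v w n))) \<partial>?N n)"
        unfolding D by (rule integral_norm_bound)
      also have "\<dots> \<le> (\<integral>z. \<bar>t\<bar> * (?d n * fluct \<theta> 0 v n z) \<partial>?N n)"
      proof (rule integral_mono)
        show "integrable (?N n) (\<lambda>z. cmod (?g (?U n (?X z)) - ?g (\<tau> n \<bullet> (?E n z *v w n))))"
          by (intro integrable_norm Bochner_Integration.integrable_diff i1 i2)
        show "integrable (?N n) (\<lambda>z. \<bar>t\<bar> * (?d n * fluct \<theta> 0 v n z))"
          by (intro integrable_mult_right E(1))
        fix z
        have "cmod (?g (?U n (?X z)) - ?g (\<tau> n \<bullet> (?E n z *v w n))) \<le>
            \<bar>t * ?U n (?X z) - t * (\<tau> n \<bullet> (?E n z *v w n))\<bar>"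
          by (rule cmod_iexp_diff_le)
        also have "\<dots> = \<bar>t\<bar> * \<bar>?U n (?X z) - \<tau> n \<bullet> (?E n z *v w n)\<bar>"
          by (simp only: right_diff_distrib[symmetric] abs_mult)
        also have "\<dots> \<le> \<bar>t\<bar> * (?d n * fluct \<theta> 0 v n z)" by (intro mult_left_mono close) simp
        finally show "cmod (?g (?U n (?X z)) - ?g (\<tau> n \<bullet> (?E n z *v w n))) \<le> \<bar>t\<bar> * (?d n * fluct \<theta> 0 v n z)" .
      qed
      also have "\<dots> = \<bar>t\<bar> * (?d n * (\<integral>z. fluct \<theta> 0 v n z \<partial>?N n))" by simp
      also have "\<dots> \<le> \<bar>t\<bar> * (?d n * K)"
      proof (intro mult_left_mono E(2))
        show "0 \<le> ?d n" using s(1) T(1) by (intro mult_nonneg_nonneg) auto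
      qed simp
      finally show ?thesis .
    qed
    have "(\<lambda>n. \<bar>t\<bar> * (?d n * K)) \<longlonglongrightarrow> \<bar>t\<bar> * (\<bar>sqrt (1 + 0 * v) - 1\<bar> * (T * (1 + T) * (sqrt (1 + 0 * v) + 1)) * K)"
      by (intro tendsto_intros r0)
    then have d0: "(\<lambda>n. \<bar>t\<bar> * (?d n * K)) \<longlonglongrightarrow> 0" by simp
    have "(\<lambda>n. (\<integral>x. ?g (?U n x) \<partial>?M n) - (\<integral>z. ?g (\<tau> n \<bullet> (?E n z *v w n)) \<partial>?N n)) \<longlonglongrightarrow> 0"
      by (rule Lim_null_comparison[OF _ d0]) (use diff in \<open>auto simp: eventually_sequentially intro!: exI[of _ 1]\<close>)
    from tendsto_add[OF this main]
    have "(\<lambda>n. \<integral>x. ?g (?U n x) \<partial>?M n) \<longlonglongrightarrow> (\<integral>y. ?g (\<sigma> *\<^sub>R y) \<partial>gauss)" by simp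
    moreover have "char (distr (?M n) borel (?U n)) t = (\<integral>x. ?g (?U n x) \<partial>?M n)" for n
      unfolding char_def by (rule integral_distr[OF Um]) simp
    moreover have "char ?L t = (\<integral>y. ?g (\<sigma> *\<^sub>R y) \<partial>gauss)"
      unfolding char_def L by (subst integral_distr) auto
    ultimately show "(\<lambda>n. char (distr (?M n) borel (?U n)) t) \<longlonglongrightarrow> char ?L t" by (simp only:)
  qed
  then show ?thesis
    by (rule conv_in_distr_iff_weak_conv_m[OF prob_space_sample_law Um L_real, THEN iffD2])
qed

section \<open>The four regimes\<close>

theorem theorem4p1:
  fixes \<theta> :: "real ^ 'p" and v :: real and r :: "nat \<Rightarrow> real"
  assumes "CARD('p) \<ge> 2" and "norm \<theta> = 1" and "v > 0"
    and "\<forall>n\<ge>1. r n > 0" and "bounded (r ` {1..})"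
  shows
    "((\<forall>n\<ge>1. r n = 1) \<longrightarrow>
       (let \<nu> = (\<lambda>n. 1 / sqrt (real n));
            \<Delta> = (\<lambda>n x. (v / (1 + v) * sqrt (real n)) *\<^sub>R
                   ((mat 1 - outer \<theta> \<theta>) *v ((sample_cov n x - spiked_cov \<theta> (r n) v) *v \<theta>)));
            \<Gamma> = (v\<^sup>2 / (1 + v)) *\<^sub>R (mat 1 - outer \<theta> \<theta>)
        in (\<forall>\<tau>. admissible \<theta> \<nu> \<tau> \<longrightarrow>
              is_oP1 (\<lambda>n. sample_law n \<theta> (r n) v)
                (\<lambda>n x. log_lik_ratio \<theta> r v \<nu> \<tau> n x
                        - (\<tau> n \<bullet> \<Delta> n x - 1 / 2 * (\<tau> n \<bullet> (\<Gamma> *v \<tau> n))))) \<and>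
           conv_in_distr (\<lambda>n. sample_law n \<theta> (r n) v) \<Delta> (mv_normal 0 \<Gamma>))) \<and>
     (r \<longlonglongrightarrow> 0 \<and> filterlim (\<lambda>n. sqrt (real n) * r n) at_top sequentially \<longrightarrow>
       (let \<nu> = (\<lambda>n. 1 / (sqrt (real n) * r n));
            \<Delta> = (\<lambda>n x. (v * sqrt (real n)) *\<^sub>R
                   ((mat 1 - outer \<theta> \<theta>) *v ((sample_cov n x - spiked_cov \<theta> (r n) v) *v \<theta>)));
            \<Gamma> = v\<^sup>2 *\<^sub>R (mat 1 - outer \<theta> \<theta>)
        in (\<forall>\<tau>. admissible \<theta> \<nu> \<tau> \<longrightarrow>
              is_oP1 (\<lambda>n. sample_law n \<theta> (r n) v)
                (\<lambda>n x. log_lik_ratio \<theta> r v \<nu> \<tau> n x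
                        - (\<tau> n \<bullet> \<Delta> n x - 1 / 2 * (\<tau> n \<bullet> (\<Gamma> *v \<tau> n))))) \<and>
           conv_in_distr (\<lambda>n. sample_law n \<theta> (r n) v) \<Delta> (mv_normal 0 \<Gamma>))) \<and>
     ((\<forall>n\<ge>1. r n = 1 / sqrt (real n)) \<longrightarrow>
       (\<forall>\<tau>. admissible \<theta> (\<lambda>n. 1) \<tau> \<longrightarrow>
          is_oP1 (\<lambda>n. sample_law n \<theta> (r n) v)
            (\<lambda>n x. log_lik_ratio \<theta> r v (\<lambda>n. 1) \<tau> n x
                    - (\<tau> n \<bullet> ((v * sqrt (real n)) *\<^sub>R
                          ((sample_cov n x - spiked_cov \<theta> (r n) v) *v (\<theta> + (1 / 2) *\<^sub>R \<tau> n)))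
                       - v\<^sup>2 / 2 * norm (\<tau> n) ^ 2 + v\<^sup>2 / 8 * norm (\<tau> n) ^ 4)) \<and>
          (\<forall>\<tau>'. \<tau> \<longlonglongrightarrow> \<tau>' \<longrightarrow>
             conv_in_distr (\<lambda>n. sample_law n \<theta> (r n) v)
               (\<lambda>n x. \<tau> n \<bullet> (sqrt (real n) *\<^sub>R
                   ((sample_cov n x - spiked_cov \<theta> (r n) v) *v (\<theta> + (1 / 2) *\<^sub>R \<tau> n))))
               (normal_law 0 (norm \<tau>' ^ 2 - 1 / 4 * norm \<tau>' ^ 4))))) \<and>
     (r \<in> o(\<lambda>n. 1 / sqrt (real n)) \<longrightarrow>
       (\<forall>\<tau>. admissible \<theta> (\<lambda>n. 1) \<tau> \<longrightarrow>
          is_oP1 (\<lambda>n. sample_law n \<theta> (r n) v) (log_lik_ratio \<theta> r v (\<lambda>n. 1) \<tau>)))"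
proof (intro conjI impI, goal_cases)
  case 1
  have c: "(\<lambda>n. v / (1 + r n * v)) \<longlonglongrightarrow> v / (1 + v)"
    by (rule tendsto_eventually) (use 1 in \<open>auto simp: eventually_sequentially intro!: exI[of _ 1]\<close>)
  have vc: "v\<^sup>2 / (1 + v) = v * (v / (1 + v))" by (simp add: power2_eq_square)
  have pos: "0 < v / (1 + v)" using assms(3) by simp
  note r1 = 1
  show ?case
    unfolding Let_def vc
  proof (intro conjI allI impI, goal_cases)
    case (1 \<tau>)
    then show ?case
      by (intro lan_expansion assms(2-5) c inverse_sqrt_tendsto_0) (use r1 in auto)
  qed (rule lan_central_sequence_limit[OF assms(2-4) c pos])
next
  case 2
  have c: "(\<lambda>n. v / (1 + r n * v)) \<longlonglongrightarrow> v"
    using 2 by (auto intro!: tendsto_eq_intros)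
  have \<nu>0: "(\<lambda>n. 1 / (sqrt (real n) * r n)) \<longlonglongrightarrow> 0"
    using 2 by (intro real_tendsto_divide_at_top[OF tendsto_const]) auto
  have \<nu>: "1 / (sqrt (real n) * r n) > 0" "sqrt (real n) * r n * (1 / (sqrt (real n) * r n)) = 1"
    if "n \<ge> 1" for n
  proof -
    have "r n > 0" using assms(4) that by simp
    then show "1 / (sqrt (real n) * r n) > 0" "sqrt (real n) * r n * (1 / (sqrt (real n) * r n)) = 1"
      using that by simp_all
  qed
  show ?case
    unfolding Let_def power2_eq_square
  proof (intro conjI allI impI, goal_cases)
    case (1 \<tau>)
    then show ?case by (intro lan_expansion assms(2-5) c \<nu>0 \<nu>)
  qed (rule lan_central_sequence_limit[OF assms(2-4) c assms(3)])
next
  case 3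
  have r0: "r \<longlonglongrightarrow> 0"
    by (rule Lim_transform_eventually[OF inverse_sqrt_tendsto_0])
      (use 3 in \<open>auto simp: eventually_sequentially intro!: exI[of _ 1]\<close>)
  show ?case
    using moderate_expansion[OF assms(2,3) 3] moderate_central_sequence_limit[OF assms(2-4) r0] by blast
next
  case 4
  from smalloD_tendsto[OF this] have "(\<lambda>n. sqrt (real n) * r n) \<longlonglongrightarrow> 0"
    by (simp add: mult.commute)
  then show ?case
    using weak_expansion[OF assms(2-5)] by blast
qed

end
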